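(* Let $a>0$, $x>0$, $0<\theta<1$, let $k\geq 0$ be an even integer, and let $\nu\in\mathbb{C}$ with $\Re(\nu)>0$. Then \begin{align*} &\left(\frac{a^2x}{4}\right)^{\frac{\nu}{2}+k+1}\sum_{n=1}^{\infty} n^{\nu/2}K_{\nu}(a\sqrt{nx})\sum_{d\mid n}d^k\sin(2\pi d\theta)\\ &= -\frac{(-1)^{k/2}a^{2k+2}k!}{2^{2k+4}(2\pi)^{k+1}}\Gamma(\nu)\bigl(\zeta(1+k,\theta)-\zeta(1+k,1-\theta)\bigr)x^{k+1} +\delta_k\,\frac{\pi\Gamma(1+\nu)}{4}\bigl(\zeta(0,\theta)-\zeta(0,1-\theta)\bigr)\\ &\quad+\frac{(-1)^{k/2}}{4}(2\pi)^{k+1}\sum_{d=1}^{\infty}d^k\sum_{m=0}^{\infty}\left\{\frac{\Gamma(\nu+k+1)}{\left(1+\frac{16\pi^2d}{a^2x}(m+\theta)\right)^{1+\nu+k}}-\frac{\Gamma(\nu+k+1)}{\left(1+\frac{16\pi^2d}{a^2x}(m+1-\theta)\right)^{1+\nu+k}}\right\}, \end{align*} where $\delta_k=1$ if $k=0$ and $\delta_k=0$ otherwise.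
   Context: $K_\nu$ denotes the modified Bessel function of the second kind of order $\nu$. $\zeta(s,\alpha)=\sum_{n=0}^\infty (n+\alpha)^{-s}$ (for $\Re s>1$, $0<\alpha\le 1$) is the Hurwitz zeta function, meromorphically continued to $\mathbb{C}$ with its only pole at $s=1$. When $k=0$ the expression $\zeta(1,\theta)-\zeta(1,1-\theta)$ is understood as $\lim_{s\to 1}(\zeta(s,\theta)-\zeta(s,1-\theta))$. *)

theory Defs
  imports "HOL-Analysis.Analysis" "HOL-Complex_Analysis.Complex_Analysis"
begin

definition besselK :: "complex \<Rightarrow> real \<Rightarrow> complex" where
  "besselK \<nu> z = integral {0..} (\<lambda>t::real. complex_of_real (exp (- z * cosh t)) * cosh (\<nu> * complex_of_real t))"

text \<open>Hurwitz zeta function: the unique function holomorphic on C minus {1} that agrees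
  with the Dirichlet series for Re s > 1 (the value at the pole s = 1 is fixed to 0
  by convention only to make the description unique; it is never used).\<close>
definition hurwitz_zeta :: "complex \<Rightarrow> real \<Rightarrow> complex" where
  "hurwitz_zeta s \<alpha> = (THE f. f holomorphic_on (- {1}) \<and> f 1 = 0 \<and>
      (\<forall>z. Re z > 1 \<longrightarrow> f z = (\<Sum>n. complex_of_real (real n + \<alpha>) powr (- z)))) s"

end

theory Submission
  imports Defs "HOL-Real_Asymp.Real_Asymp"
begin

text \<open>
  Put \<open>X = a\<^sup>2 x / 4\<close>. The substitution \<open>w = \<surd>(nX) exp t\<close> in the integral for \<open>K\<^sub>\<nu>\<close> turns
  \<open>n\<^bsup>\<nu>/2\<^esup> K\<^sub>\<nu>(a \<surd>(nx))\<close> into a multiple of \<open>\<integral> w\<^bsup>\<nu>-1\<^esup> exp (- w - nX/w) dw\<close>, so the left-hand side is the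
  integral of \<open>w\<^bsup>\<nu>-1\<^esup> exp (- w)\<close> against the Lambert series
  \<open>S(t) = \<Sum>\<^sub>d d\<^sup>k sin (2 \<pi> d \<theta>) / (exp (d t) - 1)\<close> at \<open>t = X/w\<close>. A theta-type transformation expresses
  \<open>S(t)\<close> by a constant, a multiple of \<open>1/t\<close> (only for \<open>k = 0\<close>) and a series of exponentials in
  \<open>1/t\<close>; integrating term by term with the Gamma integral gives the three terms on the right.

  For \<open>k = 0\<close> the transformation is obtained by expanding each summand over \<open>m\<close> of the Lambert series
  by the partial fractions of the cotangent and summing over \<open>m\<close> first. The resulting double series
  converges only conditionally; subtracting a multiple of a telescoping series makes it absolutely
  convergent, and the telescoping series accounts for the \<open>1/t\<close> term. The case of general even \<open>k\<close>
  follows by differentiating \<open>k\<close> times with respect to \<open>\<theta>\<close>.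
\<close>

section \<open>Swapping double sums\<close>

text \<open>Let p = n + i y with y = (m + 1) t / (2 pi). Then 1/(p + \<theta>) - 1/(p + 1 -
  \<theta>) behaves like (1 - 2\<theta>)/p^2, and the sum of 1/|p|^2 over the lattice diverges
  logarithmically, which forbids a plain exchange. The differences 1/p - 1/(p + 1), times 1 -
  2\<theta>, have the same leading term. Their real parts sum to 0 over n for each m, but summing
  over m before n leaves the boundary value -c/4 with c = 4 pi^2/t; this discrepancy between the two
  orders is the 1/t term. Evenness of k matters because two derivatives in \<theta> return sines to
  sines, while they kill the linear 1 - 2\<theta>; hence the \<delta> term. The cotangent is the
  reflection difference of Digamma, its derivatives are Polygamma differences, and these are the
  Hurwitz zeta differences at 1 + k. As \<open>hurwitz_zeta\<close> is given by a definite
  description, a continuation has to be constructed before any value can be used. Writing it as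
  \<open>rGamma s / (s - 1)\<close> plus an entire function exposes the value at 0 and makes the
  poles for \<theta> and 1 - \<theta> cancel.\<close>

lemma product_bounded_summable_on:
  fixes f :: "nat \<Rightarrow> nat \<Rightarrow> 'a :: banach" and A B :: "nat \<Rightarrow> real"
  assumes "\<And>m n. norm (f m n) \<le> A m * B n" and "summable A" "summable B"
    and "\<And>m. A m \<ge> 0" "\<And>n. B n \<ge> 0"
  shows "(\<lambda>(m, n). f m n) summable_on UNIV \<times> UNIV"
proof -
  have *: "(\<lambda>x. norm (A x)) summable_on UNIV" "(\<lambda>x. norm (B x)) summable_on UNIV"
    using assms by (auto intro!: norm_summable_imp_summable_on simp: abs_of_nonneg)
  have "(\<lambda>x. norm (case x of (m, n) \<Rightarrow> A m * B n)) summable_on UNIV \<times> UNIV"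
    using * by (subst Infinite_Sum.abs_summable_on_Sigma_iff)
      (auto simp: abs_mult infsum_cmult_right' intro!: summable_on_cmult_right summable_on_cmult_left)
  hence "(\<lambda>x. norm (case x of (m, n) \<Rightarrow> f m n)) summable_on UNIV \<times> UNIV"
    by (rule Infinite_Sum.abs_summable_on_comparison_test)
       (use assms in \<open>auto simp: abs_mult\<close>)
  thus ?thesis
    by (rule Infinite_Sum.abs_summable_summable)
qed

text \<open>A product majorant makes the family summable over pairs, where order is irrelevant; the
  remaining work converts between \<open>infsum\<close> and \<open>suminf\<close>. All exchanges of
  two series in the theta identity go through this form.\<close>

lemma suminf_swap_product_bound:
  fixes f :: "nat \<Rightarrow> nat \<Rightarrow> 'a :: banach" and A B :: "nat \<Rightarrow> real"
  assumes bound: "\<And>m n. norm (f m n) \<le> A m * B n" and "summable A" "summable B"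
    and "\<And>m. A m \<ge> 0" "\<And>n. B n \<ge> 0"
  shows "summable (\<lambda>m. \<Sum>n. f m n)" "summable (\<lambda>n. \<Sum>m. f m n)"
    "(\<Sum>m. \<Sum>n. f m n) = (\<Sum>n. \<Sum>m. f m n)"
proof -
  have sm: "summable (\<lambda>n. norm (f m n))" for m
    by (rule summable_comparison_test'[of "\<lambda>n. A m * B n"]) (use assms in \<open>auto intro: summable_mult\<close>)
  have sn: "summable (\<lambda>m. norm (f m n))" for n
    by (rule summable_comparison_test'[of "\<lambda>m. A m * B n"]) (use assms in \<open>auto intro: summable_mult2\<close>)
  have im: "infsum (\<lambda>n. f m n) UNIV = (\<Sum>n. f m n)" for m
    using sm by (simp add: norm_summable_imp_has_sum infsumI summable_norm_cancel summable_sums)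
  have "infsum (\<lambda>m. f m n) UNIV = (\<Sum>m. f m n)" for n
    using sn by (simp add: norm_summable_imp_has_sum infsumI summable_norm_cancel summable_sums)
  note in' = this
  have bm: "norm (\<Sum>n. f m n) \<le> A m * (\<Sum>n. B n)" for m
  proof -
    have "norm (\<Sum>n. f m n) \<le> (\<Sum>n. norm (f m n))" by (rule summable_norm[OF sm])
    also have "\<dots> \<le> (\<Sum>n. A m * B n)" by (rule suminf_le) (use assms sm in \<open>auto intro: summable_mult\<close>)
    finally show ?thesis using assms by (simp add: suminf_mult)
  qed
  have bn: "norm (\<Sum>m. f m n) \<le> (\<Sum>m. A m) * B n" for n
  proof -
    have "norm (\<Sum>m. f m n) \<le> (\<Sum>m. norm (f m n))" by (rule summable_norm[OF sn])
    also have "\<dots> \<le> (\<Sum>m. A m * B n)" by (rule suminf_le) (use assms sn in \<open>auto intro: summable_mult2\<close>)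
    finally show ?thesis using assms by (simp add: suminf_mult2)
  qed
  have sM: "summable (\<lambda>m. norm (\<Sum>n. f m n))"
    by (rule summable_comparison_test'[of "\<lambda>m. A m * (\<Sum>n. B n)"]) (use bm assms in \<open>auto intro: summable_mult2\<close>)
  have sN: "summable (\<lambda>n. norm (\<Sum>m. f m n))"
    by (rule summable_comparison_test'[of "\<lambda>n. (\<Sum>m. A m) * B n"]) (use bn assms in \<open>auto intro: summable_mult\<close>)
  show "summable (\<lambda>m. \<Sum>n. f m n)" "summable (\<lambda>n. \<Sum>m. f m n)"
    using sM sN by (auto intro: summable_norm_cancel)
  have "infsum (\<lambda>m. infsum (\<lambda>n. f m n) UNIV) UNIV = infsum (\<lambda>n. infsum (\<lambda>m. f m n) UNIV) UNIV"
    by (rule infsum_swap_banach) (rule product_bounded_summable_on[OF assms])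
  also have "infsum (\<lambda>m. infsum (\<lambda>n. f m n) UNIV) UNIV = (\<Sum>m. \<Sum>n. f m n)"
    unfolding im using sM by (simp add: norm_summable_imp_has_sum infsumI summable_norm_cancel summable_sums)
  also have "infsum (\<lambda>n. infsum (\<lambda>m. f m n) UNIV) UNIV = (\<Sum>n. \<Sum>m. f m n)"
    unfolding in' using sN by (simp add: norm_summable_imp_has_sum infsumI summable_norm_cancel summable_sums)
  finally show "(\<Sum>m. \<Sum>n. f m n) = (\<Sum>n. \<Sum>m. f m n)" .
qed

text \<open>Grouping the pairs (d, m) by their product. Absolute summability of the pairs justifies
  the regrouping, and \<open>sm\<close> turns the resulting sum over n back into an ordinary
  series.\<close>

lemma suminf_divisors:
  fixes f :: "nat \<Rightarrow> nat \<Rightarrow> 'a :: banach" and A B :: "nat \<Rightarrow> real"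
  assumes bound: "\<And>d m. norm (f (Suc d) (Suc m)) \<le> A d * B m" and "summable A" "summable B"
    and "\<And>m. A m \<ge> 0" "\<And>n. B n \<ge> 0"
    and sm: "summable (\<lambda>n. norm (\<Sum>d | d dvd Suc n. f d (Suc n div d)))"
  shows "(\<Sum>n. \<Sum>d | d dvd Suc n. f d (Suc n div d)) = (\<Sum>d. \<Sum>m. f (Suc d) (Suc m))"
proof -
  have S: "(\<lambda>(d, m). f (Suc d) (Suc m)) summable_on UNIV \<times> UNIV"
    by (rule product_bounded_summable_on[OF assms(1-5)])
  have fsm: "summable (\<lambda>m. norm (f (Suc d) (Suc m)))" for d
    by (rule summable_comparison_test'[of "\<lambda>n. A d * B n"]) (use assms in \<open>auto intro: summable_mult\<close>)
  have sM: "summable (\<lambda>d. norm (\<Sum>m. f (Suc d) (Suc m)))"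
  proof (rule summable_comparison_test'[of "\<lambda>m. A m * (\<Sum>n. B n)"])
    show "norm (norm (\<Sum>m. f (Suc d) (Suc m))) \<le> A d * (\<Sum>n. B n)" for d
    proof -
      have "norm (\<Sum>n. f (Suc d) (Suc n)) \<le> (\<Sum>n. norm (f (Suc d) (Suc n)))" by (rule summable_norm[OF fsm])
      also have "\<dots> \<le> (\<Sum>n. A d * B n)" by (rule suminf_le) (use assms fsm in \<open>auto intro: summable_mult\<close>)
      finally show ?thesis using assms by (simp add: suminf_mult)
    qed
  qed (use assms in \<open>auto intro: summable_mult2\<close>)
  have div: "Suc (Suc d * Suc m - Suc 0) = Suc d * Suc m" "Suc d * Suc m div Suc d = Suc m" for d m
    by (simp, metis nat.simps(3) nonzero_mult_div_cancel_left)
  have dv: "Suc (d - Suc 0) = d" "Suc (Suc n div d - Suc 0) = Suc n div d" "d * (Suc n div d) = Suc n"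
    if "d dvd Suc n" for d n
    using that by (auto intro!: Suc_pred elim!: dvdE simp del: mult_Suc mult_Suc_right intro: Nat.gr0I)
      (metis Zero_not_Suc mult_is_0 neq0_conv nonzero_mult_div_cancel_left)+
  have "infsum (\<lambda>m. f (Suc d) (Suc m)) UNIV = (\<Sum>m. f (Suc d) (Suc m))" for d
    using fsm by (simp add: norm_summable_imp_has_sum infsumI summable_norm_cancel summable_sums)
  hence "(\<Sum>d. \<Sum>m. f (Suc d) (Suc m)) = infsum (\<lambda>d. infsum (\<lambda>m. f (Suc d) (Suc m)) UNIV) UNIV"
    using infsumI[OF norm_summable_imp_has_sum[OF sM summable_sums[OF summable_norm_cancel[OF sM]]]] by simp
  also have "\<dots> = infsum (\<lambda>(d, m). f (Suc d) (Suc m)) (UNIV \<times> UNIV)"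
    by (rule infsum_Sigma'_banach) (use S in simp)
  \<comment> \<open>Series indices start at 0 while divisors and products are positive: the pair (d,
    m) stands for the factors \<open>Suc d\<close> and \<open>Suc m\<close>, and n stands for their
    product \<open>Suc n\<close>. Hence the subtractions of 1 in both directions of the
    bijection.\<close>
  also have "\<dots> = infsum (\<lambda>(n, d). f d (Suc n div d)) (SIGMA n:UNIV. {d. d dvd Suc n})"
    by (rule infsum_reindex_bij_witness[where i = "\<lambda>(n, d). (d - 1, Suc n div d - 1)"
          and j = "\<lambda>(d, m). (Suc d * Suc m - 1, Suc d)"])
       (auto simp: div dv simp del: mult_Suc mult_Suc_right)
  also have "\<dots> = infsum (\<lambda>n. infsum (\<lambda>d. f d (Suc n div d)) {d. d dvd Suc n}) UNIV"
  proof (rule infsum_Sigma'_banach [symmetric])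
    have "(\<lambda>(d, m). f (Suc d) (Suc m)) summable_on UNIV \<times> UNIV \<longleftrightarrow>
      (\<lambda>(n, d). f d (Suc n div d)) summable_on (SIGMA n:UNIV. {d. d dvd Suc n})"
      by (rule summable_on_reindex_bij_witness[where i = "\<lambda>(n, d). (d - 1, Suc n div d - 1)"
          and j = "\<lambda>(d, m). (Suc d * Suc m - 1, Suc d)"])
         (auto simp: div dv simp del: mult_Suc mult_Suc_right)
    thus "(\<lambda>(n, d). f d (Suc n div d)) summable_on (SIGMA n:UNIV. {d. d dvd Suc n})" using S by simp
  qed
  also have "\<dots> = infsum (\<lambda>n. \<Sum>d | d dvd Suc n. f d (Suc n div d)) UNIV"
    by (intro infsum_cong) auto
  also have "\<dots> = (\<Sum>n. \<Sum>d | d dvd Suc n. f d (Suc n div d))"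
    using sm by (simp add: norm_summable_imp_has_sum infsumI summable_norm_cancel summable_sums)
  finally show ?thesis by simp
qed

section \<open>Partial fractions of the cotangent, and geometric series of exponentials\<close>

lemma cot_conv_exp:
  fixes z :: complex
  assumes "exp (2 * \<i> * z) \<noteq> 1"
  shows "cot z = - \<i> * (1 + exp (2 * \<i> * z)) / (1 - exp (2 * \<i> * z))"
proof -
  define e where "e = exp (\<i> * z)"
  have e: "exp (2 * \<i> * z) = e ^ 2" "exp (- (\<i> * z)) = 1 / e" "e \<noteq> 0" unfolding e_def
    by (simp_all add: exp_minus field_simps flip: exp_double)
  have "cot z = ((e + 1 / e) / 2) / ((e - 1 / e) / (2 * \<i>))"
    using e by (simp add: cot_def cos_exp_eq sin_exp_eq e_def)
  also have "\<dots> = - \<i> * (1 + e ^ 2) / (1 - e ^ 2)"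
    using e assms by (simp add: divide_simps power2_eq_square) (simp add: algebra_simps)
  finally show ?thesis by (simp add: e)
qed

text \<open>In the difference of the two defining series the harmonic terms and the Euler-Mascheroni
  constant cancel.\<close>

lemma Digamma_diff_sums:
  fixes z w :: complex
  assumes "z \<notin> \<int>\<^sub>\<le>\<^sub>0" "w \<notin> \<int>\<^sub>\<le>\<^sub>0"
  shows "(\<lambda>n. 1 / (of_nat n + z) - 1 / (of_nat n + w)) sums (Digamma w - Digamma z)"
proof -
  have "(\<lambda>n. inverse (of_nat (Suc n)) - inverse (z + of_nat n)) sums (Digamma z + euler_mascheroni)"
    if "z \<notin> \<int>\<^sub>\<le>\<^sub>0" for z :: complex
    using summable_Digamma[of z] that by (auto simp: Digamma_def sums_iff)
  from sums_diff[OF this[OF assms(2)] this[OF assms(1)]] show ?thesis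
    by (simp add: inverse_eq_divide add_ac)
qed

text \<open>Logarithmic differentiation of the reflection formula: the derivative of
  \<open>Gamma z * Gamma (1 - z)\<close> is computed once by the product rule and once from pi /
  sin(pi z).\<close>

lemma Digamma_reflection:
  fixes z :: complex
  assumes "z \<notin> \<int>"
  shows "Digamma (1 - z) - Digamma z = of_real pi * cot (of_real pi * z)"
proof -
  have z: "z \<notin> \<int>\<^sub>\<le>\<^sub>0" "1 - z \<notin> \<int>\<^sub>\<le>\<^sub>0"
    using assms nonpos_Ints_subset_Ints by (auto simp: minus_in_Ints_iff dest!: nonpos_Ints_Int)
  have sin: "sin (of_real pi * z) \<noteq> 0"
    using assms by (auto simp: sin_eq_0 mult.commute)
  have g: "Gamma z \<noteq> 0" "Gamma (1 - z) \<noteq> 0" using z by (auto simp: Gamma_eq_zero_iff)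
  have 1: "((\<lambda>z. Gamma z * Gamma (1 - z)) has_field_derivative
          Gamma z * Gamma (1 - z) * (Digamma z - Digamma (1 - z))) (at z)"
    using z by (auto intro!: derivative_eq_intros simp: algebra_simps)
  have 2: "((\<lambda>z. Gamma z * Gamma (1 - z)) has_field_derivative
          - of_real pi * (of_real pi * cos (of_real pi * z)) / sin (of_real pi * z) ^ 2) (at z)"
    unfolding Gamma_reflection_complex
    using sin by (auto intro!: derivative_eq_intros simp: power2_eq_square)
  have "Digamma (1 - z) - Digamma z = 
      - (sin (of_real pi * z) / of_real pi) * (of_real pi / sin (of_real pi * z) * (Digamma z - Digamma (1 - z)))"
    using sin by simp
  also have "of_real pi / sin (of_real pi * z) * (Digamma z - Digamma (1 - z)) = 
       - of_real pi * (of_real pi * cos (of_real pi * z)) / sin (of_real pi * z) ^ 2"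
    using DERIV_unique[OF 1 2] unfolding Gamma_reflection_complex .
  also have "- (sin (of_real pi * z) / of_real pi) * \<dots> = of_real pi * cot (of_real pi * z)"
    using sin by (simp add: cot_def power2_eq_square)
  finally show ?thesis .
qed

text \<open>Pairing n + z with n + 1 - z lets a series over natural numbers replace the symmetric
  sum over all integers. This pairing is the origin of the pairs \<theta>, 1 - \<theta>
  throughout.\<close>

lemma cot_partial_fraction:
  fixes z :: complex
  assumes "z \<notin> \<int>"
  shows "(\<lambda>n. 1 / (of_nat n + z) - 1 / (of_nat n + 1 - z)) sums (of_real pi * cot (of_real pi * z))"
proof -
  have "z \<notin> \<int>\<^sub>\<le>\<^sub>0" "1 - z \<notin> \<int>\<^sub>\<le>\<^sub>0"
    using assms nonpos_Ints_subset_Ints by (auto simp: minus_in_Ints_iff dest!: nonpos_Ints_Int)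
  from Digamma_diff_sums[OF this] show ?thesis
    by (simp add: Digamma_reflection[OF assms] algebra_simps)
qed

lemma summable_inverse_quadratic:
  fixes y :: real
  assumes "y \<noteq> 0"
  shows "summable (\<lambda>n. 1 / ((real n)\<^sup>2 + y\<^sup>2))"
proof (rule summable_comparison_test'[where N = 1])
  show "summable (\<lambda>n. 1 / (real n)^2)" by (simp add: inverse_power_summable field_simps flip: inverse_eq_divide)
  show "norm (1 / ((real n)\<^sup>2 + y\<^sup>2)) \<le> 1 / (real n)\<^sup>2" if "n \<ge> 1" for n
    using that assms by (auto intro!: divide_left_mono mult_pos_pos add_pos_nonneg)
qed

text \<open>Imaginary part of the cotangent expansion at z = i x, where the cotangent becomes a
  hyperbolic one and hence an expression in exp(2 pi x).\<close>

lemma coth_partial_fraction: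
  fixes x :: real
  assumes x: "x > 0"
  shows "(\<lambda>m. x / (x\<^sup>2 + (real (Suc m))\<^sup>2)) sums (pi / 2 * (1 + 2 / (exp (2 * pi * x) - 1)) - 1 / (2 * x))"
proof -
  define a where "a n = x / ((real n)\<^sup>2 + x\<^sup>2)" for n
  have e: "exp (- (2 * pi * x)) < 1" using x by simp
  have "\<i> * of_real x \<notin> \<int>" using x by (auto simp: complex_eq_iff elim!: Ints_cases)
  from sums_Im[OF cot_partial_fraction[OF this]]
  have "(\<lambda>n. Im (1 / (of_nat n + \<i> * of_real x) - 1 / (of_nat n + 1 - \<i> * of_real x))) sums
    (pi * Im (cot (of_real pi * (\<i> * of_real x))))" by simp
  also have "(\<lambda>n. Im (1 / (of_nat n + \<i> * of_real x) - 1 / (of_nat n + 1 - \<i> * of_real x)))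
     = (\<lambda>n. - (a n + a (Suc n)))"
    by (auto simp: a_def Im_divide fun_eq_iff add_ac)
  also have "cot (of_real pi * (\<i> * of_real x)) = - \<i> * of_real (1 + exp (- (2 * pi * x))) / of_real (1 - exp (- (2 * pi * x)))"
  proof -
    have "2 * \<i> * (of_real pi * (\<i> * of_real x)) = of_real (- (2 * pi * x))"
      by (simp add: complex_eq_iff)
    hence "exp (2 * \<i> * (of_real pi * (\<i> * of_real x))) = of_real (exp (- (2 * pi * x)))"
      by (simp only: exp_of_real)
    note E = this
    have "complex_of_real (exp (- (2 * pi * x))) \<noteq> 1" using e by (metis less_irrefl of_real_eq_1_iff)
    thus ?thesis
      using cot_conv_exp[of "of_real pi * (\<i> * of_real x)"] unfolding E of_real_add of_real_diff of_real_1 by simp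
  qed
  also have "Im (- \<i> * of_real (1 + exp (- (2 * pi * x))) / of_real (1 - exp (- (2 * pi * x)))) = 
    - (1 + exp (- (2 * pi * x))) / (1 - exp (- (2 * pi * x)))"
    by (subst Im_divide_of_real) simp
  also have "\<dots> = - (1 + 2 / (exp (2 * pi * x) - 1))"
  proof -
    define u where "u = exp (2 * pi * x)"
    have "u > 1" "exp (- (2 * pi * x)) = 1 / u" using x
      by (simp_all add: u_def exp_minus inverse_eq_divide)
    thus ?thesis unfolding u_def[symmetric] by (simp only:) (simp add: divide_simps)
  qed
  finally have 1: "(\<lambda>n. - (a n + a (Suc n))) sums (pi * - (1 + 2 / (exp (2 * pi * x) - 1)))" .
  \<comment> \<open>The expansion contains \<open>a n\<close> and \<open>a (Suc n)\<close>, so each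
    index but 0 occurs twice. Once \<open>a\<close> is known to be summable, the equation can be
    solved for its sum, and the term \<open>a 0 = 1 / x\<close> is split off.\<close>
  have "summable (\<lambda>n. x * (1 / ((real n)\<^sup>2 + x\<^sup>2)))" using summable_inverse_quadratic[of x] x by (intro summable_mult) auto
  hence "summable a" unfolding a_def by simp
  hence "(\<lambda>n. a (Suc n)) sums (suminf a - a 0)" by (simp add: sums_Suc_iff summable_sums)
  moreover have "(\<lambda>n. - (a n + a (Suc n))) sums - (suminf a + (suminf a - a 0))"
    using \<open>summable a\<close> calculation by (intro sums_minus sums_add summable_sums)
  from sums_unique2[OF this 1] have "suminf a = pi / 2 * (1 + 2 / (exp (2 * pi * x) - 1)) + a 0 / 2"
    by (simp add: field_simps)
  ultimately show ?thesis using x by (simp add: a_def power2_eq_square add_ac)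
qed

lemma exp_neg_sums:
  fixes a b :: real
  assumes "a > 0"
  shows "(\<lambda>n. exp (- (a * (real n + b)))) sums (exp (- (a * b)) / (1 - exp (- a)))"
proof -
  have "(\<lambda>n. exp (- (a * b)) * exp (- a) ^ n) sums (exp (- (a * b)) * (1 / (1 - exp (- a))))"
    using assms by (intro sums_mult geometric_sums) simp
  moreover have "exp (- (a * b)) * exp (- a) ^ n = exp (- (a * (real n + b)))" for n
    by (simp add: algebra_simps flip: exp_of_nat_mult exp_add)
  ultimately show ?thesis by simp
qed

lemma exp_neg_Suc_sums:
  fixes a :: real
  assumes "a > 0"
  shows "(\<lambda>n. exp (- (real (Suc n) * a))) sums (1 / (exp a - 1))"
proof -
  have "exp (- a) / (1 - exp (- a)) = 1 / (exp a - 1)"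
    using assms by (simp add: exp_minus field_simps)
  thus ?thesis using exp_neg_sums[OF assms, of 1] by (simp add: algebra_simps)
qed

lemma summable_exp_neg:
  fixes a :: real
  assumes "a > 0"
  shows "summable (\<lambda>n. exp (- (a * real n)))"
  using exp_neg_sums[OF assms, of 0] by (auto simp: sums_iff)

text \<open>With \<open>p = n + i y\<close> each term of the cotangent expansion is the real part of
  \<open>1/(p + \<theta>) - 1/(p + 1 - \<theta>)\<close>. Subtracting \<open>(1 - 2\<theta>) (1/p - 1/(p + 1))\<close> leaves exactly
  \<open>- (1 - 2\<theta>) \<theta> (1 - \<theta>) / (p (p + 1) (p + \<theta>) (p + 1 - \<theta>))\<close>, hence the fourth-order decay.\<close>
lemma theta_remainder_bound:
  fixes \<theta> y :: real and n :: nat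
  assumes "0 < \<theta>" "\<theta> < 1" "y > 0"
  defines "\<rho> \<equiv> \<lambda>b. b / (b\<^sup>2 + y\<^sup>2)"
  shows "\<bar>\<rho> (n + \<theta>) - \<rho> (n + 1 - \<theta>) - (1 - 2 * \<theta>) * (\<rho> n - \<rho> (n + 1))\<bar> \<le> 1 / ((real n)\<^sup>2 + y\<^sup>2)\<^sup>2"
proof -
  define p where "p = Complex (real n) y"
  have \<rho>: "\<rho> (real n + b) = Re (1 / (p + of_real b))" for b
    by (simp add: \<rho>_def p_def Re_divide)
  have pb: "p + of_real b \<noteq> 0" "norm (p + of_real b) \<ge> norm p" if "b \<ge> 0" for b
    using assms that by (auto simp: p_def complex_eq_iff cmod_def intro!: power_mono)
  have p0: "p \<noteq> 0" "p + 1 \<noteq> 0" "p + of_real \<theta> \<noteq> 0" "p + (1 - of_real \<theta>) \<noteq> 0"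
    using pb[of 0] pb[of 1] pb[of \<theta>] pb[of "1 - \<theta>"] assms by auto
  have "\<rho> (n + \<theta>) - \<rho> (n + 1 - \<theta>) - (1 - 2 * \<theta>) * (\<rho> n - \<rho> (n + 1)) = 
    Re (1 / (p + of_real \<theta>) - 1 / (p + of_real (1 - \<theta>)) - of_real (1 - 2 * \<theta>) * (1 / (p + of_real 0) - 1 / (p + of_real 1)))"
    using \<rho>[of \<theta>] \<rho>[of "1 - \<theta>"] \<rho>[of 0] \<rho>[of 1]
    unfolding minus_complex.sel Re_complex_of_real times_complex.sel Im_complex_of_real
    by (simp add: algebra_simps)
  also have "1 / (p + of_real \<theta>) - 1 / (p + of_real (1 - \<theta>)) - of_real (1 - 2 * \<theta>) * (1 / (p + of_real 0) - 1 / (p + of_real 1))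
    = - of_real ((1 - 2 * \<theta>) * (\<theta> * (1 - \<theta>))) / (p * (p + of_real 1) * ((p + of_real \<theta>) * (p + of_real (1 - \<theta>))))"
    using p0 by (simp add: divide_simps) (simp add: algebra_simps)
  also have "\<bar>Re \<dots>\<bar> \<le> norm \<dots>" by (rule abs_Re_le_cmod)
  also have "\<dots> = \<bar>(1 - 2 * \<theta>) * (\<theta> * (1 - \<theta>))\<bar> / (norm p * norm (p + of_real 1) * (norm (p + of_real \<theta>) * norm (p + of_real (1 - \<theta>))))"
    unfolding norm_divide norm_mult norm_minus_cancel norm_of_real by simp
  also have "\<dots> \<le> 1 / (norm p * norm p * (norm p * norm p))"
  proof (rule frac_le)
    show "\<bar>(1 - 2 * \<theta>) * (\<theta> * (1 - \<theta>))\<bar> \<le> 1"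
      unfolding abs_mult using assms by (intro mult_le_one) (auto simp: abs_if)
    show "norm p * norm p * (norm p * norm p) \<le> norm p * norm (p + of_real 1) * (norm (p + of_real \<theta>) * norm (p + of_real (1 - \<theta>)))"
      using assms by (intro mult_mono pb) auto
  qed (use p0 in auto)
  also have "norm p * norm p * (norm p * norm p) = ((real n)\<^sup>2 + y\<^sup>2)\<^sup>2"
    by (simp add: p_def cmod_def power2_eq_square)
  finally show ?thesis .
qed

section \<open>The theta identity for k = 0\<close>

text \<open>Imaginary part of the geometric series with ratio q = exp(i x - s). With w = q/(1 - q)
  the cotangent is -i (1 + 2 w), so half its real part is Im w.\<close>

lemma sin_exp_sums:
  fixes x s :: real
  assumes "s > 0"
  shows "(\<lambda>d. sin (x * real (Suc d)) * exp (- (real (Suc d) * s))) sums (Re (cot (Complex (x / 2) (s / 2))) / 2)"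
proof -
  define q where "q = cis x * of_real (exp (- s))"
  have nq: "norm q < 1" using assms by (simp add: q_def norm_mult)
  hence q1: "q \<noteq> 1" by auto
  have "q * q ^ d = q ^ Suc d" for d by simp
  have qp: "Im (q ^ Suc d) = sin (x * real (Suc d)) * exp (- (real (Suc d) * s))" for d
  proof -
    have "exp (- s) ^ Suc d = exp (- (real (Suc d) * s))"
      by (simp only: exp_of_nat_mult[symmetric] mult_minus_right)
    hence "q ^ Suc d = cis (real (Suc d) * x) * of_real (exp (- (real (Suc d) * s)))"
      unfolding q_def power_mult_distrib of_real_power[symmetric] Complex.DeMoivre by simp
    thus ?thesis by (simp add: mult.commute)
  qed
  have "(\<lambda>d. q * q ^ d) sums (q * (1 / (1 - q)))"
    by (intro sums_mult geometric_sums nq)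
  from sums_Im[OF this] have 1: "(\<lambda>d. Im (q ^ Suc d)) sums Im (q / (1 - q))" by simp
  moreover have "exp (2 * \<i> * Complex (x / 2) (s / 2)) = q"
  proof -
    have "2 * \<i> * Complex (x / 2) (s / 2) = \<i> * of_real x + of_real (- s)"
      by (simp add: complex_eq_iff)
    thus ?thesis by (simp only: q_def cis_conv_exp exp_of_real exp_add)
  qed
  with cot_conv_exp[of "Complex (x / 2) (s / 2)"] q1 
  have "cot (Complex (x / 2) (s / 2)) = - \<i> * (1 + q) / (1 - q)" by simp
  moreover have "- \<i> * (1 + q) / (1 - q) = - \<i> * (1 + 2 * (q / (1 - q)))"
    using q1 by (simp add: divide_simps)
  moreover define w where "w = q / (1 - q)"
  ultimately have "cot (Complex (x / 2) (s / 2)) = - \<i> * (1 + 2 * w)" by simp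
  hence "Re (cot (Complex (x / 2) (s / 2))) / 2 = Im w" by simp
  with 1 show ?thesis unfolding qp w_def by (simp only:)
qed

text \<open>For b at least min(\<theta>, 1 - \<theta>), the product (d + 1)(n + b) is at least d
  min(\<theta>, 1 - \<theta>) + n. Thus both exponentials have the same majorant, which factors into
  a part in d and a part in n.\<close>

lemma exp_diff_bound:
  fixes c \<theta> :: real and n d :: nat
  assumes "0 < \<theta>" "\<theta> < 1" "c > 0"
  shows "\<bar>exp (- (real (Suc d) * (c * (real n + \<theta>)))) - exp (- (real (Suc d) * (c * (real n + 1 - \<theta>))))\<bar>
    \<le> exp (- (c * min \<theta> (1 - \<theta>) * real d)) * exp (- (c * real n))"
proof -
  define \<mu> where "\<mu> = min \<theta> (1 - \<theta>)"
  have \<mu>: "0 < \<mu>" "\<mu> \<le> \<theta>" "\<mu> \<le> 1 - \<theta>" using assms by (auto simp: \<mu>_def)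
  have *: "exp (- (real (Suc d) * (c * (real n + b)))) \<le> exp (- (c * \<mu> * real d)) * exp (- (c * real n))"
    if b: "b \<ge> \<mu>" for b
  proof -
    have "real d * \<mu> + real n \<le> real (Suc d) * b + real (Suc d) * real n"
      using b \<mu> by (intro add_mono mult_mono) (auto simp: mult_le_cancel_right1)
    hence "c * (real d * \<mu> + real n) \<le> c * (real (Suc d) * b + real (Suc d) * real n)"
      using assms by (intro mult_left_mono) auto
    thus ?thesis by (simp add: algebra_simps flip: exp_add)
  qed
  have "real n + 1 - \<theta> = real n + (1 - \<theta>)"
    by simp
  moreover have "\<bar>u - v\<bar> \<le> M" if "0 < u" "0 < v" "u \<le> M" "v \<le> M" for u v M :: real using that by linarith
  ultimately show ?thesis using *[of \<theta>] *[of "1 - \<theta>"] \<mu> unfolding \<mu>_def[symmetric] by (metis exp_gt_zero)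
qed

text \<open>The array \<open>r\<close> is summed in both orders. Over n first it yields the
  cotangents \<open>F\<close>, which reassemble the Lambert series; over m first it yields
  hyperbolic cotangents \<open>C\<close>, whose exponential parts \<open>E\<close> form the series
  in 1/t.\<close>

lemma sin_lambert_theta:
  fixes t \<theta> :: real
  assumes t: "t > 0" and \<theta>: "0 < \<theta>" "\<theta> < 1"
  defines "c \<equiv> 4 * pi\<^sup>2 / t"
  shows "(\<Sum>d. sin (2 * pi * \<theta> * real (Suc d)) / (exp (real (Suc d) * t) - 1)) =
    - cot (pi * \<theta>) / 4 + pi * (1 - 2 * \<theta>) / (2 * t)
    + pi / t * (\<Sum>d. (exp (- (real (Suc d) * c * \<theta>)) - exp (- (real (Suc d) * c * (1 - \<theta>)))) / (1 - exp (- (real (Suc d) * c))))"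
proof -
  \<comment> \<open>This scale makes pi (\<theta> + i y) the argument of the cotangent in
    \<open>F\<close>, and it turns exp(2 pi b / \<tau>) into exp(c b).\<close>
  define \<tau> where "\<tau> = t / (2 * pi)"
  define y where "y m = real (Suc m) * \<tau>" for m
  define \<rho> where "\<rho> m b = b / (b\<^sup>2 + (y m)\<^sup>2)" for m b
  define F where "F m = Re (cot (Complex (pi * \<theta>) (real (Suc m) * t / 2))) / 2" for m
  define r where "r m n = \<rho> m (real n + \<theta>) - \<rho> m (real n + 1 - \<theta>) - (1 - 2 * \<theta>) * (\<rho> m (real n) - \<rho> m (real n + 1))" for m and n :: nat
  define E where "E b = 1 / (exp (c * b) - 1)" for b
  \<comment> \<open>\<open>C b\<close> is to be the sum of \<open>\<rho> m b\<close> over m. At b =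
    0 all these terms vanish while the closed formula is singular, so the value 0 is set separately;
    the telescoping sum uses it as its first value.\<close>
  define C where "C b = (if b = 0 then 0 else c / 4 * (1 + 2 * E b) - 1 / (2 * b))" for b
  have pos: "\<tau> > 0" "y m > 0" "c > 0" for m using t by (auto simp: \<tau>_def y_def c_def)
  have c\<tau>: "c = 2 * pi / \<tau>" using t by (simp add: c_def \<tau>_def field_simps power2_eq_square)

  have r_sums: "(\<lambda>n. r m n) sums (2 * pi * F m)" for m
  proof -
    define z where "z = Complex \<theta> (y m)"
    have "z \<notin> \<int>" using pos(2)[of m] by (auto simp: z_def complex_eq_iff elim!: Ints_cases)
    from sums_Re[OF cot_partial_fraction[OF this]]
    have "(\<lambda>n. Re (1 / (of_nat n + z) - 1 / (of_nat n + 1 - z))) sums (pi * Re (cot (of_real pi * z)))" by simp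
    moreover have "Re (1 / (of_nat n + z) - 1 / (of_nat n + 1 - z)) = \<rho> m (real n + \<theta>) - \<rho> m (real n + 1 - \<theta>)" for n
      by (simp add: z_def \<rho>_def Re_divide add_ac)
    moreover have "of_real pi * z = Complex (pi * \<theta>) (real (Suc m) * t / 2)"
      by (simp add: z_def y_def \<tau>_def complex_eq_iff)
    ultimately have 1: "(\<lambda>n. \<rho> m (real n + \<theta>) - \<rho> m (real n + 1 - \<theta>)) sums (2 * pi * F m)"
      by (simp add: F_def)
    \<comment> \<open>For fixed m both boundary values of the telescoping sum are 0, so its
      subtraction does not alter the sum over n.\<close>
    have "(\<lambda>n. \<rho> m (real n)) \<longlonglongrightarrow> 0"
      unfolding \<rho>_def using pos(2)[of m] by real_asymp
    from telescope_sums'[OF this] have "(\<lambda>n. \<rho> m (real n) - \<rho> m (real n + 1)) sums 0" by (simp add: \<rho>_def add_ac)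
    from sums_diff[OF 1 sums_mult[OF this, of "1 - 2 * \<theta>"]] show ?thesis by (simp add: r_def add_ac)
  qed

  have \<rho>_sums: "(\<lambda>m. \<rho> m b) sums C b" if "b \<ge> 0" for b
  proof (cases "b = 0")
    case False
    hence b: "b > 0" using that by simp
    have "\<rho> m b = (1 / \<tau>) * ((b / \<tau>) / ((b / \<tau>)\<^sup>2 + (real (Suc m))\<^sup>2))" for m
      using pos b by (simp add: \<rho>_def y_def field_simps power2_eq_square del: of_nat_Suc)
    moreover have "(1 / \<tau>) * (pi / 2 * (1 + 2 / (exp (2 * pi * (b / \<tau>)) - 1)) - 1 / (2 * (b / \<tau>))) = C b"
      using b pos by (simp add: C_def E_def c\<tau> field_simps)
    ultimately show ?thesis
      using sums_mult[OF coth_partial_fraction[of "b / \<tau>"], of "1 / \<tau>"] b pos by simp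
  qed (auto simp: \<rho>_def C_def)

  have bound: "norm (r m n) \<le> 1 / (y m)\<^sup>2 * (1 / ((real n)\<^sup>2 + \<tau>\<^sup>2))" for m n
  proof -
    have "norm (r m n) \<le> 1 / ((real n)\<^sup>2 + (y m)\<^sup>2)\<^sup>2"
      using theta_remainder_bound[OF \<theta> pos(2)] by (simp add: r_def \<rho>_def add_ac)
    also have "\<dots> \<le> 1 / ((y m)\<^sup>2 * ((real n)\<^sup>2 + \<tau>\<^sup>2))"
    proof (rule divide_left_mono)
      \<comment> \<open>One factor of the fourth-order bound is weakened to y^2 and the other to n^2
        + \<tau>^2, the smallest y being \<tau>. This separates m from n.\<close>
      have "\<tau> \<le> y m" using pos by (simp add: y_def)
      hence "\<tau>\<^sup>2 \<le> (y m)\<^sup>2" using pos by (intro power_mono) auto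
      thus "(y m)\<^sup>2 * ((real n)\<^sup>2 + \<tau>\<^sup>2) \<le> ((real n)\<^sup>2 + (y m)\<^sup>2)\<^sup>2"
        unfolding power2_eq_square[of "_ + _"] by (intro mult_mono) auto
      show "0 < ((real n)\<^sup>2 + (y m)\<^sup>2)\<^sup>2 * ((y m)\<^sup>2 * ((real n)\<^sup>2 + \<tau>\<^sup>2))"
        using pos(1) pos(2)[of m] by (intro mult_pos_pos zero_less_power add_nonneg_pos) auto
    qed auto
    finally show ?thesis by simp
  qed
  have sA: "summable (\<lambda>m. 1 / (y m)\<^sup>2)"
  proof -
    have "summable (\<lambda>m. 1 / \<tau>\<^sup>2 * inverse (real (Suc m) ^ 2))"
      by (intro summable_mult, subst summable_Suc_iff, rule inverse_power_summable) auto
    thus ?thesis by (simp add: y_def power_mult_distrib field_simps del: of_nat_Suc)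
  qed
  have sB: "summable (\<lambda>n. 1 / ((real n)\<^sup>2 + \<tau>\<^sup>2))"
    using pos by (intro summable_inverse_quadratic) auto
  note sw = suminf_swap_product_bound[OF bound sA sB]
  have "(\<Sum>m. \<Sum>n. r m n) = (\<Sum>n. \<Sum>m. r m n)" by (rule sw) auto
  moreover have "summable (\<lambda>m. \<Sum>n. r m n)" "summable (\<lambda>n. \<Sum>m. r m n)" by (rule sw; simp)+
  ultimately have sF: "summable (\<lambda>m. 2 * pi * F m)"
    and "(\<lambda>n. \<Sum>m. r m n) sums (\<Sum>m. 2 * pi * F m)"
    using r_sums by (simp_all add: sums_iff)
  note this(2)
  also have "(\<lambda>n. \<Sum>m. r m n) = (\<lambda>n. C (real n + \<theta>) - C (real n + 1 - \<theta>) - (1 - 2 * \<theta>) * (C (real n) - C (real n + 1)))"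
  proof
    fix n :: nat
    have "(\<lambda>m. r m n) sums (C (real n + \<theta>) - C (real n + 1 - \<theta>) - (1 - 2 * \<theta>) * (C (real n) - C (real n + 1)))"
      unfolding r_def using \<theta> by (intro sums_diff sums_mult \<rho>_sums) auto
    thus "(\<Sum>m. r m n) = C (real n + \<theta>) - C (real n + 1 - \<theta>) - (1 - 2 * \<theta>) * (C (real n) - C (real n + 1))"
      by (simp add: sums_iff)
  qed
  finally have 1: "(\<lambda>n. C (real n + \<theta>) - C (real n + 1 - \<theta>) - (1 - 2 * \<theta>) * (C (real n) - C (real n + 1))) sums (\<Sum>m. 2 * pi * F m)" .
  \<comment> \<open>In this order the telescoping sum is not 0: it runs from \<open>C 0 = 0\<close>
    to the limit c/4. Adding it back leaves the term that becomes pi (1 - 2\<theta>) / (2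
    t).\<close>
  have "(\<lambda>n. c / 4 * (1 + 2 * E (real n)) - 1 / (2 * real n)) \<longlonglongrightarrow> c / 4"
    unfolding E_def using pos by real_asymp
  moreover have "\<forall>\<^sub>F n in sequentially. c / 4 * (1 + 2 * E (real n)) - 1 / (2 * real n) = C (real n)"
    using eventually_gt_at_top[of 0] by eventually_elim (simp add: C_def)
  ultimately have "(\<lambda>n. C (real n)) \<longlonglongrightarrow> c / 4"
    by (rule Lim_transform_eventually)
  from telescope_sums'[OF this] have 2: "(\<lambda>n. C (real n) - C (real n + 1)) sums - (c / 4)"
    by (simp add: C_def add_ac)
  from sums_add[OF 1 sums_mult[OF 2, of "1 - 2 * \<theta>"]]
  have 3: "(\<lambda>n. C (real n + \<theta>) - C (real n + 1 - \<theta>)) sums ((\<Sum>m. 2 * pi * F m) - (1 - 2 * \<theta>) * (c / 4))"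
    by simp
  have "complex_of_real \<theta> \<notin> \<int>" using \<theta> by (auto simp: complex_eq_iff elim!: Ints_cases)
  from sums_Re[OF cot_partial_fraction[OF this]]
  have "(\<lambda>n. Re (1 / (of_nat n + of_real \<theta>) - 1 / (of_nat n + 1 - of_real \<theta>))) sums (Re (of_real pi * cot (of_real pi * of_real \<theta>)))" .
  moreover have "1 / (of_nat n + of_real \<theta>) - 1 / (of_nat n + 1 - of_real \<theta>) = complex_of_real (1 / (real n + \<theta>) - 1 / (real n + 1 - \<theta>))" for n
    by simp
  ultimately have 4: "(\<lambda>n. 1 / (real n + \<theta>) - 1 / (real n + 1 - \<theta>)) sums (pi * cot (pi * \<theta>))"
    by (simp only: Re_complex_of_real of_real_mult[symmetric] cot_of_real[symmetric])
  have "(\<lambda>n. c / 2 * (E (real n + \<theta>) - E (real n + 1 - \<theta>))) sums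
    ((\<Sum>m. 2 * pi * F m) - (1 - 2 * \<theta>) * (c / 4) + 1 / 2 * (pi * cot (pi * \<theta>)))"
  \<comment> \<open>The parts -1/(2b) of \<open>C\<close> are removed by the partial fractions of
    cot(pi \<theta>), and the constant parts c/4 cancel in the difference. Only the exponential
    parts \<open>E\<close> survive.\<close>
  proof -
    have eq: "C (real n + \<theta>) - C (real n + 1 - \<theta>) + 1 / 2 * (1 / (real n + \<theta>) - 1 / (real n + 1 - \<theta>)) = 
       c / 2 * (E (real n + \<theta>) - E (real n + 1 - \<theta>))" for n :: nat
      using \<theta> unfolding C_def by (simp add: algebra_simps)
    show ?thesis using sums_add[OF 3 sums_mult[OF 4, of "1/2"]] by (simp only: eq)
  qed
  hence 5: "(\<Sum>n. c / 2 * (E (real n + \<theta>) - E (real n + 1 - \<theta>))) =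
    (\<Sum>m. 2 * pi * F m) - (1 - 2 * \<theta>) * (c / 4) + 1 / 2 * (pi * cot (pi * \<theta>))"
    and sE: "summable (\<lambda>n. c / 2 * (E (real n + \<theta>) - E (real n + 1 - \<theta>)))" by (auto simp: sums_iff)
  have sE': "summable (\<lambda>n. E (real n + \<theta>) - E (real n + 1 - \<theta>))"
    using summable_mult[OF sE, of "2 / c"] pos(3) by (simp only: mult.assoc[symmetric]) simp

  define G where "G n d = exp (- (real (Suc d) * (c * (real n + \<theta>)))) - exp (- (real (Suc d) * (c * (real n + 1 - \<theta>))))" for n d :: nat
  have "(\<Sum>n. E (real n + \<theta>) - E (real n + 1 - \<theta>)) = (\<Sum>n. \<Sum>d. G n d)"
  proof (intro suminf_cong)
    fix n :: nat
    have "(\<lambda>d. G n d) sums (E (real n + \<theta>) - E (real n + 1 - \<theta>))"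
      unfolding G_def E_def using \<theta> pos by (intro sums_diff exp_neg_Suc_sums) auto
    thus "E (real n + \<theta>) - E (real n + 1 - \<theta>) = (\<Sum>d. G n d)" by (simp add: sums_iff)
  qed
  also have "\<dots> = (\<Sum>d. \<Sum>n. G n d)"
  proof (rule suminf_swap_product_bound)
    show "norm (G n d) \<le> exp (- (c * real n)) * exp (- (c * min \<theta> (1 - \<theta>) * real d))" for n d
      using exp_diff_bound[OF \<theta> pos(3), of d n] by (simp add: G_def mult.commute)
  qed (use \<theta> pos in \<open>auto intro!: summable_exp_neg\<close>)
  also have "\<dots> = (\<Sum>d. (exp (- (real (Suc d) * c * \<theta>)) - exp (- (real (Suc d) * c * (1 - \<theta>)))) / (1 - exp (- (real (Suc d) * c))))"
  proof (intro suminf_cong)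
    fix d :: nat
    have "real (Suc d) * c > 0" using pos by simp
    from sums_diff[OF exp_neg_sums[OF this, of \<theta>] exp_neg_sums[OF this, of "1 - \<theta>"]]
    have "(\<lambda>n. G n d) sums ((exp (- (real (Suc d) * c * \<theta>)) - exp (- (real (Suc d) * c * (1 - \<theta>)))) / (1 - exp (- (real (Suc d) * c))))"
      by (simp add: G_def mult.assoc diff_divide_distrib add_diff_eq)
    thus "(\<Sum>n. G n d) = (exp (- (real (Suc d) * c * \<theta>)) - exp (- (real (Suc d) * c * (1 - \<theta>)))) / (1 - exp (- (real (Suc d) * c)))"
      by (simp add: sums_iff)
  qed
  finally have 6: "(\<Sum>n. E (real n + \<theta>) - E (real n + 1 - \<theta>)) = \<dots>" .

  define H where "H d m = sin (2 * pi * \<theta> * real (Suc d)) * exp (- (real (Suc d) * (real (Suc m) * t)))" for d m :: nat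
  have "(\<Sum>d. sin (2 * pi * \<theta> * real (Suc d)) / (exp (real (Suc d) * t) - 1)) = (\<Sum>d. \<Sum>m. H d m)"
  proof (intro suminf_cong)
    fix d :: nat
    have "real (Suc d) * t > 0" using t by simp
    from sums_mult[OF exp_neg_Suc_sums[OF this], of "sin (2 * pi * \<theta> * real (Suc d))"]
    show "sin (2 * pi * \<theta> * real (Suc d)) / (exp (real (Suc d) * t) - 1) = (\<Sum>m. H d m)"
      by (simp add: H_def sums_iff mult.left_commute del: of_nat_Suc)
  qed
  also have "\<dots> = (\<Sum>m. \<Sum>d. H d m)"
  proof (rule suminf_swap_product_bound)
    show "norm (H d m) \<le> exp (- (t * real d)) * exp (- (t * real m))" for d m
    proof -
      have "real d + real m \<le> real (Suc d) * real (Suc m)" by (simp add: algebra_simps)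
      hence "t * (real d + real m) \<le> t * (real (Suc d) * real (Suc m))"
        using t by (intro mult_left_mono) auto
      hence "exp (- (t * (real (Suc d) * real (Suc m)))) \<le> exp (- (t * (real d + real m)))"
        by (simp only: exp_le_cancel_iff neg_le_iff_le)
      also have "\<dots> = exp (- (t * real d)) * exp (- (t * real m))"
        by (simp add: distrib_left flip: exp_add)
      also have "t * (real (Suc d) * real (Suc m)) = real (Suc d) * (real (Suc m) * t)"
        by (simp only: ac_simps)
      finally have "exp (- (real (Suc d) * (real (Suc m) * t))) \<le> exp (- (t * real d)) * exp (- (t * real m))" .
      moreover have "\<bar>sin (2 * pi * \<theta> * real (Suc d))\<bar> \<le> 1" by simp
      ultimately show ?thesis unfolding H_def
        using mult_mono[of "\<bar>sin (2 * pi * \<theta> * real (Suc d))\<bar>" 1 "exp (- (real (Suc d) * (real (Suc m) * t)))"]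
        by (simp add: abs_mult del: of_nat_Suc)
    qed
  qed (use t in \<open>auto intro!: summable_exp_neg\<close>)
  also have "\<dots> = (\<Sum>m. F m)"
  proof (intro suminf_cong)
    fix m :: nat
    have "real (Suc m) * t > 0" using t by simp
    from sin_exp_sums[OF this, of "2 * pi * \<theta>"] show "(\<Sum>d. H d m) = F m"
      by (simp add: H_def F_def sums_iff del: of_nat_Suc)
  qed
  finally have 7: "(\<Sum>d. sin (2 * pi * \<theta> * real (Suc d)) / (exp (real (Suc d) * t) - 1)) = (\<Sum>m. F m)" .
  have "summable F" using summable_mult[OF sF, of "1 / (2 * pi)"] by simp
  have "c / 2 * (\<Sum>n. E (real n + \<theta>) - E (real n + 1 - \<theta>)) =
      2 * pi * (\<Sum>m. F m) - (1 - 2 * \<theta>) * (c / 4) + 1 / 2 * (pi * cot (pi * \<theta>))"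
    using 5 by (simp only: suminf_mult[OF \<open>summable F\<close>] suminf_mult[OF sE'])
  hence "2 * pi * (\<Sum>m. F m) = c / 2 * (\<Sum>n. E (real n + \<theta>) - E (real n + 1 - \<theta>)) + (1 - 2 * \<theta>) * (c / 4) - 1 / 2 * (pi * cot (pi * \<theta>))"
    by linarith
  hence "(2 * pi * (\<Sum>m. F m)) / (2 * pi) = (c / 2 * (\<Sum>n. E (real n + \<theta>) - E (real n + 1 - \<theta>)) + (1 - 2 * \<theta>) * (c / 4) - 1 / 2 * (pi * cot (pi * \<theta>))) / (2 * pi)"
    by (simp only:)
  hence "(\<Sum>m. F m) = (c / (4 * pi)) * (\<Sum>n. E (real n + \<theta>) - E (real n + 1 - \<theta>)) + (1 - 2 * \<theta>) * (c / (8 * pi)) - cot (pi * \<theta>) / 4"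
    by (simp add: add_divide_distrib diff_divide_distrib)
  also have "c / (4 * pi) = pi / t" using t by (simp add: c_def power2_eq_square)
  also have "(1 - 2 * \<theta>) * (c / (8 * pi)) = pi * (1 - 2 * \<theta>) / (2 * t)" using t by (simp add: c_def power2_eq_square)
  finally show ?thesis unfolding 7 6 by simp
qed

section \<open>Differentiation with respect to the shift\<close>

text \<open>A power series in exp(u) rather than in x: differentiation in u then merely multiplies
  the d-th term by d, so the index \<open>j\<close> counts derivatives and no binomial or shift
  terms appear.\<close>

definition exp_series :: "(nat \<Rightarrow> complex) \<Rightarrow> nat \<Rightarrow> complex \<Rightarrow> complex" where
  "exp_series a j u = (\<Sum>d. a d * of_nat d ^ j * exp (of_nat d * u))"

text \<open>Each factor d is one application of the operator x d/dx, which keeps the disc of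
  convergence.\<close>

lemma summable_powser_times_of_nat_power:
  fixes a :: "nat \<Rightarrow> complex"
  assumes "\<And>x. norm x < R \<Longrightarrow> summable (\<lambda>d. a d * x ^ d)" and "norm x < R"
  shows "summable (\<lambda>d. a d * of_nat d ^ j * x ^ d)"
  using assms(2)
proof (induction j arbitrary: x)
  case (Suc j)
  have "summable (\<lambda>d. diffs (\<lambda>d. a d * of_nat d ^ j) d * x ^ d)"
    by (rule termdiff_converges[OF Suc.prems]) (use Suc.IH in auto)
  from diffs_equiv[OF this]
  have "summable (\<lambda>d. x * (of_nat d * (a d * of_nat d ^ j) * x ^ (d - Suc 0)))"
    by (intro summable_mult) (auto simp: sums_iff)
  also have "(\<lambda>d. x * (of_nat d * (a d * of_nat d ^ j) * x ^ (d - Suc 0))) = (\<lambda>d. a d * of_nat d ^ Suc j * x ^ d)"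
  proof
    show "x * (of_nat d * (a d * of_nat d ^ j) * x ^ (d - Suc 0)) = a d * of_nat d ^ Suc j * x ^ d" for d
      by (cases d) (auto simp: algebra_simps)
  qed
  finally show ?case .
qed (use assms in auto)

lemma exp_series_sums:
  assumes "\<And>x. norm x < R \<Longrightarrow> summable (\<lambda>d. a d * x ^ d)" and "norm (exp u) < R"
  shows "(\<lambda>d. a d * of_nat d ^ j * exp (of_nat d * u)) sums exp_series a j u"
  using summable_powser_times_of_nat_power[OF assms, of j]
  unfolding exp_series_def exp_of_nat_mult by (rule summable_sums)

text \<open>The chain rule for f(exp u) gives x f'(x) at x = exp u, and x d/dx multiplies the d-th
  coefficient by d.\<close>

lemma exp_series_has_field_derivative:
  assumes "\<And>x. norm x < R \<Longrightarrow> summable (\<lambda>d. a d * x ^ d)" and u: "norm (exp u) < R"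
  shows "(exp_series a j has_field_derivative exp_series a (Suc j) u) (at u)"
proof -
  define f where "f x = (\<Sum>d. a d * of_nat d ^ j * x ^ d)" for x
  define f' where "f' x = (\<Sum>d. diffs (\<lambda>d. a d * of_nat d ^ j) d * x ^ d)" for x
  obtain r where r: "norm (exp u) < r" "r < R" using dense[OF u] by blast
  moreover from this have "r > 0" by (meson norm_ge_zero order.strict_trans1)
  ultimately have "(f has_field_derivative f' (exp u)) (at (exp u))"
    unfolding f_def f'_def
    by (intro termdiffs_strong[of _ "of_real r"] summable_powser_times_of_nat_power[OF assms(1)]) auto
  from DERIV_chain2[OF this DERIV_exp]
  have "((\<lambda>u. f (exp u)) has_field_derivative (f' (exp u) * exp u)) (at u)" .
  also have "(\<lambda>u. f (exp u)) = exp_series a j"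
    by (auto simp: fun_eq_iff f_def exp_series_def exp_of_nat_mult)
  also have "f' (exp u) * exp u = exp_series a (Suc j) u"
  proof -
    have "summable (\<lambda>d. diffs (\<lambda>d. a d * of_nat d ^ j) d * exp u ^ d)"
      by (rule termdiff_converges[OF u]) (rule summable_powser_times_of_nat_power[OF assms(1)])
    from sums_mult2[OF diffs_equiv[OF this], of "exp u"]
    have "(\<lambda>d. of_nat d * (a d * of_nat d ^ j) * exp u ^ (d - Suc 0) * exp u) sums (f' (exp u) * exp u)"
      by (simp add: f'_def)
    moreover have "of_nat d * (a d * of_nat d ^ j) * exp u ^ (d - Suc 0) * exp u = a d * of_nat d ^ Suc j * exp (of_nat d * u)" for d
      unfolding exp_of_nat_mult by (cases d) (auto simp: algebra_simps)
    ultimately show ?thesis by (simp add: sums_iff exp_series_def)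
  qed
  finally show ?thesis .
qed

text \<open>The coefficients decay like exp(-d t), so the disc of convergence has radius exp(t) > 1.
  The points exp(2 pi i \<theta>) on the unit circle therefore lie strictly inside, and
  differentiation in \<theta> is legitimate.\<close>

lemma summable_lambert_coeffs:
  fixes x :: complex
  assumes "t > 0" and x: "norm x < exp t"
  shows "summable (\<lambda>d. of_real (1 / (exp (real d * t) - 1)) * x ^ d)"
proof (rule summable_comparison_test'[where N = 1])
  have "norm x * exp (- t) < 1" using x by (simp add: exp_minus field_simps)
  thus "summable (\<lambda>d. 1 / (1 - exp (- t)) * (norm x * exp (- t)) ^ d)"
    by (intro summable_mult summable_geometric) simp
  fix d :: nat assume d: "d \<ge> 1"
  have "exp (real d * t) * (1 - exp (- t)) = exp (real d * t) - exp (real d * t - t)"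
    by (simp add: algebra_simps exp_diff exp_minus divide_inverse)
  moreover have "real d * t - t \<ge> 0" using d assms by (simp add: mult_le_cancel_right1)
  ultimately have *: "exp (real d * t) * (1 - exp (- t)) \<le> exp (real d * t) - 1" by simp
  have "1 / (exp (real d * t) - 1) \<le> 1 / (exp (real d * t) * (1 - exp (- t)))"
    using * assms d by (intro divide_left_mono mult_pos_pos) auto
  hence "1 / (exp (real d * t) - 1) * norm x ^ d \<le> 1 / (exp (real d * t) * (1 - exp (- t))) * norm x ^ d"
    by (intro mult_right_mono) auto
  also have "\<dots> = 1 / (1 - exp (- t)) * (norm x * exp (- t)) ^ d"
  proof -
    have "exp (- t) ^ d = 1 / exp (real d * t)"
      by (simp add: exp_of_nat_mult exp_minus inverse_eq_divide power_divide)
    thus ?thesis by (simp add: power_mult_distrib)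
  qed
  finally show "norm (of_real (1 / (exp (real d * t) - 1)) * x ^ d) \<le> \<dots>"
    using assms d by (simp add: norm_mult norm_power norm_divide del: of_real_divide of_real_diff)
qed

text \<open>These coefficients are merely bounded, so only the unit disc is covered. That suffices,
  since exp(-c \<theta>) and exp(-c (1 - \<theta>)) are smaller than 1 for 0 < \<theta> < 1.\<close>

lemma summable_lambert_coeffs':
  fixes x :: complex
  assumes "t > 0" and x: "norm x < 1"
  shows "summable (\<lambda>d. of_real (1 / (1 - exp (- (real d * t)))) * x ^ d)"
proof (rule summable_comparison_test'[where N = 1])
  show "summable (\<lambda>d. 1 / (1 - exp (- t)) * norm x ^ d)"
    using x by (intro summable_mult summable_geometric) simp
  fix d :: nat assume d: "d \<ge> 1"
  have "t \<le> real d * t" using d assms by simp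
  hence "1 / (1 - exp (- (real d * t))) \<le> 1 / (1 - exp (- t))"
    using assms d by (intro divide_left_mono mult_pos_pos) auto
  hence "1 / (1 - exp (- (real d * t))) * norm x ^ d \<le> 1 / (1 - exp (- t)) * norm x ^ d"
    by (intro mult_right_mono) auto
  thus "norm (of_real (1 / (1 - exp (- (real d * t)))) * x ^ d) \<le> \<dots>"
    using assms d by (simp add: norm_mult norm_power norm_divide del: of_real_divide of_real_diff)
qed

lemma sums_of_real_imp_suminf:
  assumes "(\<lambda>n. complex_of_real (g n)) sums S"
  shows "S = of_real (suminf g)"
proof -
  have "summable g" using assms by (metis sums_summable summable_complex_of_real)
  hence "(\<lambda>n. complex_of_real (g n)) sums of_real (suminf g)"
    by (intro sums_of_real summable_sums)
  with assms show ?thesis by (rule sums_unique2)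
qed

text \<open>Every term of the case k = 0 is the restriction to (0, 1) of a function that is complex
  differentiable there. Sines are written through exponentials and the cotangent through Digamma, so
  that all derivatives come from families closed under differentiation.\<close>

lemma sin_power_lambert_theta:
  fixes t \<theta> :: real
  assumes t: "t > 0" and \<theta>: "0 < \<theta>" "\<theta> < 1" and k: "even k"
  defines "c \<equiv> 4 * pi\<^sup>2 / t"
  shows "(-1) ^ (k div 2) * (2 * pi) ^ k * (\<Sum>d. real (Suc d) ^ k * sin (2 * pi * \<theta> * real (Suc d)) / (exp (real (Suc d) * t) - 1)) =
    - (Polygamma k (1 - \<theta>) - Polygamma k \<theta>) / (4 * pi) + (if k = 0 then pi * (1 - 2 * \<theta>) / (2 * t) else 0)
    + pi / t * (c ^ k * (\<Sum>d. real (Suc d) ^ k * (exp (- (real (Suc d) * c * \<theta>)) - exp (- (real (Suc d) * c * (1 - \<theta>)))) / (1 - exp (- (real (Suc d) * c)))))"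
proof -
  \<comment> \<open>At d = 0 the denominators of \<open>a\<close> and \<open>b\<close> vanish, and
    division by zero gives the coefficient 0. Hence the power series may start at 0 although the
    theta identity starts at d = 1.\<close>
  define a where "a d = complex_of_real (1 / (exp (real d * t) - 1))" for d
  define b where "b d = complex_of_real (1 / (1 - exp (- (real d * c))))" for d
  define w where "w = 2 * of_real pi * \<i>"
  \<comment> \<open>In each of the families \<open>A\<close>, \<open>B\<close>, \<open>P\<close>,
    \<open>L\<close> the member with index \<open>Suc j\<close> is the derivative of the one with
    index \<open>j\<close>. The alternating signs come from the inner derivatives of -w z, -c z and
    1 - z.\<close>
  define A where "A j z = (w ^ j * exp_series a j (w * z) - (- w) ^ j * exp_series a j (- w * z)) / (2 * \<i>)" for j z
  define B where "B j z = (- of_real c) ^ j * exp_series b j (- of_real c * z) - of_real c ^ j * exp_series b j (of_real c * (z - 1))" for j z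
  define P where "P j z = (-1) ^ j * Polygamma j (1 - z) - Polygamma j z" for j and z :: complex
  define L where "L j z = (if j = 0 then 1 - 2 * z else if j = Suc 0 then - 2 else 0)" for j :: nat and z :: complex
  have c: "c > 0" using t by (simp add: c_def)
  have sa: "norm x < exp t \<Longrightarrow> summable (\<lambda>d. a d * x ^ d)" for x
    unfolding a_def by (rule summable_lambert_coeffs[OF t])
  have sb: "norm x < 1 \<Longrightarrow> summable (\<lambda>d. b d * x ^ d)" for x
    unfolding b_def by (rule summable_lambert_coeffs'[OF c])
  have nw: "norm (exp (w * of_real x)) < exp t" "norm (exp (- w * of_real x)) < exp t" for x
    using t by (simp_all add: w_def)
  have nb: "norm (exp (- complex_of_real c * of_real x)) < 1" "norm (exp (complex_of_real c * (of_real x - 1))) < 1" 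
    if "x \<in> {0<..<1}" for x using c that by (simp_all add: norm_exp_eq_Re mult_less_0_iff)

  have A_even: "A j (of_real x) = (-1) ^ (j div 2) * of_real ((2 * pi) ^ j *
      (\<Sum>d. real (Suc d) ^ j * sin (2 * pi * x * real (Suc d)) / (exp (real (Suc d) * t) - 1)))"
    if ev: "even j" for j x
  proof -
    define g where "g d = real d ^ j * sin (2 * pi * x * real d) / (exp (real d * t) - 1)" for d
    have "(\<lambda>d. a d * of_nat d ^ j * exp (of_nat d * (w * of_real x)) - a d * of_nat d ^ j * exp (of_nat d * (- w * of_real x)))
      sums (exp_series a j (w * of_real x) - exp_series a j (- w * of_real x))"
      by (intro sums_diff exp_series_sums[OF sa]) (use nw[of x] in auto)
    also have "(\<lambda>d. a d * of_nat d ^ j * exp (of_nat d * (w * of_real x)) - a d * of_nat d ^ j * exp (of_nat d * (- w * of_real x)))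
       = (\<lambda>d. 2 * \<i> * of_real (g d))"
    proof
      fix d
      have "of_nat d * (w * of_real x) = \<i> * of_real (2 * pi * x * real d)"
        "of_nat d * (- w * of_real x) = - (\<i> * of_real (2 * pi * x * real d))"
        by (simp_all add: w_def)
      hence "exp (of_nat d * (w * of_real x)) - exp (of_nat d * (- w * of_real x)) = 2 * \<i> * of_real (sin (2 * pi * x * real d))"
        by (simp only: sin_exp_eq sin_of_real[symmetric]) (simp add: field_simps)
      thus "a d * of_nat d ^ j * exp (of_nat d * (w * of_real x)) - a d * of_nat d ^ j * exp (of_nat d * (- w * of_real x)) = 2 * \<i> * of_real (g d)"
        by (simp only: right_diff_distrib[symmetric]) (simp add: a_def g_def)
    qed
    finally have "(\<lambda>d. 2 * \<i> * of_real (g d)) sums (exp_series a j (w * of_real x) - exp_series a j (- w * of_real x))" .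
    from sums_divide[OF this, of "2 * \<i>"]
    have "(\<lambda>d. complex_of_real (g d)) sums ((exp_series a j (w * of_real x) - exp_series a j (- w * of_real x)) / (2 * \<i>))" by simp
    hence "(\<lambda>d. complex_of_real (g (Suc d))) sums ((exp_series a j (w * of_real x) - exp_series a j (- w * of_real x)) / (2 * \<i>))"
      by (subst sums_Suc_iff) (simp add: g_def)
    hence "(exp_series a j (w * of_real x) - exp_series a j (- w * of_real x)) / (2 * \<i>) = of_real (\<Sum>d. g (Suc d))"
      by (rule sums_of_real_imp_suminf)
    moreover have "w ^ j = (-1) ^ (j div 2) * of_real ((2 * pi) ^ j)"
    proof -
      have w2: "w ^ 2 = (-1) * of_real ((2 * pi) ^ 2)" by (simp add: w_def power_mult_distrib)
      obtain i where j: "j = 2 * i" using ev by (elim evenE)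
      hence "w ^ j = (-1) ^ i * of_real (((2 * pi) ^ 2) ^ i)"
        by (simp only: power_mult w2 power_mult_distrib[of "-1"] of_real_power)
      thus ?thesis by (simp add: j power_mult)
    qed
    moreover have "A j (of_real x) = w ^ j * ((exp_series a j (w * of_real x) - exp_series a j (- w * of_real x)) / (2 * \<i>))"
      using that unfolding A_def by (simp add: power_minus_even algebra_simps)
    ultimately show ?thesis by (simp only: g_def of_real_mult mult.assoc)
  qed

  have B_even: "B j (of_real x) = of_real (c ^ j * 
      (\<Sum>d. real (Suc d) ^ j * (exp (- (real (Suc d) * c * x)) - exp (- (real (Suc d) * c * (1 - x)))) / (1 - exp (- (real (Suc d) * c)))))"
    if "even j" "x \<in> {0<..<1}" for j x
  proof -
    define g where "g d = real d ^ j * (exp (- (real d * c * x)) - exp (- (real d * c * (1 - x)))) / (1 - exp (- (real d * c)))" for d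
    have "(\<lambda>d. b d * of_nat d ^ j * exp (of_nat d * (- of_real c * of_real x)) - b d * of_nat d ^ j * exp (of_nat d * (of_real c * (of_real x - 1))))
      sums (exp_series b j (- of_real c * of_real x) - exp_series b j (of_real c * (of_real x - 1)))"
      by (intro sums_diff exp_series_sums[OF sb]) (use nb[of x] that in auto)
    also have "(\<lambda>d. b d * of_nat d ^ j * exp (of_nat d * (- of_real c * of_real x)) - b d * of_nat d ^ j * exp (of_nat d * (of_real c * (of_real x - 1))))
       = (\<lambda>d. of_real (g d))"
    proof
      fix d
      have "of_nat d * (- of_real c * of_real x) = complex_of_real (- (real d * c * x))"
        "of_nat d * (of_real c * (of_real x - 1)) = complex_of_real (- (real d * c * (1 - x)))"
        by (simp_all add: algebra_simps)
      thus "b d * of_nat d ^ j * exp (of_nat d * (- of_real c * of_real x)) - b d * of_nat d ^ j * exp (of_nat d * (of_real c * (of_real x - 1))) = of_real (g d)"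
        by (simp only: exp_of_real) (simp add: b_def g_def diff_divide_distrib algebra_simps)
    qed
    finally have "(\<lambda>d. complex_of_real (g d)) sums (exp_series b j (- of_real c * of_real x) - exp_series b j (of_real c * (of_real x - 1)))" .
    hence "(\<lambda>d. complex_of_real (g (Suc d))) sums (exp_series b j (- of_real c * of_real x) - exp_series b j (of_real c * (of_real x - 1)))"
      by (subst sums_Suc_iff) (simp add: g_def)
    hence "exp_series b j (- of_real c * of_real x) - exp_series b j (of_real c * (of_real x - 1)) = of_real (\<Sum>d. g (Suc d))"
      by (rule sums_of_real_imp_suminf)
    moreover have "B j (of_real x) = of_real c ^ j * (exp_series b j (- of_real c * of_real x) - exp_series b j (of_real c * (of_real x - 1)))"
      using that unfolding B_def by (simp add: power_minus_even algebra_simps)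
    ultimately show ?thesis by (simp only: g_def of_real_mult of_real_power)
  qed

  have P_even: "P j (of_real x) = of_real (Polygamma j (1 - x) - Polygamma j x)" if "even j" "x \<in> {0<..<1}" for j x
    using that Polygamma_of_real[of x j, where ?'a = complex] Polygamma_of_real[of "1 - x" j, where ?'a = complex] by (simp add: P_def)

  \<comment> \<open>The induction passes through odd j too, where \<open>A j\<close> is a cosine
    series. The translations into real series are used only at j = 0 and at the even j = k.\<close>
  have "\<forall>x\<in>{0<..<1}. A j (of_real x) = - P j (of_real x) / (4 * of_real pi) + of_real (pi / (2 * t)) * L j (of_real x) + of_real (pi / t) * B j (of_real x)" for j
  proof (induction j)
    case 0
    show ?case
    proof
      fix x :: real assume x: "x \<in> {0<..<1}"
      have "complex_of_real x \<notin> \<int>" using x by (auto simp: complex_eq_iff elim!: Ints_cases)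
      from Digamma_reflection[OF this] have "of_real (Digamma (1 - x) - Digamma x) = of_real pi * cot (complex_of_real (pi * x))"
        using P_even[OF _ x, of 0] by (simp add: P_def)
      hence "Digamma (1 - x) - Digamma x = pi * cot (pi * x)"
        by (simp only: cot_of_real[symmetric] of_real_mult[symmetric] of_real_eq_iff)
      hence D: "Digamma x = Digamma (1 - x) - pi * cot (pi * x)" by simp
      thus "A 0 (of_real x) = - P 0 (of_real x) / (4 * of_real pi) + of_real (pi / (2 * t)) * L 0 (of_real x) + of_real (pi / t) * B 0 (of_real x)"
        using sin_lambert_theta[OF t, of x] x
        by (subst A_even, simp, subst P_even, simp, simp, subst B_even, simp, simp) (simp add: L_def c_def D)
    qed
  next
    case (Suc j)
    show ?case
    proof
      fix x :: real assume x: "x \<in> {0<..<1}"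
      have "((\<lambda>z. w ^ j * exp_series a j (w * z) - (- w) ^ j * exp_series a j (- w * z)) has_field_derivative
        w ^ Suc j * exp_series a (Suc j) (w * of_real x) - (- w) ^ Suc j * exp_series a (Suc j) (- w * of_real x)) (at (of_real x))"
        by (rule derivative_eq_intros DERIV_chain2[OF exp_series_has_field_derivative[OF sa]] nw refl | simp add: algebra_simps)+
      hence "((\<lambda>z. A j z) has_field_derivative A (Suc j) (of_real x)) (at (of_real x))"
        unfolding A_def by (rule DERIV_cdivide)
      hence 1: "((\<lambda>x. A j (of_real x)) has_vector_derivative A (Suc j) (of_real x)) (at x)"
        by (rule has_vector_derivative_real_field)
      have 2: "((\<lambda>z. B j z) has_field_derivative B (Suc j) (of_real x)) (at (of_real x))"
        unfolding B_def
        by (rule derivative_eq_intros DERIV_chain2[OF exp_series_has_field_derivative[OF sb]] nb x refl | simp add: algebra_simps)+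
      have 3: "(P j has_field_derivative P (Suc j) (of_real x)) (at (of_real x))"
      proof -
        have "complex_of_real x \<notin> \<int>\<^sub>\<le>\<^sub>0" "1 - complex_of_real x \<notin> \<int>\<^sub>\<le>\<^sub>0"
          using x by (auto elim!: nonpos_Ints_cases simp: complex_eq_iff)
        thus ?thesis unfolding P_def by (auto intro!: derivative_eq_intros)
      qed
      have 4: "(L j has_field_derivative L (Suc j) (of_real x)) (at (of_real x))"
        unfolding L_def by (cases j) (auto intro!: derivative_eq_intros)
      have "((\<lambda>z. - P j z / (4 * of_real pi) + of_real (pi / (2 * t)) * L j z + of_real (pi / t) * B j z)
        has_field_derivative - P (Suc j) (of_real x) / (4 * of_real pi) + of_real (pi / (2 * t)) * L (Suc j) (of_real x) + of_real (pi / t) * B (Suc j) (of_real x)) (at (of_real x))"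
        by (intro DERIV_add DERIV_cmult DERIV_minus DERIV_cdivide 2 3 4)
      hence "((\<lambda>x. - P j (of_real x) / (4 * of_real pi) + of_real (pi / (2 * t)) * L j (of_real x) + of_real (pi / t) * B j (of_real x))
        has_vector_derivative - P (Suc j) (of_real x) / (4 * of_real pi) + of_real (pi / (2 * t)) * L (Suc j) (of_real x) + of_real (pi / t) * B (Suc j) (of_real x)) (at x)"
        by (rule has_vector_derivative_real_field)
      \<comment> \<open>The identity for j is known only on the real interval, so the complex
        derivatives are restricted to real derivatives along it. Openness of the interval allows the
        two sides to be exchanged, and uniqueness of derivatives gives the next identity.\<close>
      hence "((\<lambda>x. A j (of_real x)) has_vector_derivative - P (Suc j) (of_real x) / (4 * of_real pi) + of_real (pi / (2 * t)) * L (Suc j) (of_real x) + of_real (pi / t) * B (Suc j) (of_real x)) (at x)"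
        by (rule has_vector_derivative_transform_within_open[where S = "{0<..<1}"]) (use Suc x in auto)
      from vector_derivative_unique_at[OF 1 this]
      show "A (Suc j) (of_real x) = - P (Suc j) (of_real x) / (4 * of_real pi) + of_real (pi / (2 * t)) * L (Suc j) (of_real x) + of_real (pi / t) * B (Suc j) (of_real x)" .
    qed
  qed
  hence "A k (of_real \<theta>) = - P k (of_real \<theta>) / (4 * of_real pi) + of_real (pi / (2 * t)) * L k (of_real \<theta>) + of_real (pi / t) * B k (of_real \<theta>)"
    using \<theta> by simp
  moreover have "L k (of_real \<theta>) = of_real (if k = 0 then 1 - 2 * \<theta> else 0)" using k by (auto simp: L_def)
  moreover have \<theta>': "\<theta> \<in> {0<..<1}" using \<theta> by simp
  moreover have "(-1) ^ n = complex_of_real ((-1) ^ n)" for n by simp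
  ultimately have "complex_of_real ((-1) ^ (k div 2) * ((2 * pi) ^ k * (\<Sum>d. real (Suc d) ^ k * sin (2 * pi * \<theta> * real (Suc d)) / (exp (real (Suc d) * t) - 1)))) =
    of_real (- (Polygamma k (1 - \<theta>) - Polygamma k \<theta>) / (4 * pi) + pi / (2 * t) * (if k = 0 then 1 - 2 * \<theta> else 0)
    + pi / t * (c ^ k * (\<Sum>d. real (Suc d) ^ k * (exp (- (real (Suc d) * c * \<theta>)) - exp (- (real (Suc d) * c * (1 - \<theta>)))) / (1 - exp (- (real (Suc d) * c))))))"
    unfolding A_even[OF k] P_even[OF k \<theta>'] B_even[OF k \<theta>']
    by (simp only: of_real_add of_real_mult of_real_divide of_real_minus of_real_numeral)
  thus ?thesis unfolding of_real_eq_iff by (simp only: mult.assoc) (auto simp: mult_ac)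
qed

section \<open>Mellin integrals\<close>

text \<open>Termwise integration for absolutely convergent sums, obtained from Lebesgue integrals of
  functions cut off by the indicator of S. The norm estimate is what makes a nested use possible:
  the inner sum becomes a single term with controlled integral.\<close>

lemma absolutely_integrable_suminf:
  fixes f :: "nat \<Rightarrow> real \<Rightarrow> complex"
  assumes int: "\<And>i. f i absolutely_integrable_on S"
    and summable: "\<And>x. x \<in> S \<Longrightarrow> summable (\<lambda>i. norm (f i x))"
    and sums: "summable (\<lambda>i. integral S (\<lambda>x. norm (f i x)))"
  shows "(\<lambda>x. \<Sum>i. f i x) absolutely_integrable_on S"
    and "(\<lambda>i. integral S (f i)) sums integral S (\<lambda>x. \<Sum>i. f i x)"
    and "integral S (\<lambda>x. norm (\<Sum>i. f i x)) \<le> (\<Sum>i. integral S (\<lambda>x. norm (f i x)))"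
proof -
  let ?F = "\<lambda>i x. indicator S x *\<^sub>R f i x"
  have F: "integrable lebesgue (?F i)" for i
    using int[of i] by (simp add: set_integrable_def)
  have AE: "AE x in lebesgue. summable (\<lambda>i. norm (?F i x))"
    using summable by (auto intro!: AE_I2 simp: indicator_def)
  have norm_F: "integral\<^sup>L lebesgue (\<lambda>x. norm (?F i x)) = integral S (\<lambda>x. norm (f i x))" for i
    using set_lebesgue_integral_eq_integral(2)[OF absolutely_integrable_norm[OF int[of i]]]
    by (simp add: set_lebesgue_integral_def o_def)
  hence S: "summable (\<lambda>i. integral\<^sup>L lebesgue (\<lambda>x. norm (?F i x)))" using sums by simp
  have eq: "(\<Sum>i. ?F i x) = indicator S x *\<^sub>R (\<Sum>i. f i x)" for x
    by (auto simp: indicator_def)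
  show *: "(\<lambda>x. \<Sum>i. f i x) absolutely_integrable_on S"
    using integrable_suminf[OF F AE S] unfolding eq by (simp add: set_integrable_def)
  have "(\<lambda>i. integral\<^sup>L lebesgue (?F i)) sums integral\<^sup>L lebesgue (\<lambda>x. \<Sum>i. ?F i x)"
    by (rule sums_integral[OF F AE S])
  also have "integral\<^sup>L lebesgue (\<lambda>x. \<Sum>i. ?F i x) = integral S (\<lambda>x. \<Sum>i. f i x)"
    unfolding eq using set_lebesgue_integral_eq_integral(2)[OF *] by (simp add: set_lebesgue_integral_def)
  also have "(\<lambda>i. integral\<^sup>L lebesgue (?F i)) = (\<lambda>i. integral S (f i))"
    using set_lebesgue_integral_eq_integral(2)[OF int] by (simp add: set_lebesgue_integral_def)
  finally show "(\<lambda>i. integral S (f i)) sums integral S (\<lambda>x. \<Sum>i. f i x)" .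
  have AE': "AE x in lebesgue. summable (\<lambda>i. norm (norm (?F i x)))" using AE by simp
  have S': "summable (\<lambda>i. integral\<^sup>L lebesgue (\<lambda>x. norm (norm (?F i x))))" using S by simp
  have "integral S (\<lambda>x. norm (\<Sum>i. f i x)) = integral\<^sup>L lebesgue (\<lambda>x. norm (\<Sum>i. ?F i x))"
    using set_lebesgue_integral_eq_integral(2)[OF absolutely_integrable_norm[OF *]]
    unfolding eq by (simp add: set_lebesgue_integral_def o_def)
  also have "\<dots> \<le> integral\<^sup>L lebesgue (\<lambda>x. \<Sum>i. norm (?F i x))"
  proof (rule integral_mono_AE)
    show "integrable lebesgue (\<lambda>x. norm (\<Sum>i. ?F i x))"
      by (intro integrable_norm integrable_suminf F AE S)
    show "integrable lebesgue (\<lambda>x. \<Sum>i. norm (?F i x))"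
      by (rule integrable_suminf[OF integrable_norm[OF F] AE' S'])
    show "AE x in lebesgue. norm (\<Sum>i. ?F i x) \<le> (\<Sum>i. norm (?F i x))"
      using AE by eventually_elim (rule summable_norm)
  qed
  also have "\<dots> = (\<Sum>i. integral\<^sup>L lebesgue (\<lambda>x. norm (?F i x)))"
    by (rule integral_suminf[OF integrable_norm[OF F] AE' S'])
  finally show "integral S (\<lambda>x. norm (\<Sum>i. f i x)) \<le> (\<Sum>i. integral S (\<lambda>x. norm (f i x)))"
    unfolding norm_F .
qed

text \<open>The substitution t to a t in Euler's integral; complex powers are multiplicative on
  positive reals, so the factor \<open>of_real a powr z\<close> comes out.\<close>

lemma Gamma_integral_scaled:
  fixes z :: complex and a :: real
  assumes z: "Re z > 0" and a: "a > 0"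
  shows "(\<lambda>t. of_real t powr (z - 1) * of_real (exp (- (a * t)))) absolutely_integrable_on {0<..}"
    and "integral {0<..} (\<lambda>t. of_real t powr (z - 1) * of_real (exp (- (a * t)))) = Gamma z / of_real a powr z"
proof -
  let ?f = "\<lambda>t. complex_of_real t powr (z - 1) / of_real (exp t)"
  let ?g = "\<lambda>t. complex_of_real t powr (z - 1) * of_real (exp (- (a * t)))"
  have im: "(*) a ` {0<..} = {0<..}" using a by (auto simp: image_iff intro!: exI[of _ "_ / a"] bexI[of _ "_ / a"])
  have "(\<lambda>t. \<bar>a\<bar> *\<^sub>R ?f (a * t)) absolutely_integrable_on {0<..} \<and> integral {0<..} (\<lambda>t. \<bar>a\<bar> *\<^sub>R ?f (a * t)) = Gamma z"
    using absolutely_integrable_Gamma_integral'[OF z] integral_unique[OF Gamma_integral_complex'[OF z]] a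
    by (subst has_absolute_integral_change_of_variables_real[where g = "(*) a"])
       (auto simp: im intro!: derivative_eq_intros inj_onI)
  moreover have "\<bar>a\<bar> *\<^sub>R ?f (a * t) = of_real a powr z * ?g t" if "t \<in> {0<..}" for t
  proof -
    have "complex_of_real (a * t) powr (z - 1) = of_real a powr (z - 1) * of_real t powr (z - 1)"
      using that a by (simp add: powr_times_real)
    moreover have "of_real a * complex_of_real a powr (z - 1) = of_real a powr z"
      using a by (simp add: powr_diff)
    ultimately show ?thesis using a
      by (simp add: scaleR_conv_of_real exp_minus divide_inverse flip: mult.assoc)
  qed
  note eq = this
  have "(\<lambda>t. \<bar>a\<bar> *\<^sub>R ?f (a * t)) absolutely_integrable_on {0<..} \<longleftrightarrow> (\<lambda>t. of_real a powr z * ?g t) absolutely_integrable_on {0<..}"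
    by (rule set_integrable_cong[OF refl refl], rule eq)
  moreover have "integral {0<..} (\<lambda>t. \<bar>a\<bar> *\<^sub>R ?f (a * t)) = integral {0<..} (\<lambda>t. of_real a powr z * ?g t)"
    by (rule integral_cong, rule eq)
  ultimately have *: "(\<lambda>t. of_real a powr z * ?g t) absolutely_integrable_on {0<..}"
    "integral {0<..} (\<lambda>t. of_real a powr z * ?g t) = Gamma z"
    by (simp_all only: simp_thms)
  have az: "complex_of_real a powr z \<noteq> 0" using a by simp
  show ai: "?g absolutely_integrable_on {0<..}"
  proof -
    have "(\<lambda>t. inverse (of_real a powr z) * (of_real a powr z * ?g t)) absolutely_integrable_on {0<..}"
      by (intro set_integrable_mult_right *(1))
    thus ?thesis using az by (simp flip: mult.assoc)
  qed
  show "integral {0<..} ?g = Gamma z / of_real a powr z"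
    using *(2) az by (simp add: field_simps)
qed

text \<open>The modulus of the integrand is the same integrand at the real exponent
  \<open>Re z\<close>.\<close>

lemma Gamma_integral_scaled_norm:
  fixes z :: complex and a :: real
  assumes z: "Re z > 0" and a: "a > 0"
  shows "integral {0<..} (\<lambda>t. norm (of_real t powr (z - 1) * complex_of_real (exp (- (a * t))))) = Gamma (Re z) / a powr Re z"
proof -
  let ?g = "\<lambda>t. complex_of_real t powr (of_real (Re z) - 1) * of_real (exp (- (a * t)))"
  have "?g integrable_on {0<..}"
    using Gamma_integral_scaled(1)[of "of_real (Re z)" a] assms
    by (intro set_lebesgue_integral_eq_integral(1)) auto
  hence "(?g has_integral (Gamma (of_real (Re z)) / of_real a powr of_real (Re z))) {0<..}"
    using integrable_integral[of ?g "{0<..}"] Gamma_integral_scaled(2)[of "of_real (Re z)" a] assms by simp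
  from has_integral_linear[OF this bounded_linear_Re]
  have "((\<lambda>t. Re (?g t)) has_integral (Re (Gamma (of_real (Re z)) / of_real a powr of_real (Re z)))) {0<..}"
    by (simp only: o_def)
  also have "Re (Gamma (of_real (Re z)) / of_real a powr of_real (Re z)) = Gamma (Re z) / a powr Re z"
    using a powr_of_real[of a "Re z"] by (simp add: Gamma_complex_of_real)
  finally have g: "((\<lambda>t. Re (?g t)) has_integral (Gamma (Re z) / a powr Re z)) {0<..}" .
  have "Re (?g t) = norm (of_real t powr (z - 1) * complex_of_real (exp (- (a * t))))" if "t \<in> {0<..}" for t
    using that powr_of_real[of t "Re z - 1"] by (simp add: norm_mult norm_powr_real_powr)
  from has_integral_eq[OF this g]
  have "((\<lambda>t. norm (of_real t powr (z - 1) * complex_of_real (exp (- (a * t))))) has_integral (Gamma (Re z) / a powr Re z)) {0<..}" .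
  thus ?thesis by (rule integral_unique)
qed

section \<open>The Hurwitz zeta function\<close>

text \<open>The Weierstrass test on discs. The bound is asked only eventually, because in the
  application finitely many terms have a removable singularity in the disc and escape the uniform
  estimate.\<close>

lemma holomorphic_on_suminf_UNIV:
  fixes f :: "nat \<Rightarrow> complex \<Rightarrow> complex"
  assumes "\<And>n. f n holomorphic_on UNIV"
    and "\<And>R. \<exists>M. summable M \<and> (\<forall>\<^sub>F n in sequentially. \<forall>z\<in>cball 0 R. norm (f n z) \<le> M n)"
  shows "(\<lambda>z. \<Sum>n. f n z) holomorphic_on UNIV"
proof (rule holomorphic_uniform_sequence[where f = "\<lambda>n z. \<Sum>i<n. f i z"])
  fix z :: complex
  obtain M where "summable M" "\<forall>\<^sub>F n in sequentially. \<forall>w\<in>cball 0 (norm z + 1). norm (f n w) \<le> M n"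
    using assms(2)[of "norm z + 1"] by blast
  hence "uniform_limit (cball 0 (norm z + 1)) (\<lambda>n z. \<Sum>i<n. f i z) (\<lambda>z. \<Sum>n. f n z) sequentially"
    by (intro Weierstrass_m_test_ev)
  hence "uniform_limit (cball z 1) (\<lambda>n z. \<Sum>i<n. f i z) (\<lambda>z. \<Sum>n. f n z) sequentially"
    by (rule uniform_limit_on_subset) (simp add: cball_subset_cball_iff)
  thus "\<exists>d>0. cball z d \<subseteq> UNIV \<and> uniform_limit (cball z d) (\<lambda>n z. \<Sum>i<n. f i z) (\<lambda>z. \<Sum>n. f n z) sequentially"
    by (intro exI[of _ 1]) auto
qed (auto intro!: holomorphic_on_sum assms)

text \<open>The kernel is the generating function of the Bernoulli polynomials at 1 - \<alpha>, so
  \<open>h n\<close> is B_n(1 - \<alpha>)/n!. Its nearest singularities are at distance 2 pi > 6; a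
  radius beyond 1 is what gives absolute summability of \<open>h\<close> on the integration
  interval.\<close>

lemma zeta_kernel_power_series:
  fixes \<alpha> :: real
  obtains h :: "nat \<Rightarrow> complex" where "h 0 = 1" "h 1 = 1 / 2 - of_real \<alpha>" "summable (\<lambda>n. norm (h n))"
    "\<And>z. norm z < 6 \<Longrightarrow> z \<noteq> 0 \<Longrightarrow> (\<lambda>n. h n * z ^ n) sums (z * exp (- of_real \<alpha> * z) / (1 - exp (- z)))"
proof -
  \<comment> \<open>This is (1 - exp(-z))/z with its removable singularity filled in, phrased as a
    difference quotient of -exp(-z) at 0 so that holomorphy at 0 follows.\<close>
  define A where "A z = (if z = 0 then deriv (\<lambda>z. - exp (- z)) 0 else (- exp (- z) - (- exp (- 0))) / (z - 0))" for z :: complex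
  define f where "f z = exp (- of_real \<alpha> * z) / A z" for z
  define h where "h n = (deriv ^^ n) f 0 / fact n" for n
  have "((\<lambda>z::complex. - exp (- z)) has_field_derivative 1) (at 0)"
    by (auto intro!: derivative_eq_intros)
  hence A0: "A 0 = 1" by (auto simp: A_def dest: DERIV_imp_deriv)
  have A: "A z = (1 - exp (- z)) / z" if "z \<noteq> 0" for z using that by (simp add: A_def)
  have Anz: "A z \<noteq> 0" if "norm z < 6" for z
  proof (cases "z = 0")
    case False
    have "exp (- z) \<noteq> 1"
    proof
      assume "exp (- z) = 1"
      then obtain n :: int where n: "Re z = 0" "- Im z = of_int (2 * n) * pi"
        unfolding exp_eq_1 by auto
      hence "n \<noteq> 0" using False by (auto simp: complex_eq_iff)
      hence "1 \<le> \<bar>of_int n :: real\<bar>" by linarith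
      hence "2 * pi \<le> \<bar>- Im z\<bar>" unfolding n(2) by (simp add: abs_mult)
      also have "\<dots> \<le> norm z" using abs_Im_le_cmod[of z] by simp
      finally show False using that pi_gt3 by simp
    qed
    thus ?thesis using False by (simp add: A)
  qed (simp add: A0)
  have "A holomorphic_on UNIV" unfolding A_def
    by (intro pole_lemma_open holomorphic_intros) auto
  hence "A holomorphic_on ball 0 6" by (rule holomorphic_on_subset) auto
  hence hol: "f holomorphic_on ball 0 6" unfolding f_def
    by (intro holomorphic_intros) (auto simp: Anz)
  have sums: "(\<lambda>n. h n * z ^ n) sums f z" if "norm z < 6" for z
    using holomorphic_power_series[OF hol, of z] that by (simp add: h_def)
  have "summable (\<lambda>n. h n * 2 ^ n)" using sums[of 2] by (auto simp: sums_iff)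
  from powser_insidea[OF this, of 1] have "summable (\<lambda>n. norm (h n))" by simp
  moreover have "h 0 = 1" by (simp add: h_def f_def A0)
  moreover have "h 1 = 1 / 2 - of_real \<alpha>"
  proof -
    \<comment> \<open>As h 1 = f'(0) exists, it may be computed along the positive reals, where the
      asymptotic expansion of the difference quotient is available.\<close>
    have "(f has_field_derivative h 1) (at 0)"
      using holomorphic_derivI[OF hol] by (simp add: h_def)
    hence "((\<lambda>z. (f z - f 0) / (z - 0)) \<longlongrightarrow> h 1) (at 0)"
      by (simp add: has_field_derivative_iff)
    moreover have "filterlim complex_of_real (at 0) (at_right 0)"
      by (auto simp: filterlim_at eventually_at_filter intro!: tendsto_eq_intros)
    ultimately have "((\<lambda>t. (f (of_real t) - f 0) / (of_real t - 0)) \<longlongrightarrow> h 1) (at_right 0)"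
      by (rule filterlim_compose)
    moreover have "eventually (\<lambda>t. (f (of_real t) - f 0) / (of_real t - 0) = of_real ((t * exp (- \<alpha> * t) / (1 - exp (- t)) - 1) / t)) (at_right 0)"
      using eventually_at_right_less[of 0]
      by eventually_elim (simp add: f_def A A0 flip: exp_of_real)
    ultimately have "((\<lambda>t. complex_of_real ((t * exp (- \<alpha> * t) / (1 - exp (- t)) - 1) / t)) \<longlongrightarrow> h 1) (at_right 0)"
      by (rule Lim_transform_eventually)
    moreover have "((\<lambda>t. (t * exp (- \<alpha> * t) / (1 - exp (- t)) - 1) / t) \<longlongrightarrow> 1 / 2 - \<alpha>) (at_right 0)"
      by real_asymp
    hence "((\<lambda>t. complex_of_real ((t * exp (- \<alpha> * t) / (1 - exp (- t)) - 1) / t)) \<longlongrightarrow> of_real (1 / 2 - \<alpha>)) (at_right 0)"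
      by (rule tendsto_of_real)
    ultimately show ?thesis
      using tendsto_unique[OF trivial_limit_at_right_real] by fastforce
  qed
  moreover have "f z = z * exp (- of_real \<alpha> * z) / (1 - exp (- z))" if "z \<noteq> 0" for z
    using that by (simp add: f_def A)
  hence "(\<lambda>n. h n * z ^ n) sums (z * exp (- of_real \<alpha> * z) / (1 - exp (- z)))" if "norm z < 6" "z \<noteq> 0" for z
    using sums[of z] that by simp
  ultimately show ?thesis by (intro that)
qed

lemma complex_powr_integral_0_1:
  fixes w :: complex
  assumes "Re w > -1"
  shows "(\<lambda>t. of_real t powr w) absolutely_integrable_on {0<..1}"
    and "integral {0<..1} (\<lambda>t. of_real t powr w) = 1 / (w + 1)"
    and "integral {0<..1} (\<lambda>t. norm (of_real t powr w)) = 1 / (Re w + 1)"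
proof -
  have w: "w + 1 \<noteq> 0" using assms by (auto simp: complex_eq_iff)
  have spike: "negligible {x \<in> {0..1::real} - {0<..1}. P x}" "negligible {x \<in> {0<..1} - {0..1::real}. P x}" for P
    by (rule negligible_subset[of "{0}"]; auto)+
  have "((\<lambda>t. of_real t powr w) has_integral of_real 1 powr (w + 1) / (w + 1) - of_real 0 powr (w + 1) / (w + 1)) {0..1}"
  proof (rule fundamental_theorem_of_calculus_interior)
    show "continuous_on {0..1} (\<lambda>t. of_real t powr (w + 1) / (w + 1))"
      using assms w by (intro continuous_intros) auto
    fix t :: real assume t: "t \<in> {0<..<1}"
    have "((\<lambda>z. z powr (w + 1) / (w + 1)) has_field_derivative (of_real t powr w)) (at (of_real t))"
      using t w by (auto intro!: derivative_eq_intros)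
    thus "((\<lambda>t. of_real t powr (w + 1) / (w + 1)) has_vector_derivative (of_real t powr w)) (at t)"
      by (rule has_vector_derivative_real_field)
  qed auto
  hence 1: "((\<lambda>t. of_real t powr w) has_integral 1 / (w + 1)) {0<..1}"
    by (subst (asm) has_integral_spike_set_eq[OF spike]) simp
  thus "integral {0<..1} (\<lambda>t. of_real t powr w) = 1 / (w + 1)" by (rule integral_unique)
  have "((\<lambda>t. t powr Re w) has_integral (1 / (Re w + 1))) {0..1}"
    using has_integral_powr_from_0[of "Re w" 1] assms by simp
  hence "((\<lambda>t. t powr Re w) has_integral (1 / (Re w + 1))) {0<..1}"
    by (subst (asm) has_integral_spike_set_eq[OF spike])
  note h = this
  have "norm (complex_of_real t powr w) = t powr Re w" if "t \<in> {0<..1}" for t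
    using that by (simp add: norm_powr_real_powr)
  from has_integral_eq[OF this[symmetric] h]
  have 2: "((\<lambda>t. norm (complex_of_real t powr w)) has_integral (1 / (Re w + 1))) {0<..1}" .
  thus "integral {0<..1} (\<lambda>t. norm (complex_of_real t powr w)) = 1 / (Re w + 1)" by (rule integral_unique)
  show "(\<lambda>t. of_real t powr w) absolutely_integrable_on {0<..1}"
    using 1 2 by (auto simp: absolutely_integrable_on_def)
qed

text \<open>\<open>rGamma\<close> vanishes at -j, so the quotient has a removable singularity. At j
  = 0 and s = 0 its value is the derivative of \<open>rGamma\<close> at 0, which is 1 and later
  fixes the zeta value at 0.\<close>

lemma rGamma_quotient_entire:
  obtains q :: "nat \<Rightarrow> complex \<Rightarrow> complex" where
    "\<And>j. q j holomorphic_on UNIV" "\<And>j s. s \<noteq> - of_nat j \<Longrightarrow> q j s = rGamma s / (s + of_nat j)" "q 0 0 = 1"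
proof -
  define q where "q j s = (if s = - of_nat j then deriv rGamma (- of_nat j) else (rGamma s - rGamma (- of_nat j)) / (s - - of_nat j))" for j and s :: complex
  have "q j holomorphic_on UNIV" for j
    unfolding q_def by (intro pole_lemma_open holomorphic_intros) auto
  moreover have "q j s = rGamma s / (s + of_nat j)" if "s \<noteq> - of_nat j" for j s
    using that by (simp add: q_def)
  moreover have "q 0 0 = 1"
  proof -
    have "(rGamma has_field_derivative 1) (at (0::complex))"
      using has_field_derivative_rGamma_nonpos_int[of 0] by simp
    thus ?thesis by (simp add: q_def DERIV_imp_deriv)
  qed
  ultimately show ?thesis by (intro that)
qed

text \<open>The half-line is cut into unit intervals. Each piece is entire in s by differentiation
  under the integral, and exp(-\<alpha> t) beats the power of t uniformly for bounded s. Absolute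
  integrability then supplies the dominating function that identifies the sum of the pieces with the
  integral.\<close>

lemma incomplete_zeta_integral_entire:
  fixes \<alpha> :: real
  assumes \<alpha>: "\<alpha> > 0"
  defines "F \<equiv> \<lambda>s t. of_real t powr (s - 1) * complex_of_real (exp (- \<alpha> * t) / (1 - exp (- t)))"
  obtains E where "E holomorphic_on UNIV" 
    "\<And>s. F s absolutely_integrable_on {1..} \<Longrightarrow> integral {1..} (F s) = E s"
proof -
  define a where "a n = real (Suc n)" for n
  have a: "a n \<ge> 1" "a (Suc n) = a n + 1" "a n \<le> a (Suc n)" for n by (auto simp: a_def)
  define e where "e n s = integral (cbox (a n) (a (Suc n))) (F s)" for n s
  have cont: "continuous_on (cbox (a n) (a (Suc n))) (F s)" for n s
    unfolding F_def using a(1)[of n] by (auto intro!: continuous_intros)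
  have intF: "F s integrable_on cbox (a n) (a (Suc n))" for n s
    by (rule integrable_continuous[OF cont])
  have hol: "e n holomorphic_on UNIV" for n
    unfolding e_def
  proof (rule leibniz_rule_holomorphic)
    fix s t assume "t \<in> cbox (a n) (a (Suc n))"
    hence "t > 0" using a(1)[of n] by simp
    have "((\<lambda>s. of_real t powr (s - 1)) has_field_derivative (Ln (of_real t) * of_real t powr (s - 1) * 1)) (at s)"
      by (rule DERIV_chain2[OF has_field_derivative_powr_right]) (use \<open>t > 0\<close> in \<open>auto intro!: derivative_eq_intros\<close>)
    from DERIV_cmult_right[OF this, of "of_real (exp (- \<alpha> * t) / (1 - exp (- t)))"]
    show "((\<lambda>s. F s t) has_field_derivative (of_real (ln t) * F s t)) (at s within UNIV)"
      unfolding F_def using \<open>t > 0\<close> by (simp only: Ln_of_real mult.assoc mult_1_right)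
  next
    show "continuous_on (UNIV \<times> cbox (a n) (a (Suc n))) (\<lambda>(s, t). of_real (ln t) * F s t)"
      unfolding F_def using a(1)[of n] by (auto intro!: continuous_intros simp: split_beta)
  qed (use intF in auto)
  have bound: "norm (e n s) \<le> a (Suc n) powr R * exp (- \<alpha> * a n) / (1 - exp (- 1))" if s: "norm s \<le> R" for n s R
  proof -
    have "norm (e n s) \<le> a (Suc n) powr R * exp (- \<alpha> * a n) / (1 - exp (- 1)) * (a (Suc n) - a n)"
      unfolding e_def cbox_interval
    proof (rule integral_bound)
      show "continuous_on {a n..a (Suc n)} (F s)" using cont by (simp add: cbox_interval)
      fix t assume t: "t \<in> {a n..a (Suc n)}"
      hence t1: "t \<ge> 1" "a n \<le> t" "t \<le> a (Suc n)" using a(1)[of n] by auto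
      have "norm (F s t) = t powr (Re s - 1) * (exp (- \<alpha> * t) / (1 - exp (- t)))"
        using t1 by (simp add: F_def norm_mult norm_powr_real_powr norm_divide del: of_real_divide of_real_diff)
      also have "\<dots> \<le> a (Suc n) powr R * (exp (- \<alpha> * a n) / (1 - exp (- 1)))"
      proof (intro mult_mono frac_le)
        have "t powr (Re s - 1) \<le> t powr R"
          using t1 s abs_Re_le_cmod[of s] by (intro powr_mono) auto
        also have "\<dots> \<le> a (Suc n) powr R"
          using t1 s norm_ge_zero[of s] by (intro powr_mono2) linarith+
        finally show "t powr (Re s - 1) \<le> a (Suc n) powr R" .
      qed (use t1 \<alpha> in auto)
      finally show "norm (F s t) \<le> a (Suc n) powr R * exp (- \<alpha> * a n) / (1 - exp (- 1))" by simp
    qed (use a in auto)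
    thus ?thesis by (simp add: a)
  qed
  have sM: "summable (\<lambda>n. a (Suc n) powr R * exp (- \<alpha> * a n) / (1 - exp (- 1)))" for R
  proof (rule summable_comparison_test_bigo)
    show "summable (\<lambda>n. norm (1 / real n ^ 2))" 
      using inverse_power_summable[of 2, where ?'a = real] by (simp add: field_simps)
    show "(\<lambda>n. a (Suc n) powr R * exp (- \<alpha> * a n) / (1 - exp (- 1))) \<in> O(\<lambda>n. 1 / real n ^ 2)"
      unfolding a_def using \<alpha> by real_asymp
  qed
  define E where "E s = (\<Sum>n. e n s)" for s
  have "E holomorphic_on UNIV"
    unfolding E_def
  proof (rule holomorphic_on_suminf_UNIV[OF hol])
    fix R :: real
    show "\<exists>M. summable M \<and> (\<forall>\<^sub>F n in sequentially. \<forall>z\<in>cball 0 R. norm (e n z) \<le> M n)"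
      by (intro exI[of _ "\<lambda>n. a (Suc n) powr R * exp (- \<alpha> * a n) / (1 - exp (- 1))"] conjI sM always_eventually)
         (use bound in auto)
  qed
  moreover have "integral {1..} (F s) = E s" if F: "F s absolutely_integrable_on {1..}" for s
  proof -
    have Int: "{1..a k} \<inter> {1..} = {1..a k}" for k by auto
    let ?f = "\<lambda>k t. if t \<in> {1..a k} then F s t else 0"
    have partial: "F s integrable_on {1..a k} \<and> integral {1..a k} (F s) = (\<Sum>n<k. e n s)" for k
    proof (induction k)
      case 0
      show ?case using integrable_on_refl[of "F s" 1] by (simp add: a_def)
    next
      case (Suc k)
      have i: "F s integrable_on {1..a (Suc k)}"
        unfolding F_def by (intro integrable_continuous_interval continuous_intros) auto
      have "integral {1..a (Suc k)} (F s) = integral {1..a k} (F s) + integral {a k..a (Suc k)} (F s)"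
        using i a by (intro Henstock_Kurzweil_Integration.integral_combine[symmetric]) auto
      thus ?case using Suc i by (simp add: e_def)
    qed
    have "(\<lambda>k. integral {1..} (?f k)) \<longlonglongrightarrow> integral {1..} (F s)"
    proof (rule dominated_convergence)
      show "?f k integrable_on {1..}" for k
        unfolding integrable_restrict_Int Int using partial[of k] by simp
      show "(\<lambda>t. norm (F s t)) integrable_on {1..}"
        using F by (simp add: absolutely_integrable_on_def)
      show "(\<lambda>k. ?f k t) \<longlonglongrightarrow> F s t" if "t \<in> {1..}" for t
      proof (rule tendsto_eventually)
        obtain N where "t \<le> real N" using real_arch_simple by blast
        thus "\<forall>\<^sub>F k in sequentially. ?f k t = F s t"
          using that by (intro eventually_sequentiallyI[of N]) (auto simp: a_def)
      qed
    qed auto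
    moreover have "integral {1..} (?f k) = (\<Sum>n<k. e n s)" for k
      unfolding integral_restrict_Int Int using partial[of k] by simp
    ultimately have "(\<lambda>k. \<Sum>n<k. e n s) \<longlonglongrightarrow> integral {1..} (F s)" by simp
    thus ?thesis unfolding E_def by (simp add: sums_def sums_unique)
  qed
  ultimately show ?thesis by (rule that)
qed

lemma summable_shifted_powr:
  fixes \<alpha> \<sigma> :: real
  assumes "\<alpha> > 0" "\<sigma> > 1"
  shows "summable (\<lambda>n. (real n + \<alpha>) powr (- \<sigma>))"
proof (rule summable_comparison_test'[where N = 1])
  show "summable (\<lambda>n. real n powr (- \<sigma>))" using assms by (simp add: summable_real_powr_iff)
  show "norm ((real n + \<alpha>) powr (- \<sigma>)) \<le> real n powr (- \<sigma>)" if "n \<ge> 1" for n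
    using that assms by (simp add: powr_mono2')
qed

text \<open>The kernel is the geometric series of exp(-(n + \<alpha>) t), and each term is a scaled
  Gamma integral. Multiplying by \<open>rGamma s\<close> removes the Gamma factor.\<close>

lemma hurwitz_zeta_mellin:
  fixes \<alpha> :: real
  assumes \<alpha>: "\<alpha> > 0" and s: "Re s > 1"
  defines "F \<equiv> \<lambda>t. of_real t powr (s - 1) * complex_of_real (exp (- \<alpha> * t) / (1 - exp (- t)))"
  shows "F absolutely_integrable_on {0<..}"
    and "(\<lambda>n. of_real (real n + \<alpha>) powr (- s)) sums (rGamma s * integral {0<..} F)"
proof -
  let ?f = "\<lambda>n t. of_real t powr (s - 1) * complex_of_real (exp (- ((real n + \<alpha>) * t)))"
  have pos: "real n + \<alpha> > 0" for n using \<alpha> by (simp add: add_nonneg_pos)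
  have s0: "Re s > 0" using s by simp
  have F_sums: "(\<lambda>n. ?f n t) sums F t" and nsum: "summable (\<lambda>n. norm (?f n t))" if "t \<in> {0<..}" for t
  proof -
    have *: "(\<lambda>n. exp (- \<alpha> * t) * exp (- t) ^ n) sums (exp (- \<alpha> * t) * (1 / (1 - exp (- t))))"
      using that by (intro sums_mult geometric_sums) auto
    also have "(\<lambda>n. exp (- \<alpha> * t) * exp (- t) ^ n) = (\<lambda>n. exp (- ((real n + \<alpha>) * t)))"
      by (simp add: algebra_simps flip: exp_of_nat_mult exp_add)
    finally have *: "(\<lambda>n. exp (- ((real n + \<alpha>) * t))) sums (exp (- \<alpha> * t) / (1 - exp (- t)))" by simp
    show "(\<lambda>n. ?f n t) sums F t" unfolding F_def by (intro sums_mult sums_of_real *)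
    show "summable (\<lambda>n. norm (?f n t))"
      unfolding norm_mult norm_of_real using * by (auto intro!: summable_mult simp: sums_iff)
  qed
  have F_eq: "(\<Sum>n. ?f n t) = F t" if "t \<in> {0<..}" for t using F_sums[OF that] by (simp add: sums_iff)
  have ai: "?f n absolutely_integrable_on {0<..}" for n
    by (rule Gamma_integral_scaled(1)[OF s0 pos])
  have "summable (\<lambda>n. Gamma (Re s) * (real n + \<alpha>) powr (- Re s))"
    using summable_shifted_powr[OF \<alpha> s] by (rule summable_mult)
  hence sm: "summable (\<lambda>n. integral {0<..} (\<lambda>t. norm (?f n t)))"
    unfolding Gamma_integral_scaled_norm[OF s0 pos] by (simp add: powr_minus field_simps)
  note lim = absolutely_integrable_suminf[where f = ?f, OF ai nsum sm]
  have "(\<lambda>t. \<Sum>n. ?f n t) absolutely_integrable_on {0<..} \<longleftrightarrow> F absolutely_integrable_on {0<..}"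
    by (rule set_integrable_cong[OF refl refl F_eq])
  with lim(1) show "F absolutely_integrable_on {0<..}" by blast
  have "integral {0<..} (\<lambda>t. \<Sum>n. ?f n t) = integral {0<..} F"
    by (rule integral_cong[OF F_eq])
  with lim(2) have "(\<lambda>n. integral {0<..} (?f n)) sums integral {0<..} F" by simp
  hence "(\<lambda>n. Gamma s / of_real (real n + \<alpha>) powr s) sums integral {0<..} F"
    by (simp only: Gamma_integral_scaled(2)[OF s0 pos])
  from sums_mult[OF this, of "rGamma s"]
  have "(\<lambda>n. rGamma s * (Gamma s / of_real (real n + \<alpha>) powr s)) sums (rGamma s * integral {0<..} F)" .
  moreover have "s \<notin> \<int>\<^sub>\<le>\<^sub>0" using s by (auto elim!: nonpos_Ints_cases)
  hence "rGamma s * Gamma s = 1" by (simp add: rGamma_inverse_Gamma Gamma_eq_zero_iff)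
  hence "rGamma s * (Gamma s / of_real (real n + \<alpha>) powr s) = of_real (real n + \<alpha>) powr (- s)" for n
    using powr_minus[of "complex_of_real (real n + \<alpha>)" s]
    by (metis divide_inverse mult.assoc mult_1)
  ultimately show "(\<lambda>n. of_real (real n + \<alpha>) powr (- s)) sums (rGamma s * integral {0<..} F)" by simp
qed

text \<open>On \<open>{0<..1}\<close> the Mellin integrand is integrated termwise through the power series of
  \<open>t exp (- \<alpha> t) / (1 - exp (- t))\<close>; every resulting pole except the one at \<open>1\<close> is cancelled by a zero of
  \<open>rGamma\<close>. The part over \<open>{1..}\<close> is entire.\<close>
lemma hurwitz_zeta_continuation:
  fixes \<alpha> :: real
  assumes \<alpha>: "\<alpha> > 0"
  obtains H where "H holomorphic_on UNIV" "H 0 = 1 / 2 - of_real \<alpha>"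
    "\<And>s. Re s > 1 \<Longrightarrow> (\<lambda>n. of_real (real n + \<alpha>) powr (- s)) sums (rGamma s / (s - 1) + H s)"
proof -
  define F where "F s t = of_real t powr (s - 1) * complex_of_real (exp (- \<alpha> * t) / (1 - exp (- t)))" for s t
  obtain E where E: "E holomorphic_on UNIV" 
    "\<And>s. F s absolutely_integrable_on {1..} \<Longrightarrow> integral {1..} (F s) = E s"
    using incomplete_zeta_integral_entire[OF \<alpha>] unfolding F_def by blast
  obtain h :: "nat \<Rightarrow> complex" where h: "h 0 = 1" "h 1 = 1 / 2 - of_real \<alpha>" and sh: "summable (\<lambda>n. norm (h n))"
    and h_sums: "\<And>z. norm z < 6 \<Longrightarrow> z \<noteq> 0 \<Longrightarrow> (\<lambda>n. h n * z ^ n) sums (z * exp (- of_real \<alpha> * z) / (1 - exp (- z)))"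
    using zeta_kernel_power_series by blast
  obtain q :: "nat \<Rightarrow> complex \<Rightarrow> complex" where q: "\<And>j. q j holomorphic_on UNIV"
    "\<And>j s. s \<noteq> - of_nat j \<Longrightarrow> q j s = rGamma s / (s + of_nat j)" "q 0 0 = 1"
    using rGamma_quotient_entire by blast
  define Q where "Q s = (\<Sum>j. h (Suc j) * q j s)" for s
  define H where "H s = Q s + rGamma s * E s" for s
  have "Q holomorphic_on UNIV"
    unfolding Q_def
  proof (rule holomorphic_on_suminf_UNIV)
    show "(\<lambda>s. h (Suc j) * q j s) holomorphic_on UNIV" for j by (intro holomorphic_intros q)
    fix R :: real
    have "continuous_on (cball 0 R) (rGamma :: complex \<Rightarrow> complex)"
      by (intro holomorphic_on_imp_continuous_on holomorphic_intros)
    hence "bounded (rGamma ` cball (0::complex) R)"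
      by (intro compact_imp_bounded compact_continuous_image) auto
    then obtain B where "\<forall>s\<in>cball 0 R. norm (rGamma s :: complex) \<le> B"
      unfolding bounded_iff by blast
    hence B: "norm (rGamma s) \<le> B" if "norm s \<le> R" for s :: complex
      using that by simp
    show "\<exists>M. summable M \<and> (\<forall>\<^sub>F j in sequentially. \<forall>s\<in>cball 0 R. norm (h (Suc j) * q j s) \<le> M j)"
    proof (intro exI conjI)
      show "summable (\<lambda>j. norm (h (Suc j)) * B)"
        using sh summable_Suc_iff[of "\<lambda>n. norm (h n)"] by (intro summable_mult2) simp
      show "\<forall>\<^sub>F j in sequentially. \<forall>s\<in>cball 0 R. norm (h (Suc j) * q j s) \<le> norm (h (Suc j)) * B"
      proof (rule eventually_sequentiallyI, rule ballI)
        \<comment> \<open>From this index on, |s + j| is at least 1 for all |s| up to R, so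
          \<open>q j s\<close> is bounded by the maximum of \<open>rGamma\<close> on the
          disc.\<close>
        fix j and s :: complex assume j: "j \<ge> nat \<lceil>R\<rceil> + 1" and s: "s \<in> cball 0 R"
        have "real j \<ge> R + 1" using j by linarith
        moreover have "real j \<le> norm (s + of_nat j) + norm s"
          using norm_triangle_ineq4[of "s + of_nat j" s] by simp
        ultimately have 1: "norm (s + of_nat j) \<ge> 1" using s by simp
        hence "s \<noteq> - of_nat j" by auto
        hence "norm (q j s) = norm (rGamma s) / norm (s + of_nat j)" by (simp add: q norm_divide)
        also have "\<dots> \<le> norm (rGamma s) / 1" by (rule divide_left_mono) (use 1 in auto)
        also have "\<dots> \<le> B" using B s by simp
        finally show "norm (h (Suc j) * q j s) \<le> norm (h (Suc j)) * B"
          by (simp add: norm_mult mult_left_mono)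
      qed
    qed
  qed
  hence "H holomorphic_on UNIV" unfolding H_def by (intro holomorphic_intros E)
  moreover have "H 0 = 1 / 2 - of_real \<alpha>"
  proof -
    \<comment> \<open>Since \<open>rGamma 0 = 0\<close>, every \<open>q j 0\<close> with j > 0
      vanishes and so does the term with \<open>E\<close>. Only h 1 times \<open>q 0 0 = 1\<close>
      remains.\<close>
    have "h (Suc j) * q j 0 = (if j = 0 then h (Suc 0) else 0)" for j by (auto simp: q)
    hence "Q 0 = h (Suc 0)" unfolding Q_def using sums_single[of 0 "\<lambda>_. h (Suc 0)"] by (simp add: sums_iff)
    thus ?thesis using h(2) by (simp add: H_def)
  qed
  moreover have "(\<lambda>n. of_real (real n + \<alpha>) powr (- s)) sums (rGamma s / (s - 1) + H s)" if s: "Re s > 1" for s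
  proof -
    note mellin = hurwitz_zeta_mellin[OF \<alpha> s, folded F_def]
    have F1: "F s absolutely_integrable_on {0<..1}" and F2: "F s absolutely_integrable_on {1..}"
      by (rule set_integrable_subset[OF mellin(1)]; force)+
    have "{0<..1} \<inter> {1..} = {1::real}" by auto
    hence "integral ({0<..1} \<union> {1..}) (F s) = integral {0<..1} (F s) + integral {1..} (F s)"
      using F1 F2 by (intro integral_Un set_lebesgue_integral_eq_integral(1)) auto
    also have "{0<..1} \<union> {1..} = {0::real<..}" by auto
    finally have split: "integral {0<..} (F s) = integral {0<..1} (F s) + E s" using E(2)[OF F2] by simp

    \<comment> \<open>The expanded kernel carries an extra factor t, so the power t^(s - 1) becomes
      t^(s - 2). Integrating the j-th term gives the denominator s - 1 + j; j = 0 is the pole at 1,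
      and the later terms are reindexed to s + j.\<close>
    let ?g = "\<lambda>j t. h j * of_real t powr (s - 2 + of_nat j)"
    have w: "Re (s - 2 + of_nat j) > -1" for j using s by simp
    have g_eq: "(\<lambda>j. ?g j t) sums F s t" and g_norm: "summable (\<lambda>j. norm (?g j t))" if t: "t \<in> {0<..1}" for t
    proof -
      have pw: "of_real t powr (s - 2 + of_nat j) = of_real t powr (s - 2) * of_real t ^ j" for j
        using t by (simp add: powr_add powr_nat)
      have pw1: "of_real t powr (s - 1) = of_real t powr (s - 2) * of_real t"
        using t powr_add[of "complex_of_real t" "s - 2" 1] by simp
      have "of_real t powr (s - 2) * (of_real t * exp (- of_real \<alpha> * of_real t) / (1 - exp (- of_real t))) = F s t"
        unfolding F_def pw1 by (simp flip: exp_of_real)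
      moreover have "(\<lambda>j. of_real t powr (s - 2) * (h j * of_real t ^ j)) sums
        (of_real t powr (s - 2) * (of_real t * exp (- of_real \<alpha> * of_real t) / (1 - exp (- of_real t))))"
        using t by (intro sums_mult h_sums) auto
      ultimately show "(\<lambda>j. ?g j t) sums F s t"
        unfolding pw by (simp add: mult.left_commute)
      show "summable (\<lambda>j. norm (?g j t))"
      proof (rule summable_comparison_test')
        show "summable (\<lambda>j. norm (h j) * norm (complex_of_real t powr (s - 2)))"
          using sh by (rule summable_mult2)
        show "norm (norm (?g j t)) \<le> norm (h j) * norm (complex_of_real t powr (s - 2))" if "j \<ge> 0" for j
        proof -
          have "norm (complex_of_real t) ^ j \<le> 1" using t by (intro power_le_one) auto
          hence "norm (h j) * (norm (complex_of_real t powr (s - 2)) * norm (complex_of_real t) ^ j) \<le> norm (h j) * (norm (complex_of_real t powr (s - 2)) * 1)"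
            by (intro mult_left_mono) auto
          thus ?thesis unfolding pw norm_mult norm_power by simp
        qed
      qed
    qed
    have gF: "(\<Sum>j. ?g j t) = F s t" if "t \<in> {0<..1}" for t using g_eq[OF that] by (simp add: sums_iff)
    have ai: "?g j absolutely_integrable_on {0<..1}" for j
      by (intro set_integrable_mult_right complex_powr_integral_0_1 w)
    have sm: "summable (\<lambda>j. integral {0<..1} (\<lambda>t. norm (?g j t)))"
    proof (rule summable_comparison_test')
      show "summable (\<lambda>j. norm (h j) * (1 / (Re s - 1)))" using sh by (rule summable_mult2)
      show "norm (integral {0<..1} (\<lambda>t. norm (?g j t))) \<le> norm (h j) * (1 / (Re s - 1))" if "j \<ge> 0" for j
      proof -
        have "integral {0<..1} (\<lambda>t. norm (?g j t)) = norm (h j) * (1 / (Re s - 1 + real j))"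
          using complex_powr_integral_0_1(3)[OF w[of j]] by (simp add: norm_mult)
        moreover have "norm (h j) * (1 / (Re s - 1 + real j)) \<le> norm (h j) * (1 / (Re s - 1))"
          using s by (intro divide_left_mono mult_left_mono) auto
        ultimately show ?thesis using s by simp
      qed
    qed
    have int_g: "integral {0<..1} (?g j) = h j / (s - 1 + of_nat j)" for j
      using complex_powr_integral_0_1(2)[OF w[of j]] by (simp add: algebra_simps)
    have "integral {0<..1} (\<lambda>t. \<Sum>j. ?g j t) = integral {0<..1} (F s)"
      by (rule integral_cong[OF gF])
    with absolutely_integrable_suminf(2)[where f = ?g, OF ai g_norm sm]
    have "(\<lambda>j. h j / (s - 1 + of_nat j)) sums integral {0<..1} (F s)" by (simp only: int_g)
    hence "(\<lambda>j. rGamma s * (h j / (s - 1 + of_nat j))) sums (rGamma s * integral {0<..1} (F s))"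
      by (rule sums_mult)
    hence "(\<lambda>j. rGamma s * (h (Suc j) / (s - 1 + of_nat (Suc j)))) sums (rGamma s * integral {0<..1} (F s) - rGamma s / (s - 1))"
      by (subst sums_Suc_iff) (simp add: h)
    moreover have "rGamma s * (h (Suc j) / (s - 1 + of_nat (Suc j))) = h (Suc j) * q j s" for j
    proof -
      have "s \<noteq> - of_nat j" using s by (auto simp: complex_eq_iff)
      thus ?thesis by (simp add: q)
    qed
    ultimately have "Q s = rGamma s * integral {0<..1} (F s) - rGamma s / (s - 1)"
      by (simp add: Q_def sums_iff)
    hence "rGamma s * integral {0<..} (F s) = rGamma s / (s - 1) + H s"
      by (simp add: H_def split algebra_simps)
    with mellin(2) show ?thesis by (simp only:)
  qed
  ultimately show ?thesis by (rule that)
qed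

text \<open>Discharges the definite description: the candidate satisfies the conditions, and two
  solutions agree on Re z > 1, hence by the identity theorem on the connected punctured plane. The
  prescribed value at 1 settles the last point.\<close>

lemma hurwitz_zeta_eq:
  fixes \<alpha> :: real
  assumes H: "H holomorphic_on UNIV"
    and sums: "\<And>s. Re s > 1 \<Longrightarrow> (\<lambda>n. of_real (real n + \<alpha>) powr (- s)) sums (rGamma s / (s - 1) + H s)"
    and s: "s \<noteq> 1"
  shows "hurwitz_zeta s \<alpha> = rGamma s / (s - 1) + H s"
proof -
  define f where "f s = (if s = 1 then 0 else rGamma s / (s - 1) + H s)" for s
  have "(THE f. f holomorphic_on - {1} \<and> f 1 = 0 \<and>
      (\<forall>z. Re z > 1 \<longrightarrow> f z = (\<Sum>n. complex_of_real (real n + \<alpha>) powr - z))) = f"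
  proof (rule the_equality, intro conjI allI impI)
    have "(\<lambda>s. rGamma s / (s - 1) + H s) holomorphic_on - {1}"
      by (intro holomorphic_intros holomorphic_on_subset[OF H]) auto
    thus hf: "f holomorphic_on - {1}"
      by (rule holomorphic_transform) (auto simp: f_def)
    show "f 1 = 0" by (simp add: f_def)
    show fs: "f z = (\<Sum>n. complex_of_real (real n + \<alpha>) powr - z)" if "Re z > 1" for z
      using sums[OF that] that by (auto simp: f_def sums_iff)
    fix g assume g: "g holomorphic_on - {1} \<and> g 1 = 0 \<and>
      (\<forall>z. Re z > 1 \<longrightarrow> g z = (\<Sum>n. complex_of_real (real n + \<alpha>) powr - z))"
    show "g = f"
    proof
      fix z
      show "g z = f z"
      proof (cases "z = 1")
        case False
        show ?thesis
        proof (rule analytic_continuation_open[of "{z. Re z > 1}" "- {1}" g f])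
          show "open {z. 1 < Re z}" by (rule open_halfspace_Re_gt)
          have "2 \<in> {z. 1 < Re z}" by simp
          thus "{z. 1 < Re z} \<noteq> {}" by blast
          show "connected (- {1::complex})" by (rule connected_punctured_universe) simp
        qed (use g hf fs False in auto)
      qed (use g in \<open>simp add: f_def\<close>)
    qed
  qed
  thus ?thesis using s by (simp add: hurwitz_zeta_def f_def)
qed

lemma hurwitz_zeta_0:
  assumes "\<alpha> > 0"
  shows "hurwitz_zeta 0 \<alpha> = 1 / 2 - of_real \<alpha>"
proof -
  obtain H where H: "H holomorphic_on UNIV" "H 0 = 1 / 2 - of_real \<alpha>"
    "\<And>s. Re s > 1 \<Longrightarrow> (\<lambda>n. of_real (real n + \<alpha>) powr (- s)) sums (rGamma s / (s - 1) + H s)"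
    using hurwitz_zeta_continuation[OF assms] by blast
  show ?thesis using hurwitz_zeta_eq[OF H(1,3), of 0] H(2) by simp
qed

lemma hurwitz_zeta_sums:
  assumes "\<alpha> > 0" "Re s > 1"
  shows "(\<lambda>n. of_real (real n + \<alpha>) powr (- s)) sums hurwitz_zeta s \<alpha>"
proof -
  obtain H where H: "H holomorphic_on UNIV"
    "\<And>s. Re s > 1 \<Longrightarrow> (\<lambda>n. of_real (real n + \<alpha>) powr (- s)) sums (rGamma s / (s - 1) + H s)"
    using hurwitz_zeta_continuation[OF assms(1)] by blast
  have "s \<noteq> 1" using assms by auto
  thus ?thesis using hurwitz_zeta_eq[OF H, of s] H(2)[OF assms(2)] by simp
qed

text \<open>At an integer exponent above 1 the Dirichlet series is the series of
  \<open>Polygamma k\<close> up to sign and factorial.\<close>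

lemma hurwitz_zeta_Suc:
  assumes "\<alpha> > 0" "k > 0"
  shows "hurwitz_zeta (1 + of_nat k) \<alpha> = of_real ((-1) ^ Suc k * Polygamma k \<alpha> / fact k)"
proof -
  have "(\<lambda>n. of_real (real n + \<alpha>) powr (- (1 + of_nat k))) sums hurwitz_zeta (1 + of_nat k) \<alpha>"
    using assms by (intro hurwitz_zeta_sums) auto
  also have "(\<lambda>n. complex_of_real (real n + \<alpha>) powr (- (1 + of_nat k))) = (\<lambda>n. of_real (inverse ((\<alpha> + of_nat n) ^ Suc k)))"
  proof
    fix n
    have pos: "real n + \<alpha> > 0" using assms by (simp add: add_nonneg_pos)
    have "complex_of_real (real n + \<alpha>) powr (1 + of_nat k) = complex_of_real (real n + \<alpha>) ^ Suc k"
      using powr_nat'[of "complex_of_real (real n + \<alpha>)" "Suc k"] pos by (simp del: power_Suc of_real_add)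
    thus "complex_of_real (real n + \<alpha>) powr (- (1 + of_nat k)) = of_real (inverse ((\<alpha> + of_nat n) ^ Suc k))"
      by (simp only: powr_minus of_real_inverse of_real_power add.commute)
  qed
  finally show ?thesis
    using sums_of_real[OF Polygamma_LIMSEQ[of \<alpha> k], where ?'a = complex] assms
    by (intro sums_unique2) auto
qed

text \<open>The polar parts \<open>rGamma s / (s - 1)\<close> do not depend on the shift, so the
  difference extends continuously to 1. Its value there is found along real s > 1, where the series
  of differences converges uniformly up to s = 1 although the separate series do not.\<close>

lemma hurwitz_zeta_diff_Lim:
  assumes \<theta>: "0 < \<theta>" "\<theta> < 1"
  shows "Lim (at (1::complex)) (\<lambda>s. hurwitz_zeta s \<theta> - hurwitz_zeta s (1 - \<theta>)) = of_real (Digamma (1 - \<theta>) - Digamma \<theta>)"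
proof -
  let ?D = "\<lambda>s. hurwitz_zeta s \<theta> - hurwitz_zeta s (1 - \<theta>)"
  obtain H where H: "H holomorphic_on UNIV"
    "\<And>s. Re s > 1 \<Longrightarrow> (\<lambda>n. of_real (real n + \<theta>) powr (- s)) sums (rGamma s / (s - 1) + H s)"
    using hurwitz_zeta_continuation[OF \<theta>(1)] by blast
  obtain G where G: "G holomorphic_on UNIV"
    "\<And>s. Re s > 1 \<Longrightarrow> (\<lambda>n. of_real (real n + (1 - \<theta>)) powr (- s)) sums (rGamma s / (s - 1) + G s)"
    using hurwitz_zeta_continuation[of "1 - \<theta>"] \<theta> by auto
  have D: "?D s = H s - G s" if "s \<noteq> 1" for s
    using hurwitz_zeta_eq[OF H that] hurwitz_zeta_eq[OF G that] by simp
  have "isCont (\<lambda>s. H s - G s) 1"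
    using H(1) G(1) by (auto simp: continuous_on_eq_continuous_at intro!: continuous_intros dest!: holomorphic_on_imp_continuous_on)
  hence "((\<lambda>s. H s - G s) \<longlongrightarrow> H 1 - G 1) (at 1)" by (simp add: isCont_def)
  moreover have "eventually (\<lambda>s. H s - G s = ?D s) (at 1)"
    using D by (auto simp: eventually_at_filter)
  ultimately have lim: "(?D \<longlongrightarrow> H 1 - G 1) (at 1)"
    by (rule Lim_transform_eventually)
  define f where "f n s = (real n + \<theta>) powr (- s) - (real n + (1 - \<theta>)) powr (- s)" for n and s :: real
  have fD: "of_real (\<Sum>n. f n s) = ?D (of_real s)" if "s > 1" for s
  proof -
    have "(\<lambda>n. complex_of_real (real n + \<theta>) powr (- of_real s) - of_real (real n + (1 - \<theta>)) powr (- of_real s)) sums ?D (of_real s)"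
      using that \<theta> by (intro sums_diff hurwitz_zeta_sums) auto
    moreover have "complex_of_real (real n + \<theta>) powr (- of_real s) = of_real ((real n + \<theta>) powr (- s))"
      "complex_of_real (real n + (1 - \<theta>)) powr (- of_real s) = of_real ((real n + (1 - \<theta>)) powr (- s))" for n
      using \<theta> powr_of_real[of "real n + \<theta>" "- s"] powr_of_real[of "real n + (1 - \<theta>)" "- s"] by simp_all
    ultimately have sums: "(\<lambda>n. complex_of_real (f n s)) sums ?D (of_real s)"
      by (simp only: f_def of_real_diff)
    hence "summable (\<lambda>n. f n s)" by (metis sums_summable summable_complex_of_real)
    from sums_of_real[OF summable_sums[OF this], where ?'a = complex] sums
    show ?thesis by (rule sums_unique2)
  qed
  \<comment> \<open>Both powers lie between those of n and n + 1, so their difference is at most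
    n^(-s) (1 - (1 + 1/n)^(-s)). Over 1 \<le> s \<le> 2 the first factor is largest at s = 1 and the
    second at s = 2, and 1 - (1 + u)^(-2) \<le> 2 u finishes the estimate.\<close>
  have bound: "norm (f n s) \<le> 2 * (1 / real n ^ 2)" if "s \<in> {1..2}" "n \<ge> 1" for n s
  proof -
    have n: "real n > 0" using that by simp
    have *: "(real n + b) powr (- s) \<in> {(real n + 1) powr (- s)..real n powr (- s)}" if "0 < b" "b < 1" for b
      using that n \<open>s \<in> {1..2}\<close> by (auto intro!: powr_mono2')
    have "norm (f n s) \<le> real n powr (- s) - (real n + 1) powr (- s)"
      using *[of \<theta>] *[of "1 - \<theta>"] \<theta> by (simp add: f_def abs_le_iff)
    also have "(real n + 1) powr (- s) = real n powr (- s) * (1 + 1 / real n) powr (- s)"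
    proof -
      have "real n + 1 = real n * (1 + 1 / real n)" using n by (simp add: field_simps)
      thus ?thesis using n by (simp only: powr_mult)
    qed
    also have "real n powr (- s) - real n powr (- s) * (1 + 1 / real n) powr (- s) = real n powr (- s) * (1 - (1 + 1 / real n) powr (- s))"
      by (simp add: algebra_simps)
    also have "\<dots> \<le> real n powr (- 1) * (1 - (1 + 1 / real n) powr (- 2))"
    proof (rule mult_mono)
      show "real n powr (- s) \<le> real n powr (- 1)" using that by (intro powr_mono) auto
      have "(1 + 1 / real n) powr (- 2) \<le> (1 + 1 / real n) powr (- s)" using that by (intro powr_mono) auto
      thus "1 - (1 + 1 / real n) powr (- s) \<le> 1 - (1 + 1 / real n) powr (- 2)" by simp
      show "0 \<le> 1 - (1 + 1 / real n) powr (- s)" using powr_mono[of "- s" 0 "1 + 1 / real n"] that add_pos_nonneg[of 1 "1 / real n"] by (simp split: if_splits)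
    qed auto
    also have "(1 + 1 / real n) powr (- 2) = 1 / (1 + 1 / real n) ^ 2"
      by (subst powr_minus, subst powr_numeral) (auto simp: inverse_eq_divide add_pos_nonneg)
    also have "real n powr (- 1) * (1 - 1 / (1 + 1 / real n) ^ 2) \<le> 2 * (1 / real n ^ 2)"
    proof -
      have "1 - 1 / (1 + u) ^ 2 \<le> 2 * u" if "u \<ge> 0" for u :: real
      proof -
        have "(1 - 2 * u) * (1 + u) ^ 2 = 1 - (3 * u ^ 2 + 2 * u ^ 3)"
          by (simp add: power2_eq_square power3_eq_cube algebra_simps)
        moreover have "0 \<le> 3 * u ^ 2 + 2 * u ^ 3" using that by simp
        ultimately have "(1 - 2 * u) * (1 + u) ^ 2 \<le> 1" by linarith
        moreover have "(1 + u) ^ 2 > 0" using that by simp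
        ultimately have "1 - 2 * u \<le> 1 / (1 + u) ^ 2" by (simp add: pos_le_divide_eq)
        thus ?thesis by simp
      qed
      from this[of "1 / real n"] have "1 / real n * (1 - 1 / (1 + 1 / real n) ^ 2) \<le> 1 / real n * (2 * (1 / real n))"
        by (intro mult_left_mono) auto
      thus ?thesis using n by (simp add: powr_minus inverse_eq_divide power2_eq_square)
    qed
    finally show ?thesis .
  qed
  have "uniform_limit {1..2} (\<lambda>n s. \<Sum>i<n. f i s) (\<lambda>s. \<Sum>n. f n s) sequentially"
  proof (rule Weierstrass_m_test_ev)
    show "\<forall>\<^sub>F n in sequentially. \<forall>s\<in>{1..2}. norm (f n s) \<le> 2 * (1 / real n ^ 2)"
      using bound by (intro eventually_sequentiallyI[of 1]) blast
    show "summable (\<lambda>n. 2 * (1 / real n ^ 2))"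
      using inverse_power_summable[of 2, where ?'a = real] by (intro summable_mult) (simp add: field_simps)
  qed
  moreover have "\<forall>n. continuous_on {1..2} (\<lambda>s. \<Sum>i<n. f i s)"
    unfolding f_def using \<theta> by (auto intro!: continuous_intros)
  ultimately have "continuous_on {1..2} (\<lambda>s. \<Sum>n. f n s)"
    by (intro uniform_limit_theorem) auto
  hence "((\<lambda>s. \<Sum>n. f n s) \<longlongrightarrow> (\<Sum>n. f n 1)) (at 1 within {1..2})"
    by (auto simp: continuous_on_def)
  moreover have "at (1::real) within {1..2} = at_right 1" by (rule at_within_Icc_at_right) simp
  ultimately have "((\<lambda>s. complex_of_real (\<Sum>n. f n s)) \<longlongrightarrow> of_real (\<Sum>n. f n 1)) (at_right 1)"
    by (intro tendsto_of_real) simp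
  moreover have "eventually (\<lambda>s. complex_of_real (\<Sum>n. f n s) = ?D (of_real s)) (at_right 1)"
    using eventually_at_right_less[of 1] by eventually_elim (rule fD)
  ultimately have l1: "((\<lambda>s. ?D (of_real s)) \<longlongrightarrow> of_real (\<Sum>n. f n 1)) (at_right 1)"
    by (rule Lim_transform_eventually)
  have "filterlim complex_of_real (at 1) (at_right 1)"
    by (auto simp: filterlim_at eventually_at_filter intro!: tendsto_eq_intros)
  from filterlim_compose[OF lim this] l1 have "H 1 - G 1 = of_real (\<Sum>n. f n 1)"
    by (intro tendsto_unique[OF trivial_limit_at_right_real]) 
  also have "(\<Sum>n. f n 1) = Digamma (1 - \<theta>) - Digamma \<theta>"
  proof -
    have nz: "complex_of_real \<theta> \<notin> \<int>\<^sub>\<le>\<^sub>0" "complex_of_real (1 - \<theta>) \<notin> \<int>\<^sub>\<le>\<^sub>0"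
      using \<theta> by (auto elim!: nonpos_Ints_cases simp: complex_eq_iff)
    have "f n 1 = 1 / (real n + \<theta>) - 1 / (real n + (1 - \<theta>))" for n
      using \<theta> by (simp add: f_def powr_minus inverse_eq_divide)
    hence "(\<lambda>n. 1 / (of_nat n + complex_of_real \<theta>) - 1 / (of_nat n + complex_of_real (1 - \<theta>))) = (\<lambda>n. of_real (f n 1))"
      by (simp add: fun_eq_iff)
    with Digamma_diff_sums[OF nz] have "(\<lambda>n. complex_of_real (f n 1)) sums of_real (Digamma (1 - \<theta>) - Digamma \<theta>)"
      using \<theta> Polygamma_of_real[of \<theta> 0, where ?'a = complex] Polygamma_of_real[of "1 - \<theta>" 0, where ?'a = complex] by simp
    thus ?thesis using sums_of_real_imp_suminf of_real_eq_iff by metis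
  qed
  finally show ?thesis using lim by (intro tendsto_Lim) auto
qed

section \<open>Integral representation of the Bessel function\<close>

lemma power_le_fact_mult_exp:
  fixes y :: real
  assumes "y \<ge> 0"
  shows "y ^ n \<le> fact n * exp y"
proof -
  have "sum (\<lambda>n. y ^ n /\<^sub>R fact n) {n} \<le> (\<Sum>n. y ^ n /\<^sub>R fact n)"
    using assms by (intro sum_le_suminf summable_exp_generic) auto
  thus ?thesis by (simp add: exp_def field_simps)
qed

text \<open>One term of the exponential series bounds exp(-p/w) by M! (w/p)^M. The free M buys any
  power of decay in p at the price of raising the exponent of w in a Gamma integrand.\<close>

lemma bessel_kernel_bound:
  fixes p w \<sigma> :: real
  assumes "p > 0" "w > 0"
  shows "w powr (\<sigma> - 1) * exp (- w - p / w) \<le> fact M / p ^ M * (w powr (\<sigma> + real M - 1) * exp (- w))"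
proof -
  have "(p / w) ^ M \<le> fact M * exp (p / w)" using assms by (intro power_le_fact_mult_exp) simp
  hence "exp (- (p / w)) \<le> fact M / p ^ M * w powr real M"
    using assms by (simp add: exp_minus field_simps powr_realpow power_divide)
  hence "(w powr (\<sigma> - 1) * exp (- w)) * exp (- (p / w)) \<le> (w powr (\<sigma> - 1) * exp (- w)) * (fact M / p ^ M * w powr real M)"
    by (intro mult_left_mono) auto
  moreover have "w powr (\<sigma> + real M - 1) = w powr (\<sigma> - 1) * w powr real M"
  proof -
    have "\<sigma> + real M - 1 = (\<sigma> - 1) + real M" by simp
    thus ?thesis by (simp only: powr_add)
  qed
  ultimately show ?thesis by (simp add: mult_ac exp_add[symmetric] flip: exp_add) (simp add: exp_diff exp_minus divide_inverse mult_ac)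
qed

lemma bessel_kernel_integral:
  fixes \<nu> :: complex and p :: real and M :: nat
  assumes \<nu>: "Re \<nu> > 0" and p: "p > 0"
  defines "f \<equiv> \<lambda>w. complex_of_real w powr (\<nu> - 1) * of_real (exp (- w - p / w))"
  shows "f absolutely_integrable_on {0<..}"
    and "integral {0<..} (\<lambda>w. norm (f w)) \<le> fact M / p ^ M * Gamma (Re \<nu> + real M)"
proof -
  let ?g = "\<lambda>w. fact M / p ^ M * (w powr (Re \<nu> + real M - 1) * exp (- w))"
  have "((\<lambda>w. w powr (Re \<nu> + real M - 1) / exp w) has_integral Gamma (Re \<nu> + real M)) {0..}"
    using \<nu> by (intro Gamma_integral_real) (simp add: add_pos_nonneg)
  moreover have "negligible {x \<in> {0..} - {0<..}. P x}" "negligible {x \<in> {0<..} - {0..}. P x}" for P :: "real \<Rightarrow> bool"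
    by (rule negligible_subset[of "{0}"]; auto)+
  ultimately have "((\<lambda>w. w powr (Re \<nu> + real M - 1) / exp w) has_integral Gamma (Re \<nu> + real M)) {0<..}"
    by (subst (asm) has_integral_spike_set_eq)
  from has_integral_mult_right[OF this, of "fact M / p ^ M"]
  have g: "(?g has_integral (fact M / p ^ M * Gamma (Re \<nu> + real M))) {0<..}"
    by (simp add: exp_minus divide_inverse)
  have nf: "norm (f w) = w powr (Re \<nu> - 1) * exp (- w - p / w)" if "w \<in> {0<..}" for w
    using that by (simp add: f_def norm_mult norm_powr_real_powr)
  have fg: "norm (f w) \<le> ?g w" if "w \<in> {0<..}" for w
    using bessel_kernel_bound[of p w "Re \<nu>" M] p that by (simp add: nf)
  have "continuous_on {0<..} f" unfolding f_def by (intro continuous_intros) auto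
  hence "f \<in> borel_measurable (lebesgue_on {0<..})"
    by (rule continuous_imp_measurable_on_sets_lebesgue) auto
  thus ai: "f absolutely_integrable_on {0<..}"
    by (rule measurable_bounded_by_integrable_imp_absolutely_integrable[where g = ?g]) (use g fg in auto)
  hence "(\<lambda>w. norm (f w)) integrable_on {0<..}" by (simp add: absolutely_integrable_on_def)
  hence "integral {0<..} (\<lambda>w. norm (f w)) \<le> integral {0<..} ?g"
    using g fg by (intro integral_le) auto
  thus "integral {0<..} (\<lambda>w. norm (f w)) \<le> fact M / p ^ M * Gamma (Re \<nu> + real M)"
    by (simp only: integral_unique[OF g])
qed

text \<open>With w = sqrt(p) exp(t) the exponent -w - p/w becomes -2 sqrt(p) cosh t and the measure
  contributes exp(\<nu> t) on the whole line. Folding t to -t turns exp(\<nu> t) into 2 cosh(\<nu>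
  t), the source of the factor 2.\<close>

lemma besselK_conv_integral:
  fixes \<nu> :: complex and p :: real
  assumes \<nu>: "Re \<nu> > 0" and p: "p > 0"
  shows "integral {0<..} (\<lambda>w. complex_of_real w powr (\<nu> - 1) * of_real (exp (- w - p / w))) =
    2 * of_real p powr (\<nu> / 2) * besselK \<nu> (2 * sqrt p)"
proof -
  let ?f = "\<lambda>w. complex_of_real w powr (\<nu> - 1) * of_real (exp (- w - p / w))"
  let ?J = "\<lambda>t. exp (\<nu> * of_real t) * complex_of_real (exp (- (2 * sqrt p) * cosh t))"
  define c where "c = complex_of_real p powr (\<nu> / 2)"
  have c: "c \<noteq> 0" using p by (simp add: c_def)
  have sp: "sqrt p > 0" "sqrt p * sqrt p = p" using p by auto
  have im: "range (\<lambda>t. sqrt p * exp t) = {0<..}"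
  proof (intro equalityI subsetI)
    fix w :: real assume "w \<in> {0<..}"
    hence "w = sqrt p * exp (ln (w / sqrt p))" using sp by simp
    thus "w \<in> range (\<lambda>t. sqrt p * exp t)" by blast
  qed (use sp in auto)
  have eq: "\<bar>sqrt p * exp t\<bar> *\<^sub>R ?f (sqrt p * exp t) = c * ?J t" for t
  proof -
    define w where "w = sqrt p * exp t"
    have w: "w > 0" using sp by (simp add: w_def)
    have "of_real w * of_real w powr (\<nu> - 1) = of_real w powr \<nu>"
      using w powr_add[of "complex_of_real w" 1 "\<nu> - 1"] by simp
    also have "of_real w powr \<nu> = of_real (sqrt p) powr \<nu> * of_real (exp t) powr \<nu>"
      using sp unfolding w_def of_real_mult by (intro powr_times_real) auto
    also have "of_real (sqrt p) powr \<nu> = c"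
    proof -
      have l: "ln (sqrt p) = ln p / 2" using p by (simp add: ln_sqrt)
      have "complex_of_real (sqrt p) powr \<nu> = exp (\<nu> * of_real (ln (sqrt p)))"
        using sp(1) by (simp add: powr_def Ln_of_real)
      also have "\<dots> = c" unfolding l using p by (simp add: c_def powr_def Ln_of_real)
      finally show ?thesis .
    qed
    also have "complex_of_real (exp t) powr \<nu> = exp (\<nu> * of_real t)"
      by (simp add: powr_def Ln_of_real)
    finally have 1: "of_real w * of_real w powr (\<nu> - 1) = c * exp (\<nu> * of_real t)" .
    have "p / w = sqrt p * exp (- t)"
      using sp by (simp add: w_def exp_minus field_simps)
    hence "- w - p / w = - (2 * sqrt p) * cosh t"
      by (simp add: w_def cosh_field_def algebra_simps)
    hence 2: "exp (- w - p / w) = exp (- (2 * sqrt p) * cosh t)" by simp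
    have "\<bar>w\<bar> *\<^sub>R ?f w = (of_real w * of_real w powr (\<nu> - 1)) * of_real (exp (- w - p / w))"
      using w by (simp add: scaleR_conv_of_real)
    also have "\<dots> = c * ?J t" unfolding 1 2 by simp
    finally show ?thesis by (simp only: w_def)
  qed
  have "(\<lambda>t. \<bar>sqrt p * exp t\<bar> *\<^sub>R ?f (sqrt p * exp t)) absolutely_integrable_on UNIV \<and>
    integral UNIV (\<lambda>t. \<bar>sqrt p * exp t\<bar> *\<^sub>R ?f (sqrt p * exp t)) = integral {0<..} ?f"
    using bessel_kernel_integral(1)[OF \<nu> p] sp(1)
    by (subst has_absolute_integral_change_of_variables_real)
       (auto simp: im inj_on_def intro!: derivative_eq_intros)
  hence cJ: "(\<lambda>t. c * ?J t) absolutely_integrable_on UNIV" "integral UNIV (\<lambda>t. c * ?J t) = integral {0<..} ?f"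
    unfolding eq by auto
  have "(\<lambda>t. inverse c * (c * ?J t)) absolutely_integrable_on UNIV"
    by (intro set_integrable_mult_right cJ)
  hence J: "?J absolutely_integrable_on UNIV" using c by (simp flip: mult.assoc)
  have Jpos: "?J absolutely_integrable_on {0..}" and Jneg: "?J absolutely_integrable_on {..0}"
    by (rule set_integrable_subset[OF J]; simp)+
  have img: "uminus ` {0..} = {..0::real}" by (auto simp: image_iff intro!: bexI[of _ "- _"])
  have "(\<lambda>t. \<bar>- 1\<bar> *\<^sub>R ?J (- t)) absolutely_integrable_on {0..} \<and> integral {0..} (\<lambda>t. \<bar>- 1\<bar> *\<^sub>R ?J (- t)) = integral {..0} ?J"
    using Jneg by (subst has_absolute_integral_change_of_variables_real[where g = uminus])
      (auto simp: img intro!: derivative_eq_intros)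
  hence neg: "(\<lambda>t. ?J (- t)) absolutely_integrable_on {0..}" "integral {0..} (\<lambda>t. ?J (- t)) = integral {..0} ?J"
    by simp_all
  have "{0..} \<inter> {..0} = {0::real}" by auto
  hence "integral ({0..} \<union> {..0}) ?J = integral {0..} ?J + integral {..0} ?J"
    using Jpos Jneg by (intro integral_Un set_lebesgue_integral_eq_integral(1)) auto
  also have "{0..} \<union> {..0} = (UNIV :: real set)" by auto
  also have "integral {0..} ?J + integral {..0} ?J = integral {0..} (\<lambda>t. ?J t + ?J (- t))"
    using Jpos neg by (simp add: Henstock_Kurzweil_Integration.integral_add set_lebesgue_integral_eq_integral(1))
  also have "(\<lambda>t. ?J t + ?J (- t)) = (\<lambda>t. 2 * (complex_of_real (exp (- (2 * sqrt p) * cosh t)) * cosh (\<nu> * of_real t)))"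
    by (auto simp: fun_eq_iff cosh_field_def algebra_simps)
  also have "integral {0..} \<dots> = 2 * besselK \<nu> (2 * sqrt p)"
    unfolding besselK_def by (rule integral_mult_right)
  finally have i1: "integral UNIV ?J = 2 * besselK \<nu> (2 * sqrt p)" .
  have i2: "integral UNIV (\<lambda>t. c * ?J t) = c * integral UNIV ?J" by (rule integral_mult_right)
  show ?thesis unfolding cJ(2)[symmetric] i2 i1 by (simp add: c_def)
qed

section \<open>Termwise integration\<close>

lemma summable_power_exp_neg:
  fixes t :: real
  assumes "t > 0"
  shows "summable (\<lambda>n. real (Suc n) ^ j * exp (- (t * real n)))"
proof (rule summable_comparison_test_bigo)
  show "summable (\<lambda>n. norm (1 / real n ^ 2))"
    using inverse_power_summable[of 2, where ?'a = real] by (simp add: field_simps)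
  show "(\<lambda>n. real (Suc n) ^ j * exp (- (t * real n))) \<in> O(\<lambda>n. 1 / real n ^ 2)"
    using assms by real_asymp
qed

text \<open>There are at most n + 1 divisors, each contributing at most (n + 1)^k; hence the
  exponent \<open>Suc k\<close>.\<close>

lemma divisor_sum_bound:
  "\<bar>\<Sum>d | d dvd Suc n. real d ^ k * sin (2 * pi * real d * \<theta>)\<bar> \<le> real (Suc n) ^ Suc k"
proof -
  have sub: "{d. d dvd Suc n} \<subseteq> {1..Suc n}" by (auto simp: Suc_le_eq intro: dvd_imp_le dvd_pos_nat)
  have "norm (\<Sum>d | d dvd Suc n. real d ^ k * sin (2 * pi * real d * \<theta>)) \<le> real (card {d. d dvd Suc n}) * real (Suc n) ^ k"
  proof (rule sum_norm_bound)
    fix d assume "d \<in> {d. d dvd Suc n}"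
    hence "real d ^ k \<le> real (Suc n) ^ k" using sub by (intro power_mono) auto
    moreover have "\<bar>sin (2 * pi * real d * \<theta>)\<bar> \<le> 1" by simp
    ultimately show "norm (real d ^ k * sin (2 * pi * real d * \<theta>)) \<le> real (Suc n) ^ k"
      using mult_mono[of "real d ^ k" "real (Suc n) ^ k" "\<bar>sin (2 * pi * real d * \<theta>)\<bar>" 1]
      by (simp add: abs_mult del: of_nat_Suc)
  qed
  also have "\<dots> \<le> real (Suc n) * real (Suc n) ^ k"
    using card_mono[OF _ sub] by (intro mult_right_mono) (auto simp del: of_nat_Suc)
  finally show ?thesis by simp
qed

text \<open>Each 1/(exp(d t) - 1) is the sum of exp(-d m t) over m \<ge> 1; collecting equal
  products d m gives the divisor sums.\<close>

lemma lambert_divisor_series: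
  fixes t \<theta> :: real
  assumes t: "t > 0"
  shows "(\<Sum>n. (\<Sum>d | d dvd Suc n. real d ^ k * sin (2 * pi * real d * \<theta>)) * exp (- (real (Suc n) * t))) =
    (\<Sum>d. real (Suc d) ^ k * sin (2 * pi * \<theta> * real (Suc d)) / (exp (real (Suc d) * t) - 1))"
proof -
  let ?s = "\<lambda>d. real d ^ k * sin (2 * pi * real d * \<theta>)"
  let ?f = "\<lambda>d m. ?s d * exp (- (real d * real m * t))"
  have eq: "(\<Sum>d | d dvd Suc n. ?s d) * exp (- (real (Suc n) * t)) = (\<Sum>d | d dvd Suc n. ?f d (Suc n div d))" for n
    unfolding sum_distrib_right
  proof (rule sum.cong)
    fix d assume "d \<in> {d. d dvd Suc n}"
    hence "real (Suc n) = real d * real (Suc n div d)"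
      by (metis dvd_mult_div_cancel mem_Collect_eq of_nat_mult)
    thus "?s d * exp (- (real (Suc n) * t)) = ?f d (Suc n div d)" by simp
  qed auto
  have "(\<Sum>n. \<Sum>d | d dvd Suc n. ?f d (Suc n div d)) = (\<Sum>d. \<Sum>m. ?f (Suc d) (Suc m))"
  proof (rule suminf_divisors)
    show "norm (?f (Suc d) (Suc m)) \<le> (real (Suc d) ^ k * exp (- (t * real d))) * exp (- (t * real m))" for d m
    proof -
      have "real d + real m \<le> real (Suc d) * real (Suc m)" by (simp add: algebra_simps)
      hence "t * (real d + real m) \<le> t * (real (Suc d) * real (Suc m))"
        using t by (intro mult_left_mono) auto
      hence "exp (- (t * (real (Suc d) * real (Suc m)))) \<le> exp (- (t * (real d + real m)))"
        by (simp only: exp_le_cancel_iff neg_le_iff_le)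
      also have "\<dots> = exp (- (t * real d)) * exp (- (t * real m))"
        by (simp add: distrib_left flip: exp_add)
      also have "t * (real (Suc d) * real (Suc m)) = real (Suc d) * real (Suc m) * t"
        by (simp only: ac_simps)
      finally have 1: "exp (- (real (Suc d) * real (Suc m) * t)) \<le> exp (- (t * real d)) * exp (- (t * real m))" .
      have "norm (?f (Suc d) (Suc m)) = real (Suc d) ^ k * (\<bar>sin (2 * pi * real (Suc d) * \<theta>)\<bar> * exp (- (real (Suc d) * real (Suc m) * t)))"
        by (simp add: abs_mult del: of_nat_Suc)
      also have "\<dots> \<le> real (Suc d) ^ k * (1 * (exp (- (t * real d)) * exp (- (t * real m))))"
        using 1 by (intro mult_left_mono mult_mono) (auto simp del: of_nat_Suc)
      finally show ?thesis by simp
    qed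
    show "summable (\<lambda>n. norm (\<Sum>d | d dvd Suc n. ?f d (Suc n div d)))"
    proof (rule summable_comparison_test')
      show "summable (\<lambda>n. real (Suc n) ^ Suc k * exp (- (t * real n)))"
        by (rule summable_power_exp_neg[OF t])
      show "norm (norm (\<Sum>d | d dvd Suc n. ?f d (Suc n div d))) \<le> real (Suc n) ^ Suc k * exp (- (t * real n))" if "n \<ge> 0" for n
        unfolding eq[symmetric] norm_mult real_norm_def abs_mult abs_abs abs_exp_cancel
        using t by (intro mult_mono divisor_sum_bound) (auto simp: algebra_simps)
    qed
  qed (use t summable_power_exp_neg[OF t] in \<open>auto intro!: summable_exp_neg\<close>)
  also have "\<dots> = (\<Sum>d. real (Suc d) ^ k * sin (2 * pi * \<theta> * real (Suc d)) / (exp (real (Suc d) * t) - 1))"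
  proof (intro suminf_cong)
    fix d :: nat
    have "real (Suc d) * t > 0" using t by simp
    from sums_mult[OF exp_neg_Suc_sums[OF this], of "?s (Suc d)"]
    show "(\<Sum>m. ?f (Suc d) (Suc m)) = real (Suc d) ^ k * sin (2 * pi * \<theta> * real (Suc d)) / (exp (real (Suc d) * t) - 1)"
      by (simp add: sums_iff mult_ac del: of_nat_Suc)
  qed
  finally show ?thesis unfolding eq .
qed

lemma bessel_series_conv_integral:
  fixes \<nu> :: complex and X :: real and s :: "nat \<Rightarrow> real"
  assumes \<nu>: "Re \<nu> > 0" and X: "X > 0" and s: "\<And>n. \<bar>s n\<bar> \<le> real (Suc n) ^ j"
  shows "of_real X powr (\<nu> / 2) * (\<Sum>n. of_real (real (Suc n)) powr (\<nu> / 2) * besselK \<nu> (2 * sqrt (real (Suc n) * X)) * of_real (s n)) =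
    integral {0<..} (\<lambda>w. of_real w powr (\<nu> - 1) * of_real (exp (- w)) * of_real (\<Sum>n. s n * exp (- (real (Suc n) * (X / w))))) / 2"
proof -
  define p where "p n = real (Suc n) * X" for n
  have p: "p n > 0" for n using X by (simp add: p_def)
  \<comment> \<open>The coefficients grow at most like (n + 1)^j and the kernel bound decays like (n
    + 1)^(-M). The surplus 2 leaves the convergent series of 1/(n + 1)^2.\<close>
  define M where "M = j + 2"
  let ?f = "\<lambda>n w. complex_of_real (s n) * (of_real w powr (\<nu> - 1) * of_real (exp (- w - p n / w)))"
  have sq: "summable (\<lambda>n. 1 / real (Suc n) ^ 2)"
    using inverse_power_summable[of 2, where ?'a = real] by (subst summable_Suc_iff) (simp add: field_simps)
  have sp: "\<bar>s n\<bar> * (fact M / p n ^ M) \<le> fact M / X ^ M * (1 / real (Suc n) ^ 2)" for n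
  proof -
    have "\<bar>s n\<bar> * (fact M / p n ^ M) \<le> real (Suc n) ^ j * (fact M / p n ^ M)"
      using s[of n] p[of n] by (intro mult_right_mono) auto
    also have "\<dots> = fact M / X ^ M * (1 / real (Suc n) ^ 2)"
      using X by (simp add: M_def p_def power_mult_distrib power_add field_simps power2_eq_square del: of_nat_Suc)
    finally show ?thesis .
  qed
  have ai: "?f n absolutely_integrable_on {0<..}" for n
    by (intro set_integrable_mult_right bessel_kernel_integral(1)[OF \<nu> p])
  have norm_f: "norm (?f n w) \<le> fact M / X ^ M * (w powr (Re \<nu> + real M - 1) * exp (- w)) * (1 / real (Suc n) ^ 2)" if "w \<in> {0<..}" for n w
  proof -
    have "norm (?f n w) = \<bar>s n\<bar> * (w powr (Re \<nu> - 1) * exp (- w - p n / w))"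
      using that by (simp add: norm_mult norm_powr_real_powr)
    also have "\<dots> \<le> \<bar>s n\<bar> * (fact M / p n ^ M * (w powr (Re \<nu> + real M - 1) * exp (- w)))"
      using that by (intro mult_left_mono bessel_kernel_bound p) auto
    also have "\<dots> \<le> (fact M / X ^ M * (1 / real (Suc n) ^ 2)) * (w powr (Re \<nu> + real M - 1) * exp (- w))"
      unfolding mult.assoc[symmetric] using sp[of n] by (intro mult_right_mono) (simp_all add: mult.assoc)
    finally show ?thesis by (simp add: mult_ac)
  qed
  have nsum: "summable (\<lambda>n. norm (?f n w))" if "w \<in> {0<..}" for w
  proof (rule summable_comparison_test')
    show "summable (\<lambda>n. fact M / X ^ M * (w powr (Re \<nu> + real M - 1) * exp (- w)) * (1 / real (Suc n) ^ 2))"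
      by (rule summable_mult[OF sq])
  qed (unfold real_norm_def abs_norm_cancel, rule norm_f[OF that])
  have isum: "summable (\<lambda>n. integral {0<..} (\<lambda>w. norm (?f n w)))"
  proof (rule summable_comparison_test')
    show "summable (\<lambda>n. fact M / X ^ M * (1 / real (Suc n) ^ 2) * Gamma (Re \<nu> + real M))"
      by (intro summable_mult2 summable_mult sq)
    show "norm (integral {0<..} (\<lambda>w. norm (?f n w))) \<le> fact M / X ^ M * (1 / real (Suc n) ^ 2) * Gamma (Re \<nu> + real M)" if "n \<ge> 0" for n
    proof -
      have "integral {0<..} (\<lambda>w. norm (?f n w)) = \<bar>s n\<bar> * integral {0<..} (\<lambda>w. norm (complex_of_real w powr (\<nu> - 1) * of_real (exp (- w - p n / w))))"
        unfolding norm_mult[of "of_real (s n)"] norm_of_real by (rule integral_mult_right)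
      also have "\<dots> \<le> \<bar>s n\<bar> * (fact M / p n ^ M * Gamma (Re \<nu> + real M))"
        by (intro mult_left_mono bessel_kernel_integral(2)[OF \<nu> p]) auto
      also have "\<dots> \<le> fact M / X ^ M * (1 / real (Suc n) ^ 2) * Gamma (Re \<nu> + real M)"
        unfolding mult.assoc[symmetric] using sp[of n] \<nu>
        by (intro mult_right_mono) (auto simp: mult.assoc intro!: less_imp_le Gamma_real_pos add_pos_nonneg)
      finally have "integral {0<..} (\<lambda>w. norm (?f n w)) \<le> fact M / X ^ M * (1 / real (Suc n) ^ 2) * Gamma (Re \<nu> + real M)" .
      moreover have "0 \<le> integral {0<..} (\<lambda>w. norm (?f n w))"
        using ai[of n] by (intro Henstock_Kurzweil_Integration.integral_nonneg) (simp_all only: absolutely_integrable_on_def norm_ge_zero)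
      ultimately show ?thesis unfolding real_norm_def by linarith
    qed
  qed
  have "(\<lambda>n. integral {0<..} (?f n)) sums integral {0<..} (\<lambda>w. \<Sum>n. ?f n w)"
    by (rule absolutely_integrable_suminf(2)[OF ai nsum isum])
  moreover have "integral {0<..} (?f n) = 2 * of_real X powr (\<nu> / 2) *
      (of_real (real (Suc n)) powr (\<nu> / 2) * besselK \<nu> (2 * sqrt (real (Suc n) * X)) * of_real (s n))" for n
  proof -
    have "integral {0<..} (?f n) = of_real (s n) * (2 * of_real (p n) powr (\<nu> / 2) * besselK \<nu> (2 * sqrt (p n)))"
      by (subst besselK_conv_integral[OF \<nu> p, symmetric]) (rule integral_mult_right)
    also have "complex_of_real (p n) powr (\<nu> / 2) = of_real (real (Suc n)) powr (\<nu> / 2) * of_real X powr (\<nu> / 2)"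
      unfolding p_def of_real_mult using X by (intro powr_times_real) auto
    finally show ?thesis by (simp add: p_def mult_ac del: of_nat_Suc)
  qed
  ultimately have "(\<lambda>n. 2 * of_real X powr (\<nu> / 2) *
      (of_real (real (Suc n)) powr (\<nu> / 2) * besselK \<nu> (2 * sqrt (real (Suc n) * X)) * of_real (s n)))
      sums integral {0<..} (\<lambda>w. \<Sum>n. ?f n w)" by (simp only:)
  note sm = this
  have X0: "complex_of_real X powr (\<nu> / 2) \<noteq> 0" using X by simp
  have c: "2 * P * A / (2 * P) = A" "1 / (2 * P) * A = A / (2 * P)" if "P \<noteq> 0" for P A :: complex
    using that by auto
  have "(\<lambda>n. of_real (real (Suc n)) powr (\<nu> / 2) * besselK \<nu> (2 * sqrt (real (Suc n) * X)) * of_real (s n))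
      sums (integral {0<..} (\<lambda>w. \<Sum>n. ?f n w) / (2 * of_real X powr (\<nu> / 2)))"
    using sums_mult[OF sm, of "1 / (2 * of_real X powr (\<nu> / 2))"] by (simp only: c[OF X0])
  hence E1: "(\<Sum>n. of_real (real (Suc n)) powr (\<nu> / 2) * besselK \<nu> (2 * sqrt (real (Suc n) * X)) * of_real (s n))
      = integral {0<..} (\<lambda>w. \<Sum>n. ?f n w) / (2 * of_real X powr (\<nu> / 2))" by (rule sums_unique[symmetric])
  have E2: "integral {0<..} (\<lambda>w. \<Sum>n. ?f n w) = 
    integral {0<..} (\<lambda>w. of_real w powr (\<nu> - 1) * of_real (exp (- w)) * of_real (\<Sum>n. s n * exp (- (real (Suc n) * (X / w)))))"
  proof (rule integral_cong)
    fix w :: real assume w: "w \<in> {0<..}"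
    let ?u = "complex_of_real w powr (\<nu> - 1) * of_real (exp (- w))"
    have f: "?f n w = ?u * of_real (s n * exp (- (real (Suc n) * (X / w))))" for n
    proof -
      have "- w - p n / w = - w + - (real (Suc n) * (X / w))" by (simp add: p_def)
      hence "exp (- w - p n / w) = exp (- w) * exp (- (real (Suc n) * (X / w)))"
        by (simp only: exp_add)
      thus ?thesis unfolding of_real_mult by (simp only: of_real_mult mult.left_commute mult.assoc)
    qed
    have "w \<noteq> 0" using w by simp
    hence u: "?u \<noteq> 0"
      by (simp only: mult_eq_0_iff powr_eq_0_iff of_real_eq_0_iff exp_not_eq_zero simp_thms)
    have *: "(\<lambda>n. ?f n w) sums (\<Sum>n. ?f n w)"
      by (rule summable_sums[OF summable_norm_cancel[OF nsum[OF w]]])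
    have sm: "(\<lambda>n. complex_of_real (s n * exp (- (real (Suc n) * (X / w))))) sums ((\<Sum>n. ?f n w) / ?u)"
    proof -
      have "1 / u * (u * x) = x" "1 / u * x = x / u" if "u \<noteq> 0" for u x :: complex using that by auto
      from this[OF u] show ?thesis using sums_mult[OF *, of "1 / ?u"] unfolding f by (simp only:)
    qed
    have *: "A = u * B" if "A / u = B" "u \<noteq> 0" for A B u :: complex using that by auto
    show "(\<Sum>n. ?f n w) = ?u * of_real (\<Sum>n. s n * exp (- (real (Suc n) * (X / w))))"
      by (rule *[OF sums_of_real_imp_suminf[OF sm] u])
  qed
  have S: "(\<Sum>n. of_real (real (Suc n)) powr (\<nu> / 2) * besselK \<nu> (2 * sqrt (real (Suc n) * X)) * of_real (s n)) =
    integral {0<..} (\<lambda>w. of_real w powr (\<nu> - 1) * of_real (exp (- w)) * of_real (\<Sum>n. s n * exp (- (real (Suc n) * (X / w))))) / (2 * of_real X powr (\<nu> / 2))"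
    by (rule trans[OF E1 arg_cong[OF E2, of "\<lambda>I. I / (2 * of_real X powr (\<nu> / 2))"]])
  have *: "P * A = B / 2" if "A = B / (2 * P)" "P \<noteq> 0" for A B P :: complex using that by simp
  show ?thesis by (rule *[OF S X0])
qed

text \<open>The summand for a single d, where a becomes (d + 1) c. Expanding 1/(1 - exp(-a w)) and
  absorbing exp(-w) gives the exponents \<open>p m\<close> and \<open>q m\<close>. The norm bound
  drops the 1 in them, so that a enters only through a^(-Re z), as the later sum over d requires; Re
  z > 1 makes \<open>B\<close> finite.\<close>

lemma theta_integral_inner:
  fixes z :: complex and a \<theta> :: real
  assumes z: "Re z > 1" and a: "a > 0" and \<theta>: "0 < \<theta>" "\<theta> < 1"
  defines "p \<equiv> \<lambda>m. 1 + a * (real m + \<theta>)" and "q \<equiv> \<lambda>m. 1 + a * (real m + 1 - \<theta>)"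
    and "B \<equiv> \<Sum>m. (real m + \<theta>) powr (- Re z) + (real m + (1 - \<theta>)) powr (- Re z)"
    and "F \<equiv> \<lambda>w. of_real w powr (z - 1) * of_real (exp (- w)) * complex_of_real ((exp (- (a * w * \<theta>)) - exp (- (a * w * (1 - \<theta>)))) / (1 - exp (- (a * w))))"
  shows "F absolutely_integrable_on {0<..}"
    and "integral {0<..} F = (\<Sum>m. Gamma z / of_real (p m) powr z - Gamma z / of_real (q m) powr z)"
    and "integral {0<..} (\<lambda>w. norm (F w)) \<le> a powr (- Re z) * (Gamma (Re z) * B)"
proof -
  have z0: "Re z > 0" using z by simp
  have pq: "p m > 0" "q m > 0" for m
    using a \<theta> by (auto simp: p_def q_def intro!: add_pos_nonneg mult_nonneg_nonneg)
  let ?e = "\<lambda>b w. of_real w powr (z - 1) * complex_of_real (exp (- (b * w)))"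
  let ?g = "\<lambda>m w. ?e (p m) w - ?e (q m) w"
  have sB: "summable (\<lambda>m. (real m + \<theta>) powr (- Re z) + (real m + (1 - \<theta>)) powr (- Re z))"
    using \<theta> z by (intro summable_add summable_shifted_powr) auto
  have ai: "?g m absolutely_integrable_on {0<..}" for m
    by (intro set_integral_diff Gamma_integral_scaled z0 pq)
  have int_g: "integral {0<..} (?g m) = Gamma z / of_real (p m) powr z - Gamma z / of_real (q m) powr z" for m
    using Gamma_integral_scaled[OF z0 pq(1)[of m]] Gamma_integral_scaled[OF z0 pq(2)[of m]]
    by (subst Henstock_Kurzweil_Integration.integral_diff) (auto intro: set_lebesgue_integral_eq_integral(1))
  have F_sums: "(\<lambda>m. ?g m w) sums F w" and nsum: "summable (\<lambda>m. norm (?g m w))" if w: "w \<in> {0<..}" for w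
  proof -
    let ?u = "of_real w powr (z - 1) * complex_of_real (exp (- w))"
    have aw: "a * w > 0" using a w by simp
    have "- (p m * w) = - w + - (a * w * (real m + \<theta>))" "- (q m * w) = - w + - (a * w * (real m + (1 - \<theta>)))" for m
      by (simp_all add: p_def q_def algebra_simps)
    hence e: "?e (p m) w = ?u * of_real (exp (- (a * w * (real m + \<theta>))))" 
      "?e (q m) w = ?u * of_real (exp (- (a * w * (real m + (1 - \<theta>)))))" for m
      by (simp_all only: exp_add of_real_mult mult.assoc)
    note s = exp_neg_sums[OF aw, of \<theta>] exp_neg_sums[OF aw, of "1 - \<theta>"]
    have "(\<lambda>m. ?u * of_real (exp (- (a * w * (real m + \<theta>))) - exp (- (a * w * (real m + (1 - \<theta>)))))) sums
      (?u * of_real (exp (- (a * w * \<theta>)) / (1 - exp (- (a * w))) - exp (- (a * w * (1 - \<theta>))) / (1 - exp (- (a * w)))))"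
      by (intro sums_mult sums_of_real sums_diff s)
    thus "(\<lambda>m. ?g m w) sums F w"
      unfolding F_def e diff_divide_distrib right_diff_distrib[symmetric] of_real_diff .
    show "summable (\<lambda>m. norm (?g m w))"
    proof (rule summable_comparison_test')
      show "summable (\<lambda>m. norm ?u * (exp (- (a * w * (real m + \<theta>))) + exp (- (a * w * (real m + (1 - \<theta>))))))"
        using s by (intro summable_mult summable_add) (auto simp: sums_iff)
      show "norm (norm (?g m w)) \<le> norm ?u * (exp (- (a * w * (real m + \<theta>))) + exp (- (a * w * (real m + (1 - \<theta>)))))" if "m \<ge> 0" for m
      proof -
        have "norm (?g m w) \<le> norm (?e (p m) w) + norm (?e (q m) w)" by (rule norm_triangle_ineq4)
        also have "\<dots> = norm ?u * (exp (- (a * w * (real m + \<theta>))) + exp (- (a * w * (real m + (1 - \<theta>)))))"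
          unfolding e norm_mult[of ?u] norm_of_real by (simp add: distrib_left)
        finally show ?thesis by simp
      qed
    qed
  qed
  have F_eq: "(\<Sum>m. ?g m w) = F w" if "w \<in> {0<..}" for w
    using F_sums[OF that] by (rule sums_unique[symmetric])
  have ni: "integral {0<..} (\<lambda>w. norm (?g m w)) \<le> a powr (- Re z) * (Gamma (Re z) * ((real m + \<theta>) powr (- Re z) + (real m + (1 - \<theta>)) powr (- Re z)))" for m
  proof -
    have i: "(\<lambda>w. norm (?e b w)) integrable_on {0<..}" if "b > 0" for b
      using absolutely_integrable_norm[OF Gamma_integral_scaled(1)[OF z0 that]]
      by (auto simp: o_def intro: set_lebesgue_integral_eq_integral(1))
    have "integral {0<..} (\<lambda>w. norm (?g m w)) \<le> integral {0<..} (\<lambda>w. norm (?e (p m) w) + norm (?e (q m) w))"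
    proof (rule integral_le)
      show "(\<lambda>w. norm (?g m w)) integrable_on {0<..}"
        using absolutely_integrable_norm[OF ai[of m]] by (auto simp: o_def intro: set_lebesgue_integral_eq_integral(1))
      show "(\<lambda>w. norm (?e (p m) w) + norm (?e (q m) w)) integrable_on {0<..}"
        by (intro integrable_add i pq)
    qed (rule norm_triangle_ineq4)
    also have "\<dots> = Gamma (Re z) / p m powr Re z + Gamma (Re z) / q m powr Re z"
      by (subst Henstock_Kurzweil_Integration.integral_add) (simp_all only: i pq Gamma_integral_scaled_norm[OF z0])
    also have "\<dots> = Gamma (Re z) * (p m powr (- Re z) + q m powr (- Re z))"
      by (simp add: powr_minus divide_inverse distrib_left)
    also have "\<dots> \<le> Gamma (Re z) * ((a * (real m + \<theta>)) powr (- Re z) + (a * (real m + (1 - \<theta>))) powr (- Re z))"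
    proof (intro mult_left_mono add_mono powr_mono2')
      show "0 < a * (real m + \<theta>)" "0 < a * (real m + (1 - \<theta>))"
        using a \<theta> by (auto intro!: mult_pos_pos add_nonneg_pos)
      show "a * (real m + \<theta>) \<le> p m" "a * (real m + (1 - \<theta>)) \<le> q m"
        by (simp_all add: p_def q_def add_diff_eq)
    qed (use z Gamma_real_pos[OF z0] in auto)
    also have "\<dots> = a powr (- Re z) * (Gamma (Re z) * ((real m + \<theta>) powr (- Re z) + (real m + (1 - \<theta>)) powr (- Re z)))"
    proof -
      have "(a * (real m + \<theta>)) powr r = a powr r * (real m + \<theta>) powr r"
        "(a * (real m + (1 - \<theta>))) powr r = a powr r * (real m + (1 - \<theta>)) powr r" for r
        using a \<theta> by (auto intro!: powr_mult)
      thus ?thesis by (simp only: distrib_left mult_ac)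
    qed
    finally show ?thesis .
  qed
  have nn: "0 \<le> integral {0<..} (\<lambda>w. norm (?g m w))" for m
    using ai[of m] by (intro Henstock_Kurzweil_Integration.integral_nonneg) (simp_all only: absolutely_integrable_on_def norm_ge_zero)
  have sM: "summable (\<lambda>m. a powr (- Re z) * (Gamma (Re z) * ((real m + \<theta>) powr (- Re z) + (real m + (1 - \<theta>)) powr (- Re z))))"
    by (intro summable_mult sB)
  have isum: "summable (\<lambda>m. integral {0<..} (\<lambda>w. norm (?g m w)))"
    by (rule summable_comparison_test'[OF sM]) (unfold real_norm_def abs_of_nonneg[OF nn], rule ni)
  note lim = absolutely_integrable_suminf[where f = ?g, OF ai nsum isum]
  have "(\<lambda>w. \<Sum>m. ?g m w) absolutely_integrable_on {0<..} \<longleftrightarrow> F absolutely_integrable_on {0<..}"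
    by (rule set_integrable_cong[OF refl refl F_eq])
  with lim(1) show "F absolutely_integrable_on {0<..}" by (simp only:)
  have "integral {0<..} (\<lambda>w. \<Sum>m. ?g m w) = integral {0<..} F"
    by (rule integral_cong[OF F_eq])
  with lim(2) show "integral {0<..} F = (\<Sum>m. Gamma z / of_real (p m) powr z - Gamma z / of_real (q m) powr z)"
    unfolding int_g by (simp only: sums_iff)
  have "integral {0<..} (\<lambda>w. norm (\<Sum>m. ?g m w)) = integral {0<..} (\<lambda>w. norm (F w))"
    by (rule integral_cong) (simp only: F_eq)
  with lim(3) have "integral {0<..} (\<lambda>w. norm (F w)) \<le> (\<Sum>m. integral {0<..} (\<lambda>w. norm (?g m w)))" by (simp only:)
  also have "\<dots> \<le> (\<Sum>m. a powr (- Re z) * (Gamma (Re z) * ((real m + \<theta>) powr (- Re z) + (real m + (1 - \<theta>)) powr (- Re z))))"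
    by (rule suminf_le[OF ni isum sM])
  also have "\<dots> = a powr (- Re z) * (Gamma (Re z) * B)"
    unfolding B_def using sB by (simp add: suminf_mult summable_mult)
  finally show "integral {0<..} (\<lambda>w. norm (F w)) \<le> a powr (- Re z) * (Gamma (Re z) * B)" .
qed

text \<open>With Re z = Re \<nu> + k + 1 the weight (d + 1)^k times (d + 1)^(-Re z) is (d + 1)^(-1 -
  Re \<nu>). This is summable exactly because Re \<nu> > 0, and it permits integration term by
  term.\<close>

lemma theta_integral:
  fixes \<nu> :: complex and c \<theta> :: real and k :: nat
  assumes \<nu>: "Re \<nu> > 0" and c: "c > 0" and \<theta>: "0 < \<theta>" "\<theta> < 1"
  defines "z \<equiv> \<nu> + of_nat k + 1"
  defines "T \<equiv> \<lambda>w. \<Sum>d. real (Suc d) ^ k * (exp (- (real (Suc d) * (c * w) * \<theta>)) - exp (- (real (Suc d) * (c * w) * (1 - \<theta>)))) / (1 - exp (- (real (Suc d) * (c * w))))"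
  defines "F \<equiv> \<lambda>w. of_real w powr (z - 1) * of_real (exp (- w)) * complex_of_real (T w)"
  shows "F absolutely_integrable_on {0<..}"
    and "integral {0<..} F = (\<Sum>d. of_nat (Suc d) ^ k * (\<Sum>m. Gamma z / of_real (1 + real (Suc d) * c * (real m + \<theta>)) powr z - Gamma z / of_real (1 + real (Suc d) * c * (real m + 1 - \<theta>)) powr z))"
proof -
  have z: "Re z > 1" using \<nu> by (simp add: z_def add_pos_nonneg)
  define e where "e d w = (exp (- (real (Suc d) * c * w * \<theta>)) - exp (- (real (Suc d) * c * w * (1 - \<theta>)))) / (1 - exp (- (real (Suc d) * c * w)))" for d w
  let ?u = "\<lambda>w. of_real w powr (z - 1) * complex_of_real (exp (- w))"
  let ?h = "\<lambda>d w. ?u w * complex_of_real (e d w)"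
  let ?g = "\<lambda>d w. of_nat (Suc d) ^ k * ?h d w"
  have a: "real (Suc d) * c > 0" for d using c by simp
  note inner = theta_integral_inner[OF z a \<theta>, folded e_def]
  define B where "B = (\<Sum>m. (real m + \<theta>) powr (- Re z) + (real m + (1 - \<theta>)) powr (- Re z))"
  have T: "T w = (\<Sum>d. real (Suc d) ^ k * e d w)" for w
    by (simp only: T_def e_def mult.assoc times_divide_eq_right)
  have ai: "?g d absolutely_integrable_on {0<..}" for d
    by (rule set_integrable_mult_right) (rule inner(1))
  have int_g: "integral {0<..} (?g d) = of_nat (Suc d) ^ k * (\<Sum>m. Gamma z / of_real (1 + real (Suc d) * c * (real m + \<theta>)) powr z - Gamma z / of_real (1 + real (Suc d) * c * (real m + 1 - \<theta>)) powr z)" for d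
    unfolding inner(2)[symmetric] by (rule integral_mult_right)
  have esum: "summable (\<lambda>d. norm (real (Suc d) ^ k * e d w))" if w: "w \<in> {0<..}" for w
  proof (rule summable_comparison_test')
    define b where "b = c * w"
    have b: "b > 0" using c w by (simp add: b_def)
    define \<mu> where "\<mu> = min \<theta> (1 - \<theta>)"
    have \<mu>: "0 < \<mu>" "\<mu> \<le> \<theta>" "\<mu> \<le> 1 - \<theta>" using \<theta> by (auto simp: \<mu>_def)
    show "summable (\<lambda>d. 1 / (1 - exp (- b)) * (real (Suc d) ^ k * exp (- (b * \<mu> * real d))))"
      using b \<mu> by (intro summable_mult summable_power_exp_neg) simp
    show "norm (norm (real (Suc d) ^ k * e d w)) \<le> 1 / (1 - exp (- b)) * (real (Suc d) ^ k * exp (- (b * \<mu> * real d)))" if "d \<ge> 0" for d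
    proof -
      have le: "exp (- (real (Suc d) * c * w * y)) \<le> exp (- (b * \<mu> * real d))" if "\<mu> \<le> y" for y
      proof -
        have "b * (\<mu> * real d) \<le> b * (y * real (Suc d))" using that b \<mu> by (intro mult_left_mono mult_mono) auto
        thus ?thesis by (simp add: b_def mult_ac)
      qed
      have "\<bar>x - y\<bar> \<le> M" if "0 < x" "0 < y" "x \<le> M" "y \<le> M" for x y M :: real using that by linarith
      from this[OF _ _ le[OF \<mu>(2)] le[OF \<mu>(3)]]
      have 1: "\<bar>exp (- (real (Suc d) * c * w * \<theta>)) - exp (- (real (Suc d) * c * w * (1 - \<theta>)))\<bar> \<le> exp (- (b * \<mu> * real d))" by simp
      have "1 * b \<le> real (Suc d) * b" using b by (intro mult_right_mono) auto
      hence "b \<le> real (Suc d) * c * w" by (simp add: b_def mult_ac)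
      hence 2: "1 - exp (- b) \<le> 1 - exp (- (real (Suc d) * c * w))" by simp
      have "\<bar>e d w\<bar> \<le> exp (- (b * \<mu> * real d)) / (1 - exp (- b))"
        unfolding e_def abs_divide using 1 2 b by (intro frac_le) auto
      hence "real (Suc d) ^ k * \<bar>e d w\<bar> \<le> real (Suc d) ^ k * (exp (- (b * \<mu> * real d)) / (1 - exp (- b)))"
        by (intro mult_left_mono) auto
      thus ?thesis by (simp add: abs_mult mult_ac del: of_nat_Suc)
    qed
  qed
  have g: "?g d w = ?u w * of_real (real (Suc d) ^ k * e d w)" for d w
    by (simp only: of_real_mult of_real_power of_real_of_nat_eq mult_ac)
  have nsum: "summable (\<lambda>d. norm (?g d w))" if "w \<in> {0<..}" for w
    unfolding g norm_mult[of "?u w"] norm_of_real using esum[OF that] by (intro summable_mult) simp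
  have F_eq: "(\<Sum>d. ?g d w) = F w" if "w \<in> {0<..}" for w
  proof -
    have "(\<lambda>d. real (Suc d) ^ k * e d w) sums T w"
      unfolding T by (rule summable_sums[OF summable_norm_cancel[OF esum[OF that]]])
    hence "(\<lambda>d. ?g d w) sums F w" unfolding g F_def by (intro sums_mult sums_of_real)
    thus ?thesis by (rule sums_unique[symmetric])
  qed
  have ni: "integral {0<..} (\<lambda>w. norm (?g d w)) \<le> c powr (- Re z) * (Gamma (Re z) * B) * real (Suc d) powr (- (1 + Re \<nu>))" for d
  proof -
    have "integral {0<..} (\<lambda>w. norm (?g d w)) = real (Suc d) ^ k * integral {0<..} (\<lambda>w. norm (?h d w))"
      unfolding norm_mult[of "of_nat (Suc d) ^ k"] norm_power norm_of_nat by (rule integral_mult_right)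
    also have "\<dots> \<le> real (Suc d) ^ k * ((real (Suc d) * c) powr (- Re z) * (Gamma (Re z) * B))"
      unfolding B_def by (intro mult_left_mono inner(3)) simp
    also have "(real (Suc d) * c) powr (- Re z) = real (Suc d) powr (- Re z) * c powr (- Re z)"
      using c by (auto intro!: powr_mult simp del: of_nat_Suc)
    also have "real (Suc d) powr (- Re z) = real (Suc d) powr (- (1 + Re \<nu>)) / real (Suc d) ^ k"
    proof -
      have "- Re z = - (1 + Re \<nu>) - real k" by (simp add: z_def)
      thus ?thesis by (simp only: powr_diff powr_realpow of_nat_0_less_iff zero_less_Suc)
    qed
    also have "real (Suc d) ^ k * (real (Suc d) powr (- (1 + Re \<nu>)) / real (Suc d) ^ k * c powr (- Re z) * (Gamma (Re z) * B)) = 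
      c powr (- Re z) * (Gamma (Re z) * B) * real (Suc d) powr (- (1 + Re \<nu>))"
      by (simp del: of_nat_Suc)
    finally show ?thesis .
  qed
  have nn: "0 \<le> integral {0<..} (\<lambda>w. norm (?g d w))" for d
    using ai[of d] by (intro Henstock_Kurzweil_Integration.integral_nonneg) (simp_all only: absolutely_integrable_on_def norm_ge_zero)
  have sM: "summable (\<lambda>d. c powr (- Re z) * (Gamma (Re z) * B) * real (Suc d) powr (- (1 + Re \<nu>)))"
    using \<nu> by (intro summable_mult, subst summable_Suc_iff, simp add: summable_real_powr_iff)
  have isum: "summable (\<lambda>d. integral {0<..} (\<lambda>w. norm (?g d w)))"
    by (rule summable_comparison_test'[OF sM]) (unfold real_norm_def abs_of_nonneg[OF nn], rule ni)
  note lim = absolutely_integrable_suminf[where f = ?g, OF ai nsum isum]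
  have "(\<lambda>w. \<Sum>d. ?g d w) absolutely_integrable_on {0<..} \<longleftrightarrow> F absolutely_integrable_on {0<..}"
    by (rule set_integrable_cong[OF refl refl F_eq])
  with lim(1) show "F absolutely_integrable_on {0<..}" by (simp only:)
  have "integral {0<..} (\<lambda>w. \<Sum>d. ?g d w) = integral {0<..} F"
    by (rule integral_cong[OF F_eq])
  with lim(2) show "integral {0<..} F = (\<Sum>d. of_nat (Suc d) ^ k * (\<Sum>m. Gamma z / of_real (1 + real (Suc d) * c * (real m + \<theta>)) powr z - Gamma z / of_real (1 + real (Suc d) * c * (real m + 1 - \<theta>)) powr z))"
    unfolding int_g by (simp only: sums_iff)
qed

section \<open>The three Gamma integrals and the comparison of their constants\<close>

theorem theorem2p1:
  fixes a x \<theta> :: real and k :: nat and \<nu> :: complex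
  assumes "a > 0" and "x > 0" and "0 < \<theta>" and "\<theta> < 1"
    and "even k" and "Re \<nu> > 0"
  shows "complex_of_real (a\<^sup>2 * x / 4) powr (\<nu> / 2 + of_nat k + 1) *
      (\<Sum>n. complex_of_real (real (Suc n)) powr (\<nu> / 2) * besselK \<nu> (a * sqrt (real (Suc n) * x)) *
         complex_of_real (\<Sum>d | d dvd Suc n. real d ^ k * sin (2 * pi * real d * \<theta>)))
    = - complex_of_real ((-1) ^ (k div 2) * a ^ (2 * k + 2) * fact k / (2 ^ (2 * k + 4) * (2 * pi) ^ (k + 1)))
        * Gamma \<nu>
        * (if k = 0 then Lim (at (1::complex)) (\<lambda>s. hurwitz_zeta s \<theta> - hurwitz_zeta s (1 - \<theta>))
           else hurwitz_zeta (1 + of_nat k) \<theta> - hurwitz_zeta (1 + of_nat k) (1 - \<theta>))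
        * complex_of_real (x ^ (k + 1))
      + (if k = 0 then complex_of_real pi * Gamma (1 + \<nu>) / 4 * (hurwitz_zeta 0 \<theta> - hurwitz_zeta 0 (1 - \<theta>)) else 0)
      + complex_of_real ((-1) ^ (k div 2) / 4 * (2 * pi) ^ (k + 1)) *
        (\<Sum>d. of_nat (Suc d) ^ k *
          (\<Sum>m. Gamma (\<nu> + of_nat k + 1) /
                  complex_of_real (1 + 16 * pi\<^sup>2 * real (Suc d) / (a\<^sup>2 * x) * (real m + \<theta>)) powr (1 + \<nu> + of_nat k)
                - Gamma (\<nu> + of_nat k + 1) /
                  complex_of_real (1 + 16 * pi\<^sup>2 * real (Suc d) / (a\<^sup>2 * x) * (real m + 1 - \<theta>)) powr (1 + \<nu> + of_nat k)))"
proof -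
  define X where "X = a\<^sup>2 * x / 4"
  define c where "c = 4 * pi\<^sup>2 / X"
  define sg :: real where "sg = (-1) ^ (k div 2)"
  define P where "P = Polygamma k (1 - \<theta>) - Polygamma k \<theta>"
  define \<sigma> where "\<sigma> n = (\<Sum>d | d dvd Suc n. real d ^ k * sin (2 * pi * real d * \<theta>))" for n
  define S where "S t = (\<Sum>n. \<sigma> n * exp (- (real (Suc n) * t)))" for t
  define T where "T w = (\<Sum>d. real (Suc d) ^ k * (exp (- (real (Suc d) * (c * w) * \<theta>)) - exp (- (real (Suc d) * (c * w) * (1 - \<theta>)))) / (1 - exp (- (real (Suc d) * (c * w)))))" for w
  define z where "z = \<nu> + of_nat k + 1"
  \<comment> \<open>Multiplying by \<open>q\<close> undoes the factor (-1)^(k/2) (2 pi)^k in front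
    of the Lambert series, the sign being its own inverse. \<open>A\<close>, \<open>B\<close>,
    \<open>C\<close> are then the coefficients of 1, w and w^(k+1) T(w) in S(X/w).\<close>
  define q where "q = sg / (2 * pi) ^ k"
  define A where "A = - q * (P / (4 * pi))"
  define B where "B = (if k = 0 then pi * (1 - 2 * \<theta>) / (2 * X) else 0)"
  define C where "C = q * (pi / X) * c ^ k"
  define R where "R = (\<Sum>d. of_nat (Suc d) ^ k * (\<Sum>m. Gamma z / of_real (1 + real (Suc d) * c * (real m + \<theta>)) powr z - Gamma z / of_real (1 + real (Suc d) * c * (real m + 1 - \<theta>)) powr z))"
  have X: "X > 0" using assms by (simp add: X_def)
  have c: "c > 0" using X by (simp add: c_def)
  have sg: "sg * sg = 1" by (simp add: sg_def flip: power_mult_distrib)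

  have pk: "complex_of_real y powr of_nat n = of_real y ^ n" if "y > 0" for y n
    using that by (simp add: powr_nat)
  have S_eq: "S (X / w) = A + B * w + C * (w ^ (k + 1) * T w)" if w: "w > 0" for w
  proof -
    have t: "X / w > 0" using X w by simp
    have ct: "4 * pi\<^sup>2 / (X / w) = c * w" by (simp add: c_def)
    have "S (X / w) = (\<Sum>d. real (Suc d) ^ k * sin (2 * pi * \<theta> * real (Suc d)) / (exp (real (Suc d) * (X / w)) - 1))"
      unfolding S_def \<sigma>_def by (rule lambert_divisor_series[OF t])
    with sin_power_lambert_theta[OF t assms(3,4,5), unfolded ct]
    have "sg * (2 * pi) ^ k * S (X / w) = - P / (4 * pi) + (if k = 0 then pi * (1 - 2 * \<theta>) / (2 * (X / w)) else 0) + pi / (X / w) * ((c * w) ^ k * T w)"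
      by (simp only: sg_def P_def T_def)
    also have "(if k = 0 then pi * (1 - 2 * \<theta>) / (2 * (X / w)) else 0) = B * w"
      by (simp add: B_def)
    finally have "q * (sg * (2 * pi) ^ k * S (X / w)) = q * (- P / (4 * pi) + B * w + pi / (X / w) * ((c * w) ^ k * T w))"
      by (rule arg_cong)
    also have "q * (sg * (2 * pi) ^ k * S (X / w)) = (sg * sg) * S (X / w)" by (simp add: q_def)
    also have "q * (- P / (4 * pi) + B * w + pi / (X / w) * ((c * w) ^ k * T w)) =
      A + q * B * w + C * (w ^ (k + 1) * T w)"
      by (simp add: A_def C_def algebra_simps power_mult_distrib)
    \<comment> \<open>\<open>B\<close> is nonzero only for k = 0, and then \<open>q\<close> is
      1.\<close>
    also have "q * B = B" by (simp add: B_def q_def sg_def)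
    finally show ?thesis by (simp add: sg)
  qed

  let ?G = "\<lambda>s w. complex_of_real w powr (s - 1) * of_real (exp (- w))"
  let ?F = "\<lambda>w. of_real w powr (z - 1) * of_real (exp (- w)) * complex_of_real (T w)"
  have G: "?G s absolutely_integrable_on {0<..}" "integral {0<..} (?G s) = Gamma s" if "Re s > 0" for s
    using Gamma_integral_scaled[OF that, of 1] by simp_all
  have F: "?F absolutely_integrable_on {0<..}" "integral {0<..} ?F = R"
    unfolding R_def T_def z_def by (rule theta_integral[OF assms(6) c assms(3,4)])+
  have \<nu>1: "Re (\<nu> + 1) > 0" using assms(6) by simp
  have "integral {0<..} (\<lambda>w. ?G \<nu> w * of_real (S (X / w))) =
    integral {0<..} (\<lambda>w. of_real A * ?G \<nu> w + of_real B * ?G (\<nu> + 1) w + of_real C * ?F w)"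
  proof (rule integral_cong)
    fix w :: real assume w: "w \<in> {0<..}"
    have p1: "complex_of_real w powr (\<nu> + 1 - 1) = of_real w powr (\<nu> - 1) * of_real w"
      using w powr_add[of "complex_of_real w" "\<nu> - 1" 1] by simp
    \<comment> \<open>The factor w^(k+1) arises from (c w)^k and from pi/t = pi w/X; it raises the
      Gamma exponent from \<nu> to z = \<nu> + k + 1.\<close>
    have "z - 1 = (\<nu> - 1) + of_nat (k + 1)" by (simp add: z_def)
    hence p2: "complex_of_real w powr (z - 1) = of_real w powr (\<nu> - 1) * of_real w ^ (k + 1)"
      using pk[of w "k + 1"] w by (simp only: powr_add greaterThan_iff)
    have "S (X / w) = A + B * w + C * (w ^ (k + 1) * T w)" using w by (intro S_eq) simp
    thus "?G \<nu> w * of_real (S (X / w)) = of_real A * ?G \<nu> w + of_real B * ?G (\<nu> + 1) w + of_real C * ?F w"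
      unfolding p1 p2 by (simp add: algebra_simps)
  qed
  also have "\<dots> = of_real A * Gamma \<nu> + of_real B * Gamma (\<nu> + 1) + of_real C * R"
  proof -
    have hG: "(?G s has_integral Gamma s) {0<..}" if "Re s > 0" for s
      using G[OF that] set_lebesgue_integral_eq_integral(1) has_integral_iff by blast
    have hF: "(?F has_integral R) {0<..}"
      using F set_lebesgue_integral_eq_integral(1) has_integral_iff by blast
    show ?thesis
      by (rule integral_unique[OF has_integral_add[OF has_integral_add[OF
            has_integral_mult_right[OF hG[OF assms(6)]] has_integral_mult_right[OF hG[OF \<nu>1]]]
            has_integral_mult_right[OF hF]]])
  qed
  finally have I: "integral {0<..} (\<lambda>w. ?G \<nu> w * of_real (S (X / w))) = of_real A * Gamma \<nu> + of_real B * Gamma (\<nu> + 1) + of_real C * R" .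

  have arg: "a * sqrt (real (Suc n) * x) = 2 * sqrt (real (Suc n) * X)" for n
  proof -
    have "sqrt (real (Suc n) * X) = sqrt ((a / 2)\<^sup>2 * (real (Suc n) * x))"
      by (simp add: X_def power_divide mult_ac del: of_nat_Suc)
    also have "\<dots> = a / 2 * sqrt (real (Suc n) * x)"
      using assms(1) by (subst real_sqrt_mult) simp
    finally show ?thesis by simp
  qed
  let ?L = "\<Sum>n. complex_of_real (real (Suc n)) powr (\<nu> / 2) * besselK \<nu> (a * sqrt (real (Suc n) * x)) * complex_of_real (\<sigma> n)"
  have e1: "of_real X powr (\<nu> / 2) * ?L = integral {0<..} (\<lambda>w. ?G \<nu> w * of_real (S (X / w))) / 2"
    unfolding arg S_def
    by (rule bessel_series_conv_integral[OF assms(6) X, of \<sigma> "Suc k"]) (unfold \<sigma>_def, rule divisor_sum_bound)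
  have e2: "complex_of_real X powr (\<nu> / 2 + of_nat k + 1) = of_real (X ^ (k + 1)) * of_real X powr (\<nu> / 2)"
  proof -
    have "\<nu> / 2 + of_nat k + 1 = \<nu> / 2 + of_nat (k + 1)" by simp
    thus ?thesis using pk[OF X, of "k + 1"] by (simp only: powr_add mult.commute of_real_power)
  qed
  have alg: "of_real y * ((of_real A * u + of_real B * v + of_real C * r) / 2) =
      of_real (y * A / 2) * u + of_real (y * B / 2) * v + of_real (y * C / 2) * r" for y and u v r :: complex
    by (simp add: algebra_simps add_divide_distrib)
  have "of_real X powr (\<nu> / 2 + of_nat k + 1) * ?L = of_real (X ^ (k + 1)) * (of_real X powr (\<nu> / 2) * ?L)"
    unfolding e2 by (rule mult.assoc)
  hence L: "of_real X powr (\<nu> / 2 + of_nat k + 1) * ?L =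
      of_real (X ^ (k + 1) * A / 2) * Gamma \<nu> + of_real (X ^ (k + 1) * B / 2) * Gamma (\<nu> + 1) + of_real (X ^ (k + 1) * C / 2) * R"
    by (simp only: e1 I alg)

  let ?Z = "if k = 0 then Lim (at (1::complex)) (\<lambda>s. hurwitz_zeta s \<theta> - hurwitz_zeta s (1 - \<theta>))
           else hurwitz_zeta (1 + of_nat k) \<theta> - hurwitz_zeta (1 + of_nat k) (1 - \<theta>)"
  \<comment> \<open>For even k the sign (-1)^(k+1) is -1, so the difference taken at \<theta> and 1
    - \<theta> appears in \<open>P\<close> with its two terms interchanged. For k = 0 the limit
    yields the same expression with Digamma.\<close>
  have Z: "?Z = of_real (P / fact k)"
  proof (cases "k = 0")
    case True
    thus ?thesis using hurwitz_zeta_diff_Lim[OF assms(3,4)] by (simp add: P_def)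
  next
    case False
    hence "k > 0" by simp
    thus ?thesis using False hurwitz_zeta_Suc[of \<theta> k] hurwitz_zeta_Suc[of "1 - \<theta>" k] assms(3-5)
      by (simp add: P_def diff_divide_distrib)
  qed
  have X_power: "X ^ (k + 1) = a ^ (2 * k + 2) * x ^ (k + 1) / 2 ^ (2 * k + 2)"
  proof -
    have "X ^ (k + 1) = (a\<^sup>2 * x / 2\<^sup>2) ^ (k + 1)" by (simp add: X_def)
    also have "\<dots> = a ^ (2 * (k + 1)) * x ^ (k + 1) / 2 ^ (2 * (k + 1))"
      unfolding power_divide power_mult_distrib power_mult ..
    finally show ?thesis by simp
  qed
  have "X ^ (k + 1) * A / 2 = - (sg * a ^ (2 * k + 2) * fact k / (2 ^ (2 * k + 4) * (2 * pi) ^ (k + 1))) * (P / fact k) * x ^ (k + 1)"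
    unfolding X_power A_def q_def by (simp add: power_add field_simps)
  hence 1: "of_real (X ^ (k + 1) * A / 2) * Gamma \<nu> = - complex_of_real (sg * a ^ (2 * k + 2) * fact k / (2 ^ (2 * k + 4) * (2 * pi) ^ (k + 1)))
        * Gamma \<nu> * ?Z * complex_of_real (x ^ (k + 1))"
    unfolding Z by (simp only: of_real_mult of_real_minus mult_ac)
  \<comment> \<open>For k = 0 the X cancels, and 1 - 2\<theta> is the difference of the zeta values
    1/2 - \<theta> and \<theta> - 1/2 at 0.\<close>
  have 2: "of_real (X ^ (k + 1) * B / 2) * Gamma (\<nu> + 1) = 
    (if k = 0 then complex_of_real pi * Gamma (1 + \<nu>) / 4 * (hurwitz_zeta 0 \<theta> - hurwitz_zeta 0 (1 - \<theta>)) else 0)"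
    using X assms(3,4) by (simp add: B_def hurwitz_zeta_0 field_simps)
  \<comment> \<open>Since X c = (2 pi)^2, all dependence on X disappears and one power (2 pi)^k
    survives the division in \<open>q\<close>.\<close>
  have 3: "X ^ (k + 1) * C / 2 = sg / 4 * (2 * pi) ^ (k + 1)"
  proof -
    have "X ^ (k + 1) * C / 2 = sg * (pi / 2) * ((X * c) ^ k / (2 * pi) ^ k)"
      using X by (simp add: C_def q_def power_mult_distrib[of X c] mult_ac)
    also have "X * c = (2 * pi) * (2 * pi)" using X by (simp add: c_def power2_eq_square)
    also have "((2 * pi) * (2 * pi)) ^ k / (2 * pi) ^ k = (2 * pi) ^ k"
      unfolding power_mult_distrib[of "2 * pi" "2 * pi"] by (rule nonzero_mult_div_cancel_left) simp
    finally show ?thesis by simp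
  qed
  have R_eq: "R = (\<Sum>d. of_nat (Suc d) ^ k *
          (\<Sum>m. Gamma (\<nu> + of_nat k + 1) /
                  complex_of_real (1 + 16 * pi\<^sup>2 * real (Suc d) / (a\<^sup>2 * x) * (real m + \<theta>)) powr (1 + \<nu> + of_nat k)
                - Gamma (\<nu> + of_nat k + 1) /
                  complex_of_real (1 + 16 * pi\<^sup>2 * real (Suc d) / (a\<^sup>2 * x) * (real m + 1 - \<theta>)) powr (1 + \<nu> + of_nat k)))"
  proof -
    have "real (Suc d) * c = 16 * pi\<^sup>2 * real (Suc d) / (a\<^sup>2 * x)" for d
      by (simp add: c_def X_def)
    moreover have "1 + \<nu> + of_nat k = z" by (simp add: z_def)
    ultimately show ?thesis by (simp only: R_def z_def)
  qed
  show ?thesis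
    using L[unfolded 1 2 3 R_eq] by (simp only: X_def \<sigma>_def sg_def)
qed

end
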